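(* Let $n\geq 2$. For $j=1,\dots,n$, let $K_j$ be a compact subset of $\mathbb{C}$, and let $K=K_1\times\dots\times K_n\subset\mathbb{C}^n$ be their cartesian product. If $K$ is regular, then $H^{0,n-1}_{W^1}(K)=0$.
   Context: A non-empty compact set $K$ is called regular if there is an open set $V$ with $K=\overline V$ and $V=\mathrm{interior}(K)$. $W^1_{p,q}(\mathbb{C}^n)$ denotes $(p,q)$-forms whose coefficients lie in the Sobolev space $W^1(\mathbb{C}^n)$ of $L^2$ functions with all first partial derivatives in $L^2$. For a regular compact $K\subset\mathbb{C}^n$, the notation $H^{p,q}_{W^1}(K)=0$ means: if $f\in W^1_{p,q}(\mathbb{C}^n)$ satisfies $\overline\partial f=0$ on the set $K$, then there is $u\in W^1_{p,q-1}(\mathbb{C}^n)$ such that $\overline\partial u=f$ on the set $K$ (equalities of forms with $L^2$ coefficients, i.e. almost everywhere on $K$). *)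

theory Defs
  imports "HOL-Analysis.Analysis"
begin

definition regular_compact :: "'a::metric_space set \<Rightarrow> bool" where
  "regular_compact K \<longleftrightarrow>
     K \<noteq> {} \<and> compact K \<and> (\<exists>V. open V \<and> K = closure V \<and> V = interior K)"

text \<open>\<open>Ck k \<phi>\<close>: the function \<open>\<phi>\<close> is \<open>k\<close> times continuously differentiable on the whole space.\<close>

fun Ck :: "nat \<Rightarrow> ('a::euclidean_space \<Rightarrow> real) \<Rightarrow> bool" where
  "Ck 0 \<phi> \<longleftrightarrow> continuous_on UNIV \<phi>"
| "Ck (Suc k) \<phi> \<longleftrightarrow> (\<forall>x. \<phi> differentiable (at x)) \<and>
     (\<forall>b\<in>Basis. Ck k (\<lambda>x. frechet_derivative \<phi> (at x) b))"

definition test_function :: "('a::euclidean_space \<Rightarrow> real) \<Rightarrow> bool" where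
  "test_function \<phi> \<longleftrightarrow> (\<forall>k. Ck k \<phi>) \<and> compact (closure {x. \<phi> x \<noteq> 0})"

text \<open>
  Elements of \<open>L\<^sup>2\<close> and \<open>W\<^sup>1\<close> are represented by Borel functions, and statements about them
  are made up to Lebesgue null sets; every a.e.-class of Lebesgue measurable functions has a Borel
  representative.
\<close>

definition L2 :: "('a::euclidean_space \<Rightarrow> complex) set" where
  "L2 = {f \<in> borel_measurable lborel. integrable lborel (\<lambda>x. (cmod (f x))\<^sup>2)}"

definition has_weak_deriv ::
    "('a::euclidean_space \<Rightarrow> complex) \<Rightarrow> 'a \<Rightarrow> ('a \<Rightarrow> complex) \<Rightarrow> bool" where
  "has_weak_deriv f b g \<longleftrightarrow> (\<forall>\<phi>. test_function \<phi> \<longrightarrow>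
     (LINT x|lborel. frechet_derivative \<phi> (at x) b *\<^sub>R f x) = - (LINT x|lborel. \<phi> x *\<^sub>R g x))"

definition W1 :: "('a::euclidean_space \<Rightarrow> complex) set" where
  "W1 = {f \<in> L2. \<forall>b\<in>Basis. \<exists>g\<in>L2. has_weak_deriv f b g}"

text \<open>
  A representative of the weak derivative; it is determined up to a null set when \<open>f\<close> is in \<open>W1\<close>
  and \<open>b\<close> in \<open>Basis\<close>, and is used only in a.e. statements about such \<open>f\<close> and \<open>b\<close>.
\<close>

definition weak_deriv ::
    "('a::euclidean_space \<Rightarrow> complex) \<Rightarrow> 'a \<Rightarrow> 'a \<Rightarrow> complex" where
  "weak_deriv f b = (SOME g. g \<in> L2 \<and> has_weak_deriv f b g)"

text \<open>
  \<open>\<partial>/\<partial>z\<^bsub>j\<^esub>-bar = (\<partial>/\<partial>x\<^bsub>j\<^esub> + i \<partial>/\<partial>y\<^bsub>j\<^esub>) / 2\<close>; here \<open>axis j 1\<close> and \<open>axis j \<i>\<close> are the members of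
  \<open>Basis\<close> pointing in the directions of \<open>x\<^bsub>j\<^esub>\<close> and \<open>y\<^bsub>j\<^esub>\<close>.
\<close>

definition d_zbar ::
    "'n::finite \<Rightarrow> (complex ^ 'n \<Rightarrow> complex) \<Rightarrow> complex ^ 'n \<Rightarrow> complex" where
  "d_zbar j f z = (weak_deriv f (axis j 1) z + \<i> * weak_deriv f (axis j \<i>) z) / 2"

text \<open>
  The \<open>(p,q)\<close>-form \<open>\<Sum> f I J dz\<^bsub>I\<^esub> \<and> dz\<^bsub>J\<^esub>-bar\<close>, summed over \<open>I\<close> with \<open>p\<close> and \<open>J\<close> with \<open>q\<close> elements (the
  factors of \<open>dz\<^bsub>I\<^esub>\<close> and \<open>dz\<^bsub>J\<^esub>-bar\<close> in increasing order of the indices), is given by its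
  coefficients \<open>f\<close>. Values of \<open>f\<close> at index sets of other cardinalities are irrelevant.
\<close>

type_synonym 'n form = "'n set \<Rightarrow> 'n set \<Rightarrow> complex ^ 'n \<Rightarrow> complex"

definition W1_form :: "nat \<Rightarrow> nat \<Rightarrow> ('n::finite) form \<Rightarrow> bool" where
  "W1_form p q f \<longleftrightarrow> (\<forall>I J. card I = p \<longrightarrow> card J = q \<longrightarrow> f I J \<in> W1)"

text \<open>
  The sign comes from moving \<open>dz\<^bsub>j\<^esub>-bar\<close> past \<open>dz\<^bsub>I\<^esub>\<close> and past those factors of \<open>dz\<^bsub>L - {j}\<^esub>-bar\<close> whose
  index is below \<open>j\<close>.
\<close>

definition dbar :: "('n::{finite,linorder}) form \<Rightarrow> 'n form" where
  "dbar f I L z =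
     (\<Sum>j\<in>L. (-1) ^ (card I + card {i\<in>L. i < j}) * d_zbar j (f I (L - {j})) z)"

definition form_eq_on ::
    "(complex ^ 'n) set \<Rightarrow> nat \<Rightarrow> nat \<Rightarrow> ('n::finite) form \<Rightarrow> 'n form \<Rightarrow> bool" where
  "form_eq_on K p q f g \<longleftrightarrow> (\<forall>I J. card I = p \<longrightarrow> card J = q \<longrightarrow>
     (AE z in lborel. z \<in> K \<longrightarrow> f I J z = g I J z))"

text \<open>
  \<open>H\<^bsup>p,q\<^esup>\<^bsub>W\<^sup>1\<^esub>(K) = 0\<close>. For \<open>q = 0\<close>, where \<open>q - 1\<close> is truncated to 0, the coefficients of bidegree
  \<open>(p,0)\<close> of \<open>dbar u\<close> are empty sums, so that the condition correctly requires \<open>f = 0\<close> on \<open>K\<close>.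
\<close>

definition H_W1_vanishes ::
    "nat \<Rightarrow> nat \<Rightarrow> (complex ^ 'n::{finite,linorder}) set \<Rightarrow> bool" where
  "H_W1_vanishes p q K \<longleftrightarrow>
     (\<forall>f. W1_form p q f \<and> form_eq_on K p (q + 1) (dbar f) (\<lambda>I J z. 0) \<longrightarrow>
        (\<exists>u. W1_form p (q - 1) u \<and> form_eq_on K p q (dbar u) f))"

end

theory Submission
  imports Defs
begin

text \<open>
  Up to signs a \<open>(0,n-1)\<close>-form is a vector field \<open>F\<close> whose component \<open>F\<^sub>j\<close> is
  the coefficient that omits the \<open>j\<close>-th differential. Its image under \<open>dbar\<close> is the divergence,
  the sum of the derivatives of the \<open>F\<^sub>j\<close> by the \<open>j\<close>-th conjugate variable, and a
  \<open>(0,n-2)\<close>-form is an antisymmetric matrix. The task is to write a field whose divergence vanishes on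
  \<open>K\<close> as the row-wise divergence of an antisymmetric \<open>W\<^sup>1\<close> matrix, on \<open>K\<close>.
  Let \<open>a\<close> be the least index. A matrix that is zero outside the row and the column of \<open>a\<close>
  suffices, so that functions \<open>Y\<^sub>l\<close> for \<open>l\<close> different from \<open>a\<close> are wanted.

  Multiply \<open>F\<close> by a cutoff and let \<open>g\<close> be the divergence of the product \<open>G\<close>. It
  still vanishes almost everywhere on \<open>K\<close>. Let \<open>g\<^sub>1\<close> be the part of \<open>g\<close> on
  the set where \<open>z\<^sub>a\<close> is not in \<open>K\<^sub>a\<close>. Since \<open>K\<close> is a product,
  \<open>g - g\<^sub>1\<close> vanishes wherever all the other coordinates \<open>z\<^sub>l\<close> are in
  \<open>K\<^sub>l\<close>. There are two solution operators: \<open>S\<close> acts in the variables other than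
  \<open>z\<^sub>a\<close> and produces a field \<open>S\<^sub>l g\<close> with divergence \<open>g\<close>, and
  \<open>T\<close> acts in \<open>z\<^sub>a\<close> and inverts the operator of that variable. An operator does not move
  the variables in which it does not act, so \<open>S g\<^sub>1\<close> vanishes for \<open>z\<^sub>a\<close> in
  \<open>K\<^sub>a\<close>, and \<open>T (g - g\<^sub>1)\<close> vanishes on \<open>K\<close>. Put
  \<open>Y\<^sub>l = T (G\<^sub>l - S\<^sub>l g\<^sub>1)\<close>. Its derivative by the conjugate of
  \<open>z\<^sub>a\<close> is \<open>G\<^sub>l - S\<^sub>l g\<^sub>1\<close>, which is \<open>F\<^sub>l\<close> on
  \<open>K\<close>, and minus the sum of the derivatives of the \<open>Y\<^sub>l\<close> in the other variables is
  \<open>G\<^sub>a - T (g - g\<^sub>1)\<close>, which is \<open>F\<^sub>a\<close> on \<open>K\<close>. Each operator gains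
  one derivative in its own variables and commutes with the derivatives in the others, and therefore
  \<open>Y\<^sub>l\<close> is in \<open>W\<^sup>1\<close>. This is \<open>divergence_free_on_product\<close>.

  Both operators come from \<open>dbar_solution\<close>. On a real space of dimension \<open>2 m\<close> the field
  \<open>x / |x|\<^bsup>2m\<^esup>\<close> is a gradient whose divergence is a multiple of the Dirac measure. The kernels
  are cut off at infinity, which keeps all functions square integrable and costs an error term supported too far away to
  be seen on \<open>K\<close>. That convolution with them gains a derivative in \<open>L\<^sup>2\<close> is proved without
  the Fourier transform. If the singularity at the origin is also cut off, the divergence of the kernel becomes an
  approximate identity (\<open>conv_approximate_identity\<close>) minus the error term. The field is curl-free and so is
  its convolution with \<open>g\<close>, and therefore the \<open>L\<^sup>2\<close> norm of all derivatives of the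
  convolution is that of its divergence (\<open>curl_free_norm\<close>). Hence the derivatives form a Cauchy sequence and
  converge (\<open>L2_complete\<close>), which gives \<open>divergence_solution\<close>.
\<close>

section \<open>Smooth functions with compact support\<close>

lemma CkI:
  assumes "\<And>x. (\<phi> has_derivative D x) (at x)" "\<And>b. b \<in> Basis \<Longrightarrow> Ck k (\<lambda>x. D x b)"
  shows "Ck (Suc k) \<phi>"
proof -
  have "frechet_derivative \<phi> (at x) = D x" for x
    using frechet_derivative_at[OF assms(1)] by simp
  then show ?thesis
    using assms by (auto simp: differentiable_def)
qed

lemma Ck_has_derivative:
  "Ck (Suc k) \<phi> \<Longrightarrow> (\<phi> has_derivative frechet_derivative \<phi> (at x)) (at x)"
  by (simp add: frechet_derivative_works[symmetric])

lemma Ck_Suc_imp: "Ck (Suc k) \<phi> \<Longrightarrow> Ck k \<phi>"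
proof (induction k arbitrary: \<phi>)
  case 0
  then show ?case
    by (auto intro!: differentiable_imp_continuous_on simp: differentiable_on_def)
next
  case (Suc k)
  then show ?case by auto
qed

lemma Ck_const: "Ck k (\<lambda>x. c)"
proof (induction k arbitrary: c)
  case (Suc k)
  show ?case
    by (rule CkI[where D = "\<lambda>x h. 0"]) (auto intro: Suc)
qed auto

lemma Ck_add: "Ck k f \<Longrightarrow> Ck k g \<Longrightarrow> Ck k (\<lambda>x. f x + g x)"
proof (induction k arbitrary: f g)
  case (Suc k)
  show ?case
    by (rule CkI[OF has_derivative_add[OF Ck_has_derivative[OF Suc.prems(1)]
            Ck_has_derivative[OF Suc.prems(2)]]])
       (use Suc in auto)
qed (auto intro: continuous_intros)

lemma Ck_mult: "Ck k f \<Longrightarrow> Ck k g \<Longrightarrow> Ck k (\<lambda>x. f x * g x)"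
proof (induction k arbitrary: f g)
  case (Suc k)
  have "Ck k f" "Ck k g" using Suc.prems Ck_Suc_imp by auto
  then show ?case
    by (intro CkI[OF has_derivative_mult[OF Ck_has_derivative[OF Suc.prems(1)]
            Ck_has_derivative[OF Suc.prems(2)]]] Ck_add Suc.IH)
       (use Suc.prems in auto)
qed (auto intro: continuous_intros)

lemma Ck_cmult: "Ck k f \<Longrightarrow> Ck k (\<lambda>x. c * f x)"
  by (intro Ck_mult Ck_const)

lemma Ck_prod: "finite A \<Longrightarrow> (\<And>i. i \<in> A \<Longrightarrow> Ck k (f i)) \<Longrightarrow> Ck k (\<lambda>x. \<Prod>i\<in>A. f i x)"
  by (induction A rule: finite_induct) (auto intro: Ck_const Ck_mult)

text \<open>
  The derivative of \<open>1/f\<close> is again a product of derivatives of \<open>f\<close> and of copies of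
  \<open>1/f\<close>, to which the induction hypothesis applies.
\<close>

lemma Ck_inverse: "Ck k f \<Longrightarrow> (\<And>x. f x \<noteq> 0) \<Longrightarrow> Ck k (\<lambda>x. inverse (f x))"
proof (induction k)
  case (Suc k)
  have k: "Ck k f" using Suc.prems Ck_Suc_imp by auto
  show ?case
  proof (rule CkI[OF Deriv.has_derivative_inverse[OF _ Ck_has_derivative[OF Suc.prems(1)]]])
    fix b :: 'a assume "b \<in> Basis"
    have "Ck k (\<lambda>x. (- 1) * (inverse (f x) * frechet_derivative f (at x) b * inverse (f x)))"
      using Suc k \<open>b \<in> Basis\<close> by (intro Ck_cmult Ck_mult) auto
    then show "Ck k (\<lambda>x. - (inverse (f x) * frechet_derivative f (at x) b * inverse (f x)))"
      by simp
  qed (use Suc.prems in auto)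
qed (auto intro: continuous_intros)

lemma Ck_compose_linear_form: "Ck k h \<Longrightarrow> Ck k (\<lambda>x. h (c + x \<bullet> v))"
proof (induction k arbitrary: h)
  case 0
  then have "continuous_on UNIV (h \<circ> (\<lambda>x. c + x \<bullet> v))"
    by (intro continuous_on_compose continuous_intros) (auto intro: continuous_on_subset)
  then show ?case by (simp add: o_def)
next
  case (Suc k)
  let ?h' = "\<lambda>y. frechet_derivative h (at y) 1"
  have d: "((\<lambda>x. h (c + x \<bullet> v)) has_derivative (\<lambda>u. frechet_derivative h (at (c + x \<bullet> v)) (u \<bullet> v))) (at x)" for x
    by (rule has_derivative_compose[OF _ Ck_has_derivative[OF Suc.prems]])
       (auto intro!: derivative_eq_intros)
  have lin: "frechet_derivative h (at y) t = t * ?h' y" for y t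
  proof -
    have "linear (frechet_derivative h (at y))"
      using Ck_has_derivative[OF Suc.prems] has_derivative_linear by blast
    from linear_scale[OF this, of t 1] show ?thesis by simp
  qed
  show ?case
  proof (rule CkI[OF d])
    fix b :: 'a
    have "Ck k ?h'" using Suc.prems by simp
    then have "Ck k (\<lambda>x. (b \<bullet> v) * ?h' (c + x \<bullet> v))"
      by (intro Ck_cmult Suc.IH)
    then show "Ck k (\<lambda>x. frechet_derivative h (at (c + x \<bullet> v)) (b \<bullet> v))"
      by (subst lin)
  qed
qed

lemma Ck_compose_affine: "Ck k h \<Longrightarrow> Ck k (\<lambda>x. h (c + s *\<^sub>R x))"
proof (induction k arbitrary: h)
  case 0
  then have "continuous_on UNIV (h \<circ> (\<lambda>x. c + s *\<^sub>R x))"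
    by (intro continuous_on_compose continuous_intros) (auto intro: continuous_on_subset)
  then show ?case by (simp add: o_def)
next
  case (Suc k)
  have d: "((\<lambda>x. h (c + s *\<^sub>R x)) has_derivative (\<lambda>u. frechet_derivative h (at (c + s *\<^sub>R x)) (s *\<^sub>R u))) (at x)" for x
    by (rule has_derivative_compose[OF _ Ck_has_derivative[OF Suc.prems]])
       (auto intro!: derivative_eq_intros)
  have lin: "frechet_derivative h (at y) (s *\<^sub>R t) = s * frechet_derivative h (at y) t" for y t
  proof -
    have "linear (frechet_derivative h (at y))"
      using Ck_has_derivative[OF Suc.prems] has_derivative_linear by blast
    from linear_scale[OF this, of s t] show ?thesis by simp
  qed
  show ?case
  proof (rule CkI[OF d])
    fix b :: 'a assume "b \<in> Basis"
    then have "Ck k (\<lambda>y. frechet_derivative h (at y) b)" using Suc.prems by simp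
    then have "Ck k (\<lambda>x. s * frechet_derivative h (at (c + s *\<^sub>R x)) b)"
      by (intro Ck_cmult Suc.IH)
    then show "Ck k (\<lambda>x. frechet_derivative h (at (c + s *\<^sub>R x)) (s *\<^sub>R b))"
      by (subst lin)
  qed
qed

text \<open>
  The functions \<open>exp (-1/x) / x\<^sup>k\<close>, extended by zero to the left. The derivative of each is a
  combination of two others, which makes smoothness an induction over the whole family.
\<close>

definition flat :: "nat \<Rightarrow> real \<Rightarrow> real" where
  "flat k x = (if x > 0 then exp (- inverse x) * inverse x ^ k else 0)"

lemma flat_at_right_0: "(flat k \<longlongrightarrow> 0) (at_right 0)"
proof -
  have "((\<lambda>x. inverse x ^ k / exp (inverse x :: real)) \<longlongrightarrow> 0) (at_right 0)"
    by (rule filterlim_compose[OF tendsto_power_div_exp_0 filterlim_inverse_at_top_right])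
  then show ?thesis
    by (rule Lim_transform_eventually)
       (auto simp: eventually_at_right_field flat_def exp_minus divide_inverse mult.commute intro: exI[of _ 1])
qed

lemma inverse_power_has_derivative:
  assumes "x \<noteq> (0::real)"
  shows "((\<lambda>x. inverse x ^ k) has_real_derivative - real k * inverse x ^ (k + 1)) (at x)"
proof (cases k)
  case (Suc n)
  show ?thesis
    using DERIV_power_Suc[OF DERIV_inverse, of x n] assms by (simp add: Suc power2_eq_square algebra_simps)
qed simp

lemma flat_has_derivative:
  "(flat k has_real_derivative (flat (k + 2) x - real k * flat (k + 1) x)) (at x)"
proof -
  consider "x > 0" | "x < 0" | "x = 0" by linarith
  then show ?thesis
  proof cases
    case 1
    have p: "((\<lambda>x. inverse x ^ k) has_real_derivative - real k * inverse x ^ (k + 1)) (at x)"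
      using 1 by (intro inverse_power_has_derivative) simp
    have e: "((\<lambda>x. exp (- inverse x)) has_real_derivative exp (- inverse x) * (inverse x)\<^sup>2) (at x)"
      using 1 by (auto intro!: derivative_eq_intros simp: power2_eq_square)
    have "((\<lambda>x. exp (- inverse x) * inverse x ^ k) has_real_derivative
        exp (- inverse x) * inverse x ^ (k + 2) - real k * (exp (- inverse x) * inverse x ^ (k + 1))) (at x)"
      using DERIV_mult[OF e p] by (simp add: power2_eq_square algebra_simps)
    then have "(flat k has_real_derivative
        exp (- inverse x) * inverse x ^ (k + 2) - real k * (exp (- inverse x) * inverse x ^ (k + 1))) (at x)"
      by (rule has_field_derivative_transform_within_open[where S = "{0<..}"])
         (use 1 in \<open>auto simp: flat_def\<close>)
    then show ?thesis using 1 by (simp add: flat_def)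
  next
    case 2
    have "((\<lambda>x. 0) has_real_derivative 0) (at x)" by simp
    then have "(flat k has_real_derivative 0) (at x)"
      by (rule has_field_derivative_transform_within_open[where S = "{..<0}"])
         (use 2 in \<open>auto simp: flat_def\<close>)
    then show ?thesis using 2 by (simp add: flat_def)
  next
    case 3
    have "((\<lambda>h. flat k h / h) \<longlongrightarrow> 0) (at_right 0)"
      by (rule Lim_transform_eventually[OF flat_at_right_0[of "Suc k"]])
         (auto simp: eventually_at_right_field flat_def divide_inverse intro: exI[of _ 1])
    moreover have "((\<lambda>h. flat k h / h) \<longlongrightarrow> 0) (at_left 0)"
      by (rule tendsto_eventually) (auto simp: eventually_at_left_field flat_def intro: exI[of _ "-1"])
    ultimately have "((\<lambda>h. flat k h / h) \<longlongrightarrow> 0) (at 0)"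
      by (simp add: filterlim_split_at)
    then show ?thesis using 3 by (simp add: DERIV_def flat_def)
  qed
qed

lemma Ck_flat: "Ck n (flat k)"
proof (induction n arbitrary: k)
  case 0
  show ?case
    using DERIV_isCont[OF flat_has_derivative] by (simp add: continuous_on_eq_continuous_at)
next
  case (Suc n)
  have "Ck n (\<lambda>x. flat (k + 2) x + (- real k) * flat (k + 1) x)"
    by (intro Ck_add Ck_cmult Suc)
  then show ?case
    by (intro CkI[OF flat_has_derivative[unfolded has_field_derivative_def]]) simp
qed

text \<open>
  The quotient is smooth because its denominator never vanishes. It is \<open>0\<close> on the negative half-line and
  \<open>1\<close> beyond \<open>1\<close>.
\<close>

definition step :: "real \<Rightarrow> real" where
  "step x = flat 0 x / (flat 0 x + flat 0 (1 - x))"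

text \<open>
  The derivative of \<open>step\<close>. Its explicit form shows the sign.
\<close>

definition step' :: "real \<Rightarrow> real" where
  "step' x = (flat 2 x * flat 0 (1 - x) + flat 0 x * flat 2 (1 - x)) / (flat 0 x + flat 0 (1 - x))\<^sup>2"

lemma flat_nonneg: "flat k x \<ge> 0"
  by (simp add: flat_def)

lemma flat_pos: "x > 0 \<Longrightarrow> flat k x > 0"
  by (simp add: flat_def)

lemma step_denominator_pos: "flat 0 x + flat 0 (1 - x) > 0"
proof -
  consider "x > 0" | "1 - x > 0" by linarith
  then show ?thesis
    by cases (use flat_pos flat_nonneg in \<open>auto intro: add_pos_nonneg add_nonneg_pos\<close>)
qed

lemma Ck_step: "Ck k step"
proof -
  have "Ck k (\<lambda>x::real. flat 0 (1 + x \<bullet> (-1)))"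
    by (intro Ck_compose_linear_form Ck_flat)
  then have "Ck k (\<lambda>x. flat 0 (1 - x))" by (simp add: inner_real_def)
  then have "Ck k (\<lambda>x. flat 0 x * inverse (flat 0 x + flat 0 (1 - x)))"
    by (intro Ck_mult Ck_inverse Ck_add Ck_flat) (use step_denominator_pos in \<open>auto simp: less_imp_neq\<close>, metis less_irrefl)
  then show ?thesis by (simp add: step_def[abs_def] divide_inverse)
qed

lemma step_nonpos: "x \<le> 0 \<Longrightarrow> step x = 0"
  by (simp add: step_def flat_def)

lemma step_ge_1: "x \<ge> 1 \<Longrightarrow> step x = 1"
  by (simp add: step_def flat_def)

lemma step_nonneg: "step x \<ge> 0"
  using flat_nonneg by (simp add: step_def)

lemma step_le_1: "step x \<le> 1"
  using flat_nonneg[of 0 "1 - x"] step_denominator_pos[of x] by (simp add: step_def)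

lemma step_has_derivative: "(step has_real_derivative step' x) (at x)"
proof -
  have d: "(flat 0 has_real_derivative flat 2 y) (at y)" for y
    using flat_has_derivative[of 0 y] by (simp add: numeral_2_eq_2)
  have d': "((\<lambda>x. flat 0 (1 - x)) has_real_derivative - flat 2 (1 - x)) (at x)"
  proof -
    have "((\<lambda>x. 1 - x) has_real_derivative -1) (at x)" by (auto intro!: derivative_eq_intros)
    from DERIV_chain2[OF d this] show ?thesis by simp
  qed
  have "flat 0 x + flat 0 (1 - x) \<noteq> 0" using step_denominator_pos[of x] by simp
  then show ?thesis
    unfolding step_def[abs_def] step'_def
    by (auto intro!: derivative_eq_intros d d' simp: power2_eq_square algebra_simps)
qed

lemma step'_nonneg: "step' x \<ge> 0"
  using flat_nonneg by (simp add: step'_def)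

lemma step'_pos: "0 < x \<Longrightarrow> x < 1 \<Longrightarrow> step' x > 0"
  unfolding step'_def using flat_pos[of x] flat_pos[of "1 - x"] step_denominator_pos[of x]
  by (auto intro!: divide_pos_pos add_pos_pos mult_pos_pos)

lemma step'_outside: "x \<le> 0 \<or> x \<ge> 1 \<Longrightarrow> step' x = 0"
  by (auto simp: step'_def flat_def)

lemma continuous_flat: "continuous_on A (flat k)"
  using Ck_flat[of 0 k] by (auto intro: continuous_on_subset)

lemma continuous_step': "continuous_on A step'"
proof -
  have "continuous_on A (flat k \<circ> (\<lambda>x. 1 - x))" for k
    by (intro continuous_on_compose continuous_intros continuous_flat)
  then have c: "continuous_on A (\<lambda>x. flat k (1 - x))" for k by (simp add: o_def)
  show ?thesis
    unfolding step'_def[abs_def]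
    by (intro continuous_intros continuous_flat c) (use step_denominator_pos in \<open>auto, metis less_irrefl\<close>)
qed

definition cutoff :: "'a::euclidean_space set \<Rightarrow> real \<Rightarrow> 'a \<Rightarrow> real" where
  "cutoff D R x = (\<Prod>b\<in>D. step (R + 1 + x \<bullet> b) * step (R + 1 - x \<bullet> b))"

lemma Ck_cutoff:
  assumes "finite D"
  shows "Ck k (cutoff D R)"
proof -
  have "Ck k (\<lambda>x. step (R + 1 + x \<bullet> b))" "Ck k (\<lambda>x. step (R + 1 + x \<bullet> (- b)))" for b :: 'a
    by (rule Ck_compose_linear_form[OF Ck_step])+
  then show ?thesis
    unfolding cutoff_def[abs_def] by (intro Ck_prod Ck_mult assms) auto
qed

lemma cutoff_eq_1: "(\<And>b. b \<in> D \<Longrightarrow> \<bar>x \<bullet> b\<bar> \<le> R) \<Longrightarrow> cutoff D R x = 1"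
  unfolding cutoff_def by (intro prod.neutral ballI) (fastforce simp: step_ge_1 abs_le_iff)

lemma cutoff_eq_0: "finite D \<Longrightarrow> b \<in> D \<Longrightarrow> \<bar>x \<bullet> b\<bar> \<ge> R + 1 \<Longrightarrow> cutoff D R x = 0"
  unfolding cutoff_def
  by (rule prod_zero) (auto intro!: bexI[of _ b] simp: step_nonpos abs_real_def split: if_splits)

lemma cutoff_nonneg: "cutoff D R x \<ge> 0"
  by (auto simp: cutoff_def step_nonneg intro!: prod_nonneg)

lemma cutoff_le_1: "cutoff D R x \<le> 1"
  unfolding cutoff_def by (intro prod_le_1) (auto simp: step_nonneg step_le_1 intro: mult_le_one)

lemma bounded_box_coordinates: "bounded {x::'a::euclidean_space. \<forall>b\<in>Basis. \<bar>x \<bullet> b\<bar> \<le> R}"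
  by (rule bounded_subset[OF bounded_cbox[of "- R *\<^sub>R One" "R *\<^sub>R One"]])
     (auto simp: mem_box abs_le_iff minus_le_iff)

lemma test_function_cutoff: "test_function (cutoff Basis R :: 'a::euclidean_space \<Rightarrow> real)"
proof -
  have "{x::'a. cutoff Basis R x \<noteq> 0} \<subseteq> {x. \<forall>b\<in>Basis. \<bar>x \<bullet> b\<bar> \<le> R + 1}"
  proof (intro subsetI CollectI ballI)
    fix x b :: 'a assume "x \<in> {x. cutoff Basis R x \<noteq> 0}" "b \<in> Basis"
    then show "\<bar>x \<bullet> b\<bar> \<le> R + 1"
      using cutoff_eq_0[of Basis b R x] by fastforce
  qed
  then have "bounded {x::'a. cutoff Basis R x \<noteq> 0}"
    by (rule bounded_subset[OF bounded_box_coordinates])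
  then show ?thesis
    by (simp add: test_function_def Ck_cutoff)
qed

lemma test_function_affine:
  assumes "test_function \<phi>" "s \<noteq> 0"
  shows "test_function (\<lambda>x. \<phi> (c + s *\<^sub>R x))"
proof -
  have b: "bounded {x. \<phi> x \<noteq> 0}"
    using assms(1) by (auto simp: test_function_def intro: bounded_subset[OF compact_imp_bounded closure_subset])
  have "{x. \<phi> (c + s *\<^sub>R x) \<noteq> 0} \<subseteq> (\<lambda>y. - (c /\<^sub>R s) + y /\<^sub>R s) ` {x. \<phi> x \<noteq> 0}"
  proof
    fix x assume "x \<in> {x. \<phi> (c + s *\<^sub>R x) \<noteq> 0}"
    then show "x \<in> (\<lambda>y. - (c /\<^sub>R s) + y /\<^sub>R s) ` {x. \<phi> x \<noteq> 0}"
      using assms(2) by (intro image_eqI[of _ _ "c + s *\<^sub>R x"]) (auto simp: algebra_simps)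
  qed
  moreover have "bounded ((\<lambda>y. - (c /\<^sub>R s) + y /\<^sub>R s) ` {x. \<phi> x \<noteq> 0})"
    using bounded_translation[OF bounded_scaling[OF b, of "inverse s"], of "- (c /\<^sub>R s)"]
    by (simp add: image_image)
  ultimately have "bounded {x. \<phi> (c + s *\<^sub>R x) \<noteq> 0}"
    using bounded_subset by blast
  then show ?thesis
    using assms(1) by (simp add: test_function_def Ck_compose_affine)
qed

lemma test_function_mult:
  assumes "test_function \<phi>" "\<And>k. Ck k \<eta>"
  shows "test_function (\<lambda>x. \<eta> x * \<phi> x)"
proof -
  have "bounded {x. \<phi> x \<noteq> 0}"
    using assms(1) by (auto simp: test_function_def intro: bounded_subset[OF compact_imp_bounded closure_subset])
  then have "bounded {x. \<eta> x * \<phi> x \<noteq> 0}"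
    by (rule bounded_subset) auto
  then show ?thesis
    using assms by (simp add: test_function_def Ck_mult)
qed

lemma test_function_has_derivative:
  "test_function \<phi> \<Longrightarrow> (\<phi> has_derivative frechet_derivative \<phi> (at x)) (at x)"
  by (rule Ck_has_derivative[of 0]) (auto simp only: test_function_def)

lemma test_function_support:
  assumes "test_function \<phi>"
  obtains M where "M > 0" "\<And>x. norm x > M \<Longrightarrow> \<phi> x = 0" "\<And>x b. norm x > M \<Longrightarrow> frechet_derivative \<phi> (at x) b = 0"
proof -
  have "bounded {x. \<phi> x \<noteq> 0}"
    using assms(1) by (auto simp: test_function_def intro: bounded_subset[OF compact_imp_bounded closure_subset])
  then obtain M where M: "M > 0" "\<And>x. \<phi> x \<noteq> 0 \<Longrightarrow> norm x \<le> M"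
    by (auto simp: bounded_pos)
  have z: "\<phi> x = 0" if "norm x > M" for x using M(2)[of x] that by force
  have "frechet_derivative \<phi> (at x) b = 0" if "norm x > M" for x b
  proof -
    have "open {x::'a. norm x > M}"
      by (intro open_Collect_less continuous_intros)
    from has_derivative_transform_within_open[OF has_derivative_const[of 0] this, where g = \<phi> and t = UNIV and x = x]
    have "(\<phi> has_derivative (\<lambda>_. 0)) (at x)"
      using that z by simp
    then show ?thesis
      using fun_cong[OF frechet_derivative_at, of \<phi> "\<lambda>_. 0" x b] by simp
  qed
  with M(1) z show thesis by (rule that)
qed

lemma continuous_bounded_of_support:
  fixes \<psi> :: "'a::euclidean_space \<Rightarrow> real"
  assumes "continuous_on UNIV \<psi>" "\<And>x. norm x > M \<Longrightarrow> \<psi> x = 0"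
  obtains B where "B > 0" "\<And>x. \<bar>\<psi> x\<bar> \<le> B"
proof -
  have "compact (\<psi> ` cball 0 M)"
    by (intro compact_continuous_image continuous_on_subset[OF assms(1)]) auto
  then have "bounded (\<psi> ` cball 0 M)" by (rule compact_imp_bounded)
  then obtain B where "B > 0" "\<And>x. x \<in> cball 0 M \<Longrightarrow> \<bar>\<psi> x\<bar> \<le> B"
    unfolding bounded_pos by (auto simp del: mem_cball)
  then have "\<bar>\<psi> x\<bar> \<le> B" for x
    using assms(2)[of x] by (cases "norm x > M") auto
  with \<open>B > 0\<close> show thesis by (rule that)
qed

lemma test_function_continuous:
  assumes "test_function \<phi>"
  shows "continuous_on UNIV \<phi>" "b \<in> Basis \<Longrightarrow> continuous_on UNIV (\<lambda>x. frechet_derivative \<phi> (at x) b)"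
proof -
  have "Ck 0 \<phi>" "Ck (Suc 0) \<phi>" using assms by (auto simp only: test_function_def)
  then show "continuous_on UNIV \<phi>" "b \<in> Basis \<Longrightarrow> continuous_on UNIV (\<lambda>x. frechet_derivative \<phi> (at x) b)"
    by auto
qed

section \<open>Square-integrable functions\<close>

definition norm_L2 :: "('a::euclidean_space \<Rightarrow> complex) \<Rightarrow> real" where
  "norm_L2 f = sqrt (LINT x|lborel. (cmod (f x))\<^sup>2)"

lemma L2_measurable: "f \<in> L2 \<Longrightarrow> f \<in> borel_measurable borel"
  by (simp add: L2_def)

lemma L2_integrable: "f \<in> L2 \<Longrightarrow> integrable lborel (\<lambda>x. (cmod (f x))\<^sup>2)"
  by (simp add: L2_def)

lemma norm_L2_nonneg: "norm_L2 f \<ge> 0"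
  by (simp add: norm_L2_def)

lemma abs_norm_L2: "\<bar>norm_L2 f\<bar> = norm_L2 f"
  using norm_L2_nonneg by (rule abs_of_nonneg)

lemma norm_L2_power2: "(norm_L2 f)\<^sup>2 = (LINT x|lborel. (cmod (f x))\<^sup>2)"
  by (simp add: norm_L2_def)

lemma L2_nn_integral:
  "f \<in> L2 \<Longrightarrow> (\<integral>\<^sup>+x. ennreal ((cmod (f x))\<^sup>2) \<partial>lborel) = ennreal ((norm_L2 f)\<^sup>2)"
  unfolding norm_L2_power2 by (rule nn_integral_eq_integral[OF L2_integrable]) auto

lemma L2I_nn_integral:
  assumes [measurable]: "f \<in> borel_measurable borel"
    and le: "(\<integral>\<^sup>+x. ennreal ((cmod (f x))\<^sup>2) \<partial>lborel) \<le> ennreal (B\<^sup>2)" and "B \<ge> 0"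
  shows "f \<in> L2" "norm_L2 f \<le> B"
proof -
  show L: "f \<in> L2"
    unfolding L2_def using le_less_trans[OF le] by (auto intro!: integrableI_bounded)
  show "norm_L2 f \<le> B"
    using le \<open>B \<ge> 0\<close> unfolding L2_nn_integral[OF L]
    by (simp add: ennreal_le_iff power2_le_iff_abs_le norm_L2_nonneg)
qed

lemma L2_dominated:
  assumes "g \<in> L2" and [measurable]: "f \<in> borel_measurable borel"
    and le: "\<And>x. cmod (f x) \<le> c * cmod (g x)"
  shows "f \<in> L2"
proof -
  have "integrable lborel (\<lambda>x. (cmod (f x))\<^sup>2)"
  proof (rule Bochner_Integration.integrable_bound)
    show "integrable lborel (\<lambda>x. c\<^sup>2 * (cmod (g x))\<^sup>2)"
      using L2_integrable[OF assms(1)] by simp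
    show "AE x in lborel. norm ((cmod (f x))\<^sup>2) \<le> norm (c\<^sup>2 * (cmod (g x))\<^sup>2)"
      using power_mono[OF le, of _ 2] by (simp add: power_mult_distrib)
  qed measurable
  then show ?thesis by (simp add: L2_def)
qed

lemma L2_add:
  assumes "f \<in> L2" "g \<in> L2"
  shows "(\<lambda>x. f x + g x) \<in> L2"
proof -
  note [measurable] = L2_measurable[OF assms(1)] L2_measurable[OF assms(2)]
  have b: "(cmod (a + b))\<^sup>2 \<le> 2 * (cmod a)\<^sup>2 + 2 * (cmod b)\<^sup>2" for a b
  proof -
    have "(cmod (a + b))\<^sup>2 \<le> (cmod a + cmod b)\<^sup>2" by (intro power_mono norm_triangle_ineq) auto
    also have "\<dots> \<le> 2 * (cmod a)\<^sup>2 + 2 * (cmod b)\<^sup>2"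
      using sum_squares_bound[of "cmod a" "cmod b"] by (simp add: power2_sum)
    finally show ?thesis .
  qed
  have "integrable lborel (\<lambda>x. (cmod (f x + g x))\<^sup>2)"
  proof (rule Bochner_Integration.integrable_bound)
    show "integrable lborel (\<lambda>x. 2 * (cmod (f x))\<^sup>2 + 2 * (cmod (g x))\<^sup>2)"
      using L2_integrable[OF assms(1)] L2_integrable[OF assms(2)] by simp
    show "AE x in lborel. norm ((cmod (f x + g x))\<^sup>2) \<le> norm (2 * (cmod (f x))\<^sup>2 + 2 * (cmod (g x))\<^sup>2)"
      using b by simp
  qed measurable
  then show ?thesis by (simp add: L2_def)
qed

lemma L2_zero: "(\<lambda>x. 0) \<in> L2"
  by (simp add: L2_def)

lemma L2_bounded_scaleR:
  assumes "f \<in> L2" and [measurable]: "h \<in> borel_measurable borel" and "\<And>x. \<bar>h x\<bar> \<le> c"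
  shows "(\<lambda>x. h x *\<^sub>R f x) \<in> L2"
proof -
  note [measurable] = L2_measurable[OF assms(1)]
  show ?thesis
    by (rule L2_dominated[OF assms(1), where c = c]) (auto intro: mult_right_mono assms(3))
qed

lemma L2_scaleR: "f \<in> L2 \<Longrightarrow> (\<lambda>x. (c::real) *\<^sub>R f x) \<in> L2"
  by (rule L2_bounded_scaleR[where c = "\<bar>c\<bar>"]) auto

lemma L2_cmult:
  assumes "f \<in> L2" shows "(\<lambda>x. c * f x) \<in> L2"
proof -
  note [measurable] = L2_measurable[OF assms(1)]
  show ?thesis by (rule L2_dominated[OF assms(1), where c = "cmod c"]) (auto simp: norm_mult)
qed

lemma L2_minus: "f \<in> L2 \<Longrightarrow> (\<lambda>x. - f x) \<in> L2"
  using L2_scaleR[of f "-1"] by simp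

lemma L2_diff: "f \<in> L2 \<Longrightarrow> g \<in> L2 \<Longrightarrow> (\<lambda>x. f x - g x) \<in> L2"
  using L2_add[of f "\<lambda>x. - g x"] L2_minus by auto

lemma L2_divide: "f \<in> L2 \<Longrightarrow> (\<lambda>x. f x / c) \<in> L2"
  using L2_cmult[of f "inverse c"] by (simp add: divide_inverse mult.commute)

lemma L2_sum: "(\<And>i. i \<in> A \<Longrightarrow> f i \<in> L2) \<Longrightarrow> (\<lambda>x. \<Sum>i\<in>A. f i x) \<in> L2"
  by (induction A rule: infinite_finite_induct) (auto intro: L2_zero L2_add)

lemmas L2_intros = L2_zero L2_add L2_diff L2_minus L2_scaleR L2_cmult L2_divide L2_sum

lemma norm_L2_cong_AE:
  assumes "f \<in> borel_measurable borel" "g \<in> borel_measurable borel" "AE x in lborel. f x = g x"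
  shows "norm_L2 f = norm_L2 g"
  unfolding norm_L2_def
  by (rule arg_cong[of _ _ sqrt], rule integral_cong_AE) (use assms in auto)

lemma L2_integral_norm_mult_le:
  assumes "f \<in> L2" "g \<in> L2"
  shows "integrable lborel (\<lambda>x. cmod (f x) * cmod (g x))"
    and "(LINT x|lborel. cmod (f x) * cmod (g x)) \<le> norm_L2 f * norm_L2 g"
proof -
  note [measurable] = L2_measurable[OF assms(1)] L2_measurable[OF assms(2)]
  show i: "integrable lborel (\<lambda>x. cmod (f x) * cmod (g x))"
  proof (rule Bochner_Integration.integrable_bound)
    show "integrable lborel (\<lambda>x. (cmod (f x))\<^sup>2 + (cmod (g x))\<^sup>2)"
      using L2_integrable[OF assms(1)] L2_integrable[OF assms(2)] by simp
    show "AE x in lborel. norm (cmod (f x) * cmod (g x)) \<le> norm ((cmod (f x))\<^sup>2 + (cmod (g x))\<^sup>2)"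
    proof (rule AE_I2)
      fix x
      have "2 * cmod (f x) * cmod (g x) \<le> (cmod (f x))\<^sup>2 + (cmod (g x))\<^sup>2"
        by (rule sum_squares_bound)
      moreover have "0 \<le> cmod (f x) * cmod (g x)" by simp
      ultimately show "norm (cmod (f x) * cmod (g x)) \<le> norm ((cmod (f x))\<^sup>2 + (cmod (g x))\<^sup>2)"
        unfolding real_norm_def by linarith
    qed
  qed measurable
  have "(\<integral>\<^sup>+x. ennreal (cmod (f x)) * ennreal (cmod (g x)) \<partial>lborel)\<^sup>2
      \<le> (\<integral>\<^sup>+x. (ennreal (cmod (f x)))\<^sup>2 \<partial>lborel) * (\<integral>\<^sup>+x. (ennreal (cmod (g x)))\<^sup>2 \<partial>lborel)"
    by (rule Cauchy_Schwarz_nn_integral) auto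
  also have "\<dots> = ennreal ((norm_L2 f * norm_L2 g)\<^sup>2)"
    using L2_nn_integral[OF assms(1)] L2_nn_integral[OF assms(2)]
    by (simp add: ennreal_power ennreal_mult' power_mult_distrib)
  finally have "(\<integral>\<^sup>+x. ennreal (cmod (f x) * cmod (g x)) \<partial>lborel)\<^sup>2 \<le> ennreal ((norm_L2 f * norm_L2 g)\<^sup>2)"
    by (simp add: ennreal_mult')
  then have "(LINT x|lborel. cmod (f x) * cmod (g x))\<^sup>2 \<le> (norm_L2 f * norm_L2 g)\<^sup>2"
    by (subst (asm) nn_integral_eq_integral[OF i]) (auto simp: ennreal_power integral_nonneg_AE ennreal_le_iff)
  then show "(LINT x|lborel. cmod (f x) * cmod (g x)) \<le> norm_L2 f * norm_L2 g"
    by (rule power2_le_imp_le) (simp add: norm_L2_nonneg)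
qed

lemma L2_integrable_inner:
  assumes "f \<in> L2" "g \<in> L2"
  shows "integrable lborel (\<lambda>x. f x \<bullet> g x)"
proof -
  note [measurable] = L2_measurable[OF assms(1)] L2_measurable[OF assms(2)]
  show ?thesis
    by (rule Bochner_Integration.integrable_bound[OF L2_integral_norm_mult_le(1)[OF assms]])
       (auto simp: abs_mult Cauchy_Schwarz_ineq2)
qed

lemma L2_Cauchy_Schwarz:
  assumes "f \<in> L2" "g \<in> L2"
  shows "\<bar>LINT x|lborel. f x \<bullet> g x\<bar> \<le> norm_L2 f * norm_L2 g"
proof -
  have "\<bar>LINT x|lborel. f x \<bullet> g x\<bar> \<le> (LINT x|lborel. \<bar>f x \<bullet> g x\<bar>)"
    using integral_norm_bound[of lborel "\<lambda>x. f x \<bullet> g x"] by simp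
  also have "\<dots> \<le> (LINT x|lborel. cmod (f x) * cmod (g x))"
    by (intro integral_mono integrable_abs L2_integrable_inner L2_integral_norm_mult_le assms)
       (rule Cauchy_Schwarz_ineq2)
  also have "\<dots> \<le> norm_L2 f * norm_L2 g" by (rule L2_integral_norm_mult_le(2)[OF assms])
  finally show ?thesis .
qed

lemma norm_L2_triangle:
  assumes "f \<in> L2" "g \<in> L2"
  shows "norm_L2 (\<lambda>x. f x + g x) \<le> norm_L2 f + norm_L2 g"
proof (rule power2_le_imp_le)
  have "(cmod (f x + g x))\<^sup>2 = (cmod (f x))\<^sup>2 + 2 * (f x \<bullet> g x) + (cmod (g x))\<^sup>2" for x
    by (simp add: power2_norm_eq_inner inner_simps inner_commute)
  then have "(norm_L2 (\<lambda>x. f x + g x))\<^sup>2 = (norm_L2 f)\<^sup>2 + 2 * (LINT x|lborel. f x \<bullet> g x) + (norm_L2 g)\<^sup>2"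
    unfolding norm_L2_power2
    using L2_integrable[OF assms(1)] L2_integrable[OF assms(2)] L2_integrable_inner[OF assms] by simp
  also have "\<dots> \<le> (norm_L2 f + norm_L2 g)\<^sup>2"
    using L2_Cauchy_Schwarz[OF assms] by (simp add: power2_sum)
  finally show "(norm_L2 (\<lambda>x. f x + g x))\<^sup>2 \<le> (norm_L2 f + norm_L2 g)\<^sup>2" .
qed (simp add: norm_L2_nonneg)

lemma norm_L2_diff_commute: "norm_L2 (\<lambda>x. f x - g x) = norm_L2 (\<lambda>x. g x - f x)"
  by (simp add: norm_L2_def norm_minus_commute)

lemma norm_L2_triangle_diff:
  assumes "f \<in> L2" "g \<in> L2" "h \<in> L2"
  shows "norm_L2 (\<lambda>x. f x - h x) \<le> norm_L2 (\<lambda>x. f x - g x) + norm_L2 (\<lambda>x. g x - h x)"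
  using norm_L2_triangle[OF L2_diff[OF assms(1,2)] L2_diff[OF assms(2,3)]] by simp

lemma norm_L2_eq_0_AE:
  assumes "f \<in> L2" "norm_L2 f = 0"
  shows "AE x in lborel. f x = 0"
proof -
  have "(LINT x|lborel. (cmod (f x))\<^sup>2) = 0"
    using assms(2) norm_L2_power2[of f] by simp
  then show ?thesis
    using integral_nonneg_eq_0_iff_AE[OF L2_integrable[OF assms(1)]] by simp
qed

lemma L2_limit_unique:
  assumes "\<And>n. F n \<in> L2" "f \<in> L2" "g \<in> L2"
    and "(\<lambda>n. norm_L2 (\<lambda>x. F n x - f x)) \<longlonglongrightarrow> 0" "(\<lambda>n. norm_L2 (\<lambda>x. F n x - g x)) \<longlonglongrightarrow> 0"
  shows "AE x in lborel. f x = g x"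
proof -
  have "norm_L2 (\<lambda>x. f x - g x) \<le> norm_L2 (\<lambda>x. F n x - f x) + norm_L2 (\<lambda>x. F n x - g x)" for n
    using norm_L2_triangle_diff[OF assms(2) assms(1) assms(3), of n] norm_L2_diff_commute[of f "F n"] by simp
  then have "norm_L2 (\<lambda>x. f x - g x) \<le> 0"
    using tendsto_add[OF assms(4,5)] by (intro LIMSEQ_le_const) auto
  then have "norm_L2 (\<lambda>x. f x - g x) = 0" using norm_L2_nonneg by (intro antisym)
  from norm_L2_eq_0_AE[OF L2_diff[OF assms(2,3)] this] show ?thesis by auto
qed

lemma L2_limit_add:
  assumes "\<And>n. F n \<in> L2" "f \<in> L2" "\<And>n. G n \<in> L2" "g \<in> L2"
    and "(\<lambda>n. norm_L2 (\<lambda>x. F n x - f x)) \<longlonglongrightarrow> 0" "(\<lambda>n. norm_L2 (\<lambda>x. G n x - g x)) \<longlonglongrightarrow> 0"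
  shows "(\<lambda>n. norm_L2 (\<lambda>x. (F n x + G n x) - (f x + g x))) \<longlonglongrightarrow> 0"
proof (rule tendsto_sandwich[OF _ _ tendsto_const])
  show "(\<lambda>n. norm_L2 (\<lambda>x. F n x - f x) + norm_L2 (\<lambda>x. G n x - g x)) \<longlonglongrightarrow> 0"
    using tendsto_add[OF assms(5,6)] by simp
  have "norm_L2 (\<lambda>x. (F n x + G n x) - (f x + g x)) \<le> norm_L2 (\<lambda>x. F n x - f x) + norm_L2 (\<lambda>x. G n x - g x)" for n
    using norm_L2_triangle[OF L2_diff[OF assms(1,2)] L2_diff[OF assms(3,4)], of n n] by (simp add: algebra_simps)
  then show "\<forall>\<^sub>F n in sequentially. norm_L2 (\<lambda>x. (F n x + G n x) - (f x + g x)) \<le> norm_L2 (\<lambda>x. F n x - f x) + norm_L2 (\<lambda>x. G n x - g x)"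
    by simp
qed (simp add: norm_L2_nonneg)

lemma L2_limit_sum:
  assumes "finite A" "\<And>i n. i \<in> A \<Longrightarrow> F i n \<in> L2" "\<And>i. i \<in> A \<Longrightarrow> f i \<in> L2"
    and "\<And>i. i \<in> A \<Longrightarrow> (\<lambda>n. norm_L2 (\<lambda>x. F i n x - f i x)) \<longlonglongrightarrow> 0"
  shows "(\<lambda>n. norm_L2 (\<lambda>x. (\<Sum>i\<in>A. F i n x) - (\<Sum>i\<in>A. f i x))) \<longlonglongrightarrow> 0"
  using assms
proof (induction A rule: finite_induct)
  case empty
  then show ?case by (simp add: norm_L2_def)
next
  case (insert i A)
  have "(\<lambda>n. norm_L2 (\<lambda>x. (F i n x + (\<Sum>i\<in>A. F i n x)) - (f i x + (\<Sum>i\<in>A. f i x)))) \<longlonglongrightarrow> 0"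
    by (rule L2_limit_add) (use insert in \<open>auto intro: L2_sum\<close>)
  then show ?case using insert by simp
qed

lemma L2_inner_tendsto:
  assumes "\<And>n. F n \<in> L2" "f \<in> L2" "\<And>n. G n \<in> L2" "g \<in> L2"
    and F: "(\<lambda>n. norm_L2 (\<lambda>x. F n x - f x)) \<longlonglongrightarrow> 0" and G: "(\<lambda>n. norm_L2 (\<lambda>x. G n x - g x)) \<longlonglongrightarrow> 0"
  shows "(\<lambda>n. LINT x|lborel. F n x \<bullet> G n x) \<longlonglongrightarrow> (LINT x|lborel. f x \<bullet> g x)"
proof -
  let ?a = "\<lambda>n. norm_L2 (\<lambda>x. F n x - f x)" and ?b = "\<lambda>n. norm_L2 (\<lambda>x. G n x - g x)"
  have bound: "\<bar>(LINT x|lborel. F n x \<bullet> G n x) - (LINT x|lborel. f x \<bullet> g x)\<bar>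
      \<le> ?a n * (?b n + norm_L2 g) + norm_L2 f * ?b n" for n
  proof -
    have d: "F n x \<bullet> G n x - f x \<bullet> g x = (F n x - f x) \<bullet> (G n x - g x) + (F n x - f x) \<bullet> g x + f x \<bullet> (G n x - g x)" for x
      by (simp add: inner_simps)
    note L = assms(1)[of n] assms(2) assms(3)[of n] assms(4)
    have "(LINT x|lborel. F n x \<bullet> G n x) - (LINT x|lborel. f x \<bullet> g x)
      = (LINT x|lborel. (F n x - f x) \<bullet> (G n x - g x)) + (LINT x|lborel. (F n x - f x) \<bullet> g x) + (LINT x|lborel. f x \<bullet> (G n x - g x))"
      by (subst Bochner_Integration.integral_diff[symmetric], (intro L2_integrable_inner L)+, subst d,
          subst Bochner_Integration.integral_add, (intro Bochner_Integration.integrable_add L2_integrable_inner L2_diff L)+,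
          subst Bochner_Integration.integral_add, (intro L2_integrable_inner L2_diff L)+, simp)
    moreover have "\<bar>LINT x|lborel. (F n x - f x) \<bullet> (G n x - g x)\<bar> \<le> ?a n * ?b n"
      by (intro L2_Cauchy_Schwarz L2_diff L)
    moreover have "\<bar>LINT x|lborel. (F n x - f x) \<bullet> g x\<bar> \<le> ?a n * norm_L2 g"
      by (intro L2_Cauchy_Schwarz L2_diff L)
    moreover have "\<bar>LINT x|lborel. f x \<bullet> (G n x - g x)\<bar> \<le> norm_L2 f * ?b n"
      by (intro L2_Cauchy_Schwarz L2_diff L)
    ultimately show ?thesis by (simp add: algebra_simps)
  qed
  have "(\<lambda>n. ?a n * (?b n + norm_L2 g) + norm_L2 f * ?b n) \<longlonglongrightarrow> 0 * (0 + norm_L2 g) + norm_L2 f * 0"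
    by (intro tendsto_intros F G)
  then have "(\<lambda>n. ?a n * (?b n + norm_L2 g) + norm_L2 f * ?b n) \<longlonglongrightarrow> 0" by simp
  then have "(\<lambda>n. (LINT x|lborel. F n x \<bullet> G n x) - (LINT x|lborel. f x \<bullet> g x)) \<longlonglongrightarrow> 0"
    by (rule Lim_null_comparison[rotated]) (use bound in auto)
  then show ?thesis by (rule LIM_zero_cancel)
qed

text \<open>
  Along a subsequence with increments of norm at most \<open>2\<^bsup>-k\<^esup>\<close> the series of
  \<open>2\<^sup>k |d\<^sub>k|\<^sup>2\<close> has a finite integral. Hence it converges almost everywhere, which bounds
  \<open>|d\<^sub>k|\<close> by a geometric sequence, and the subsequence converges pointwise. Fatou's lemma turns this
  into convergence in norm.
\<close>

lemma L2_complete: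
  fixes F :: "nat \<Rightarrow> 'a::euclidean_space \<Rightarrow> complex"
  assumes F: "\<And>n. F n \<in> L2"
    and Cauchy: "\<And>e. e > 0 \<Longrightarrow> \<exists>N. \<forall>m\<ge>N. \<forall>n\<ge>N. norm_L2 (\<lambda>x. F m x - F n x) < e"
  obtains f where "f \<in> L2" "(\<lambda>n. norm_L2 (\<lambda>x. F n x - f x)) \<longlonglongrightarrow> 0"
proof -
  note [measurable] = L2_measurable[OF F]
  have "\<exists>N. \<forall>m\<ge>N. \<forall>n\<ge>N. norm_L2 (\<lambda>x. F m x - F n x) < (1/2)^k" for k :: nat
    by (rule Cauchy) auto
  then obtain N where N: "\<And>k m n. m \<ge> N k \<Longrightarrow> n \<ge> N k \<Longrightarrow> norm_L2 (\<lambda>x. F m x - F n x) < (1/2)^k"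
    by metis
  define r where "r k = (\<Sum>i\<le>k. N i) + k" for k
  have rN: "N k \<le> r k" for k
    using member_le_sum[of k "{..k}" N] by (simp add: r_def trans_le_add1)
  have r_ge: "k \<le> r k" for k by (simp add: r_def)
  have r_mono: "r k \<le> r (Suc k)" for k by (simp add: r_def)
  define d where "d k x = F (r (Suc k)) x - F (r k) x" for k x
  have d: "norm_L2 (d k) \<le> (1/2)^k" "d k \<in> L2" for k
    unfolding d_def using N[of k "r (Suc k)" "r k"] rN[of k] r_mono[of k] by (auto intro!: L2_diff F)
  note [measurable] = L2_measurable[OF d(2)]
  have "(\<integral>\<^sup>+x. (\<Sum>k. ennreal (2^k * (cmod (d k x))\<^sup>2)) \<partial>lborel) = (\<Sum>k. \<integral>\<^sup>+x. ennreal (2^k * (cmod (d k x))\<^sup>2) \<partial>lborel)"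
    by (rule nn_integral_suminf) measurable
  also have "\<dots> = (\<Sum>k. ennreal (2^k * (norm_L2 (d k))\<^sup>2))"
    using L2_nn_integral[OF d(2)] by (simp add: ennreal_mult' nn_integral_cmult)
  also have "\<dots> \<le> (\<Sum>k. ennreal ((1/2)^k))"
  proof (intro suminf_le ennreal_leI)
    fix k
    have "2^k * (norm_L2 (d k))\<^sup>2 \<le> 2^k * ((1/2)^k)\<^sup>2"
      by (intro mult_left_mono power_mono d norm_L2_nonneg) auto
    also have "\<dots> = (1/2)^k"
      by (simp add: power2_eq_square power_mult_distrib[symmetric] flip: mult.assoc)
    finally show "2^k * (norm_L2 (d k))\<^sup>2 \<le> (1/2::real)^k" .
  qed auto
  also have "\<dots> < \<infinity>"
    by (subst suminf_ennreal2) (auto intro!: summable_geometric)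
  finally have "AE x in lborel. (\<Sum>k. ennreal (2^k * (cmod (d k x))\<^sup>2)) \<noteq> \<infinity>"
    by (intro nn_integral_noteq_infinite) auto
  then have conv: "AE x in lborel. (\<lambda>k. F (r k) x) \<longlonglongrightarrow> lim (\<lambda>k. F (r k) x)"
  proof (eventually_elim)
    case (elim x)
    define S where "S = (\<Sum>k. ennreal (2^k * (cmod (d k x))\<^sup>2))"
    have "S \<noteq> \<infinity>" using elim unfolding S_def .
    then have "S = ennreal (enn2real S)" by (simp add: less_top)
    then obtain C where C: "(\<Sum>k. ennreal (2^k * (cmod (d k x))\<^sup>2)) = ennreal C" "C \<ge> 0"
      unfolding S_def using enn2real_nonneg by blast
    have dC: "norm (d k x) \<le> sqrt C * (sqrt (1/2))^k" for k
    proof -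
      have "ennreal (2^k * (cmod (d k x))\<^sup>2) \<le> ennreal C"
      proof -
        have "(\<Sum>k\<in>{k}. ennreal (2^k * (cmod (d k x))\<^sup>2)) \<le> (\<Sum>k. ennreal (2^k * (cmod (d k x))\<^sup>2))"
          by (rule sum_le_suminf[OF summableI]) simp_all
        then show ?thesis unfolding C(1) by (simp only: sum.insert sum.empty finite.emptyI empty_iff not_False_eq_True add_0_right)
      qed
      then have "2^k * (cmod (d k x))\<^sup>2 \<le> C" using C(2) by simp
      then have "(cmod (d k x))\<^sup>2 \<le> C * (1/2)^k"
        by (simp add: field_simps power_divide)
      then have "sqrt ((cmod (d k x))\<^sup>2) \<le> sqrt (C * (1/2)^k)" by (rule real_sqrt_le_mono)
      then show ?thesis by (simp add: real_sqrt_mult real_sqrt_power)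
    qed
    have "summable (\<lambda>k. sqrt C * (sqrt (1/2))^k)"
      by (intro summable_mult summable_geometric) (simp add: real_sqrt_divide)
    then have "summable (\<lambda>k. d k x)"
      by (rule summable_comparison_test'[where N = 0]) (rule dC)
    then have "convergent (\<lambda>n. \<Sum>k<n. d k x)" by (simp add: summable_iff_convergent)
    moreover have "(\<Sum>k<n. d k x) = F (r n) x - F (r 0) x" for n
      unfolding d_def by (rule sum_lessThan_telescope)
    ultimately have "convergent (\<lambda>n. F (r n) x - F (r 0) x)" by simp
    from convergent_add[OF this convergent_const[of "F (r 0) x"]]
    have "convergent (\<lambda>n. F (r n) x)" by simp
    then show ?case by (simp only: convergent_LIMSEQ_iff)
  qed
  define f where "f x = lim (\<lambda>k. F (r k) x)" for x
  have [measurable]: "f \<in> borel_measurable borel"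
    unfolding f_def by measurable
  have close: "f \<in> L2 \<and> norm_L2 (\<lambda>x. F n x - f x) \<le> e" if "e > 0" "\<forall>m\<ge>M. \<forall>n\<ge>M. norm_L2 (\<lambda>x. F m x - F n x) < e" "n \<ge> M" for e M n
  proof -
    have "(\<integral>\<^sup>+x. ennreal ((cmod (F n x - f x))\<^sup>2) \<partial>lborel) = (\<integral>\<^sup>+x. liminf (\<lambda>k. ennreal ((cmod (F n x - F (r k) x))\<^sup>2)) \<partial>lborel)"
    proof (rule nn_integral_cong_AE)
      show "AE x in lborel. ennreal ((cmod (F n x - f x))\<^sup>2) = liminf (\<lambda>k. ennreal ((cmod (F n x - F (r k) x))\<^sup>2))"
        using conv
      proof eventually_elim
        case (elim x)
        have "(\<lambda>k. ennreal ((cmod (F n x - F (r k) x))\<^sup>2)) \<longlonglongrightarrow> ennreal ((cmod (F n x - f x))\<^sup>2)"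
          unfolding f_def by (intro tendsto_intros elim tendsto_ennrealI)
        then show ?case by (rule lim_imp_Liminf[OF sequentially_bot, symmetric])
      qed
    qed
    also have "\<dots> \<le> liminf (\<lambda>k. \<integral>\<^sup>+x. ennreal ((cmod (F n x - F (r k) x))\<^sup>2) \<partial>lborel)"
      by (rule nn_integral_liminf) measurable
    also have "\<dots> \<le> ennreal (e\<^sup>2)"
    proof (rule Liminf_le)
      show "\<forall>\<^sub>F k in sequentially. (\<integral>\<^sup>+x. ennreal ((cmod (F n x - F (r k) x))\<^sup>2) \<partial>lborel) \<le> ennreal (e\<^sup>2)"
      proof (rule eventually_sequentiallyI[of M])
        fix k assume "k \<ge> M"
        then have "r k \<ge> M" using r_ge[of k] by simp
        then have "norm_L2 (\<lambda>x. F n x - F (r k) x) < e" using that by auto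
        then show "(\<integral>\<^sup>+x. ennreal ((cmod (F n x - F (r k) x))\<^sup>2) \<partial>lborel) \<le> ennreal (e\<^sup>2)"
          by (subst L2_nn_integral[OF L2_diff[OF F F]]) (auto intro!: ennreal_leI power_mono norm_L2_nonneg)
      qed
    qed simp
    finally have *: "(\<lambda>x. F n x - f x) \<in> L2" "norm_L2 (\<lambda>x. F n x - f x) \<le> e"
      using L2I_nn_integral[of "\<lambda>x. F n x - f x" e] \<open>e > 0\<close> by auto
    then show ?thesis using L2_diff[OF F[of n] *(1)] by simp
  qed
  have "f \<in> L2" using close Cauchy[of 1] by (meson less_numeral_extra(1) order_refl)
  moreover have "(\<lambda>n. norm_L2 (\<lambda>x. F n x - f x)) \<longlonglongrightarrow> 0"
  proof (rule LIMSEQ_I)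
    fix e :: real assume "e > 0"
    then obtain M where "\<forall>m\<ge>M. \<forall>n\<ge>M. norm_L2 (\<lambda>x. F m x - F n x) < e/2" using Cauchy[of "e/2"] by auto
    then have "norm_L2 (\<lambda>x. F n x - f x) \<le> e/2" if "n \<ge> M" for n using close[of "e/2" M n] that \<open>e > 0\<close> by auto
    then show "\<exists>no. \<forall>n\<ge>no. norm (norm_L2 (\<lambda>x. F n x - f x) - 0) < e"
    proof (intro exI[of _ M] allI impI)
      fix n assume "n \<ge> M"
      then have "norm_L2 (\<lambda>x. F n x - f x) < e" using \<open>\<And>n. n \<ge> M \<Longrightarrow> norm_L2 (\<lambda>x. F n x - f x) \<le> e/2\<close> \<open>e > 0\<close> by force
      then show "norm (norm_L2 (\<lambda>x. F n x - f x) - 0) < e" using norm_L2_nonneg[of "\<lambda>x. F n x - f x"] by simp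
    qed
  qed
  ultimately show thesis by (rule that)
qed

lemma nn_integral_translate:
  fixes f :: "'a::euclidean_space \<Rightarrow> ennreal"
  assumes "f \<in> borel_measurable borel"
  shows "(\<integral>\<^sup>+x. f (x + v) \<partial>lborel) = (\<integral>\<^sup>+x. f x \<partial>lborel)"
  by (subst lborel_distr_plus[of v, symmetric], subst nn_integral_distr) (use assms in \<open>auto simp: add.commute\<close>)

lemma integral_translate:
  fixes f :: "'a::euclidean_space \<Rightarrow> 'b::{banach, second_countable_topology}"
  assumes "f \<in> borel_measurable borel"
  shows "(LINT x|lborel. f (x + v)) = (LINT x|lborel. f x)"
proof -
  have "(LINT x|lborel. f x) = (LINT x|distr lborel borel ((+) v). f x)"
    by (simp add: lborel_distr_plus)
  also have "\<dots> = (LINT x|lborel. f (v + x))"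
    by (rule integral_distr) (use assms in auto)
  finally show ?thesis by (simp add: add.commute)
qed

lemma integrable_translate:
  fixes f :: "'a::euclidean_space \<Rightarrow> 'b::{banach, second_countable_topology}"
  assumes "integrable lborel f"
  shows "integrable lborel (\<lambda>x. f (x + v))"
proof -
  have "integrable (distr lborel borel ((+) v)) f"
    by (simp add: lborel_distr_plus assms)
  then have "integrable lborel (\<lambda>x. f (v + x))"
    by (subst (asm) integrable_distr_eq) (use borel_measurable_integrable[OF assms] in auto)
  then show ?thesis by (simp add: add.commute)
qed

lemma L2_translate:
  assumes "f \<in> L2"
  shows "(\<lambda>x. f (x + v)) \<in> L2" "norm_L2 (\<lambda>x. f (x + v)) = norm_L2 f"
proof -
  note [measurable] = L2_measurable[OF assms]
  show "(\<lambda>x. f (x + v)) \<in> L2"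
    using integrable_translate[OF L2_integrable[OF assms], of v] by (simp add: L2_def)
  show "norm_L2 (\<lambda>x. f (x + v)) = norm_L2 f"
    unfolding norm_L2_def using integral_translate[of "\<lambda>x. (cmod (f x))\<^sup>2" v] by simp
qed

section \<open>Averages of translates\<close>

text \<open>
  The Cauchy-Schwarz inequality for the measure \<open>|\<kappa> w| dw\<close>, followed by Tonelli. The function
  \<open>G\<close> of two variables will be a translate of \<open>g\<close>, for Young's inequality, or the difference
  between a translate and \<open>g\<close>, for approximate identities.
\<close>

lemma averaging_L2:
  fixes \<kappa> :: "'a::euclidean_space \<Rightarrow> real" and G :: "'a \<Rightarrow> 'a \<Rightarrow> complex"
  assumes \<kappa>: "integrable lborel \<kappa>"
    and G[measurable]: "(\<lambda>(z, w). G z w) \<in> borel_measurable (lborel \<Otimes>\<^sub>M lborel)"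
    and B: "\<And>w. \<kappa> w \<noteq> 0 \<Longrightarrow> (\<integral>\<^sup>+z. ennreal ((cmod (G z w))\<^sup>2) \<partial>lborel) \<le> ennreal (B\<^sup>2)" "B \<ge> 0"
  shows "AE z in lborel. integrable lborel (\<lambda>w. \<kappa> w *\<^sub>R G z w)"
    and "(\<lambda>z. LINT w|lborel. \<kappa> w *\<^sub>R G z w) \<in> L2"
    and "norm_L2 (\<lambda>z. LINT w|lborel. \<kappa> w *\<^sub>R G z w) \<le> (LINT w|lborel. \<bar>\<kappa> w\<bar>) * B"
proof -
  have [measurable]: "\<kappa> \<in> borel_measurable lborel" using \<kappa> by auto
  define I where "I = (LINT w|lborel. \<bar>\<kappa> w\<bar>)"
  have I: "(\<integral>\<^sup>+w. ennreal \<bar>\<kappa> w\<bar> \<partial>lborel) = ennreal I" "I \<ge> 0"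
    unfolding I_def by (intro nn_integral_eq_integral integrable_abs \<kappa>) auto
  define M where "M z = (\<integral>\<^sup>+w. ennreal (cmod (\<kappa> w *\<^sub>R G z w)) \<partial>lborel)" for z
  have [measurable]: "M \<in> borel_measurable lborel" unfolding M_def by measurable
  have M2: "(M z)\<^sup>2 \<le> ennreal I * (\<integral>\<^sup>+w. ennreal (\<bar>\<kappa> w\<bar> * (cmod (G z w))\<^sup>2) \<partial>lborel)" for z
  proof -
    have "M z = (\<integral>\<^sup>+w. ennreal (sqrt \<bar>\<kappa> w\<bar>) * ennreal (sqrt \<bar>\<kappa> w\<bar> * cmod (G z w)) \<partial>lborel)"
      unfolding M_def by (intro nn_integral_cong) (simp add: ennreal_mult'[symmetric] flip: mult.assoc)
    also have "\<dots>\<^sup>2 \<le> (\<integral>\<^sup>+w. (ennreal (sqrt \<bar>\<kappa> w\<bar>))\<^sup>2 \<partial>lborel) * (\<integral>\<^sup>+w. (ennreal (sqrt \<bar>\<kappa> w\<bar> * cmod (G z w)))\<^sup>2 \<partial>lborel)"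
      by (rule Cauchy_Schwarz_nn_integral) measurable
    also have "\<dots> = ennreal I * (\<integral>\<^sup>+w. ennreal (\<bar>\<kappa> w\<bar> * (cmod (G z w))\<^sup>2) \<partial>lborel)"
      unfolding I(1)[symmetric] by (simp add: ennreal_power power_mult_distrib)
    finally show ?thesis .
  qed
  have "(\<integral>\<^sup>+z. (M z)\<^sup>2 \<partial>lborel) \<le> (\<integral>\<^sup>+z. ennreal I * (\<integral>\<^sup>+w. ennreal (\<bar>\<kappa> w\<bar> * (cmod (G z w))\<^sup>2) \<partial>lborel) \<partial>lborel)"
    by (intro nn_integral_mono M2)
  also have "\<dots> = ennreal I * (\<integral>\<^sup>+z. (\<integral>\<^sup>+w. ennreal (\<bar>\<kappa> w\<bar> * (cmod (G z w))\<^sup>2) \<partial>lborel) \<partial>lborel)"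
    by (rule nn_integral_cmult) measurable
  also have "(\<integral>\<^sup>+z. (\<integral>\<^sup>+w. ennreal (\<bar>\<kappa> w\<bar> * (cmod (G z w))\<^sup>2) \<partial>lborel) \<partial>lborel)
      = (\<integral>\<^sup>+w. (\<integral>\<^sup>+z. ennreal (\<bar>\<kappa> w\<bar> * (cmod (G z w))\<^sup>2) \<partial>lborel) \<partial>lborel)"
    by (rule lborel_pair.Fubini'[symmetric]) measurable
  finally have 1: "(\<integral>\<^sup>+z. (M z)\<^sup>2 \<partial>lborel) \<le> ennreal I * (\<integral>\<^sup>+w. (\<integral>\<^sup>+z. ennreal (\<bar>\<kappa> w\<bar> * (cmod (G z w))\<^sup>2) \<partial>lborel) \<partial>lborel)" .
  have "(\<integral>\<^sup>+w. (\<integral>\<^sup>+z. ennreal (\<bar>\<kappa> w\<bar> * (cmod (G z w))\<^sup>2) \<partial>lborel) \<partial>lborel) \<le> (\<integral>\<^sup>+w. ennreal \<bar>\<kappa> w\<bar> * ennreal (B\<^sup>2) \<partial>lborel)"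
  proof (intro nn_integral_mono)
    fix w
    have "(\<integral>\<^sup>+z. ennreal (\<bar>\<kappa> w\<bar> * (cmod (G z w))\<^sup>2) \<partial>lborel) = ennreal \<bar>\<kappa> w\<bar> * (\<integral>\<^sup>+z. ennreal ((cmod (G z w))\<^sup>2) \<partial>lborel)"
      by (subst nn_integral_cmult[symmetric]) (auto simp: ennreal_mult')
    also have "\<dots> \<le> ennreal \<bar>\<kappa> w\<bar> * ennreal (B\<^sup>2)"
      using B(1)[of w] by (cases "\<kappa> w = 0") (auto intro: mult_left_mono)
    finally show "(\<integral>\<^sup>+z. ennreal (\<bar>\<kappa> w\<bar> * (cmod (G z w))\<^sup>2) \<partial>lborel) \<le> ennreal \<bar>\<kappa> w\<bar> * ennreal (B\<^sup>2)" .
  qed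
  also have "\<dots> = ennreal (I * B\<^sup>2)"
    by (subst nn_integral_multc) (auto simp: I ennreal_mult')
  finally have "(\<integral>\<^sup>+z. (M z)\<^sup>2 \<partial>lborel) \<le> ennreal I * ennreal (I * B\<^sup>2)"
    by (rule order_trans[OF 1 mult_left_mono]) simp
  also have "\<dots> = ennreal ((I * B)\<^sup>2)"
    using I(2) by (simp add: ennreal_mult'[symmetric] power2_eq_square mult_ac)
  finally have MI: "(\<integral>\<^sup>+z. (M z)\<^sup>2 \<partial>lborel) \<le> ennreal ((I * B)\<^sup>2)" .
  then have "(\<integral>\<^sup>+z. (M z)\<^sup>2 \<partial>lborel) \<noteq> \<infinity>"
    by (auto simp: top_unique)
  then have "AE z in lborel. (M z)\<^sup>2 \<noteq> \<infinity>"
    by (intro nn_integral_noteq_infinite) auto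
  then show "AE z in lborel. integrable lborel (\<lambda>w. \<kappa> w *\<^sub>R G z w)"
  proof eventually_elim
    case (elim z)
    then have "M z < \<infinity>"
      by (auto simp: power2_eq_square ennreal_mult_eq_top_iff less_top)
    then show ?case unfolding M_def by (intro integrableI_bounded) auto
  qed
  have le: "ennreal (cmod (LINT w|lborel. \<kappa> w *\<^sub>R G z w)) \<le> M z" for z
    unfolding M_def
  proof (cases "integrable lborel (\<lambda>w. \<kappa> w *\<^sub>R G z w)")
    case True
    then show "ennreal (cmod (LINT w|lborel. \<kappa> w *\<^sub>R G z w)) \<le> (\<integral>\<^sup>+w. ennreal (cmod (\<kappa> w *\<^sub>R G z w)) \<partial>lborel)"
      by (rule integral_norm_bound_ennreal)
  qed (simp add: not_integrable_integral_eq)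
  have "(\<integral>\<^sup>+z. ennreal ((cmod (LINT w|lborel. \<kappa> w *\<^sub>R G z w))\<^sup>2) \<partial>lborel) \<le> (\<integral>\<^sup>+z. (M z)\<^sup>2 \<partial>lborel)"
    by (intro nn_integral_mono) (simp add: ennreal_power[symmetric] power_mono le)
  also note MI
  finally have *: "(\<integral>\<^sup>+z. ennreal ((cmod (LINT w|lborel. \<kappa> w *\<^sub>R G z w))\<^sup>2) \<partial>lborel) \<le> ennreal ((I * B)\<^sup>2)" .
  have m: "(\<lambda>z. LINT w|lborel. \<kappa> w *\<^sub>R G z w) \<in> borel_measurable borel"
    using lborel.borel_measurable_lebesgue_integral[of "\<lambda>z w. \<kappa> w *\<^sub>R G z w" lborel] by measurable
  show "(\<lambda>z. LINT w|lborel. \<kappa> w *\<^sub>R G z w) \<in> L2"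
    "norm_L2 (\<lambda>z. LINT w|lborel. \<kappa> w *\<^sub>R G z w) \<le> (LINT w|lborel. \<bar>\<kappa> w\<bar>) * B"
    using L2I_nn_integral[OF m *] I(2) B(2) unfolding I_def by auto
qed

text \<open>
  For the projection \<open>P\<close> onto some of the coordinates this is a convolution in those coordinates only. The
  integral nevertheless runs over the whole space, so that only one measure occurs. The kernel then has to carry a weight
  of mass \<open>1\<close> in the remaining coordinates.
\<close>

definition conv :: "('a \<Rightarrow> 'a) \<Rightarrow> ('a \<Rightarrow> real) \<Rightarrow> ('a::euclidean_space \<Rightarrow> complex) \<Rightarrow> 'a \<Rightarrow> complex" where
  "conv P \<kappa> g z = (LINT w|lborel. \<kappa> w *\<^sub>R g (z - P w))"

lemma conv_L2:
  assumes [measurable]: "P \<in> borel_measurable borel" and \<kappa>: "integrable lborel \<kappa>" and g: "g \<in> L2"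
  shows "AE z in lborel. integrable lborel (\<lambda>w. \<kappa> w *\<^sub>R g (z - P w))"
    and "conv P \<kappa> g \<in> L2"
    and "norm_L2 (conv P \<kappa> g) \<le> (LINT w|lborel. \<bar>\<kappa> w\<bar>) * norm_L2 g"
proof -
  note [measurable] = L2_measurable[OF g]
  have m: "(\<lambda>(z, w). g (z - P w)) \<in> borel_measurable (lborel \<Otimes>\<^sub>M lborel)" by measurable
  have b: "(\<integral>\<^sup>+z. ennreal ((cmod (g (z - P w)))\<^sup>2) \<partial>lborel) \<le> ennreal ((norm_L2 g)\<^sup>2)" for w
    using nn_integral_translate[of "\<lambda>z. ennreal ((cmod (g z))\<^sup>2)" "- P w"] L2_nn_integral[OF g] by simp
  show "AE z in lborel. integrable lborel (\<lambda>w. \<kappa> w *\<^sub>R g (z - P w))"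
    "conv P \<kappa> g \<in> L2" "norm_L2 (conv P \<kappa> g) \<le> (LINT w|lborel. \<bar>\<kappa> w\<bar>) * norm_L2 g"
    using averaging_L2[OF \<kappa> m b norm_L2_nonneg] unfolding conv_def[abs_def] by auto
qed

lemma conv_add:
  assumes "P \<in> borel_measurable borel" "integrable lborel \<kappa>" "g \<in> L2" "h \<in> L2"
  shows "AE z in lborel. conv P \<kappa> (\<lambda>x. g x + h x) z = conv P \<kappa> g z + conv P \<kappa> h z"
  using conv_L2(1)[OF assms(1,2,3)] conv_L2(1)[OF assms(1,2,4)]
  by eventually_elim (simp add: conv_def scaleR_add_right)

lemma conv_cmult: "conv P \<kappa> (\<lambda>x. c * g x) z = c * conv P \<kappa> g z"
  unfolding conv_def by (subst integral_mult_right_zero[symmetric]) (simp add: algebra_simps)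

lemma conv_diff:
  assumes "P \<in> borel_measurable borel" "integrable lborel \<kappa>" "g \<in> L2" "h \<in> L2"
  shows "AE z in lborel. conv P \<kappa> (\<lambda>x. g x - h x) z = conv P \<kappa> g z - conv P \<kappa> h z"
  using conv_L2(1)[OF assms(1,2,3)] conv_L2(1)[OF assms(1,2,4)]
  by eventually_elim (simp add: conv_def scaleR_diff_right)

lemma conv_zero: "conv P \<kappa> (\<lambda>x. 0) z = 0"
  by (simp add: conv_def)

lemma conv_sum:
  assumes "P \<in> borel_measurable borel" "integrable lborel \<kappa>" "finite A" "\<And>i. i \<in> A \<Longrightarrow> g i \<in> L2"
  shows "AE z in lborel. conv P \<kappa> (\<lambda>x. \<Sum>i\<in>A. g i x) z = (\<Sum>i\<in>A. conv P \<kappa> (g i) z)"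
  using assms(3,4)
proof (induction A rule: finite_induct)
  case (insert i A)
  have "AE z in lborel. conv P \<kappa> (\<lambda>x. g i x + (\<Sum>i\<in>A. g i x)) z = conv P \<kappa> (g i) z + conv P \<kappa> (\<lambda>x. \<Sum>i\<in>A. g i x) z"
    by (rule conv_add[OF assms(1,2)]) (use insert in \<open>auto intro: L2_sum\<close>)
  moreover have "AE z in lborel. conv P \<kappa> (\<lambda>x. \<Sum>i\<in>A. g i x) z = (\<Sum>i\<in>A. conv P \<kappa> (g i) z)"
    using insert by auto
  ultimately show ?case
    by eventually_elim (use insert(1,2) in simp)
qed (simp add: conv_zero)

lemma conv_kernel_diff:
  assumes "P \<in> borel_measurable borel" "integrable lborel \<kappa>" "integrable lborel \<kappa>'" "g \<in> L2"
  shows "AE z in lborel. conv P (\<lambda>w. \<kappa> w - \<kappa>' w) g z = conv P \<kappa> g z - conv P \<kappa>' g z"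
  using conv_L2(1)[OF assms(1,2,4)] conv_L2(1)[OF assms(1,3,4)]
  by eventually_elim (simp add: conv_def scaleR_diff_left)

lemma conv_kernel_sum:
  assumes "P \<in> borel_measurable borel" "\<And>i. i \<in> A \<Longrightarrow> integrable lborel (\<kappa> i)" "finite A" "g \<in> L2"
  shows "AE z in lborel. conv P (\<lambda>w. \<Sum>i\<in>A. \<kappa> i w) g z = (\<Sum>i\<in>A. conv P (\<kappa> i) g z)"
proof -
  have "AE z in lborel. \<forall>i\<in>A. integrable lborel (\<lambda>w. \<kappa> i w *\<^sub>R g (z - P w))"
    using assms conv_L2(1)[OF assms(1)] by (intro AE_finite_allI) auto
  then show ?thesis
    by eventually_elim (simp add: conv_def scaleR_sum_left)
qed

lemma conv_kernel_cmult: "conv P (\<lambda>w. c * \<kappa> w) g z = c *\<^sub>R conv P \<kappa> g z"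
  unfolding conv_def by (subst integral_scaleR_right[symmetric]) (simp add: scaleR_scaleR)

text \<open>
  By Tonelli, since every translate of a null set is a null set.
\<close>

lemma AE_AE_shift:
  fixes P :: "'a::euclidean_space \<Rightarrow> 'a"
  assumes [measurable]: "P \<in> borel_measurable borel" and "AE z in lborel. Q z"
  shows "AE z in lborel. AE w in lborel. Q (z - P w)"
proof -
  obtain N where N: "N \<in> null_sets lborel" "{x. \<not> Q x} \<subseteq> N"
    using assms(2) by (auto simp: eventually_ae_filter)
  then have [measurable]: "N \<in> sets borel" by auto
  have "(\<integral>\<^sup>+z. \<integral>\<^sup>+w. indicator N (z - P w) \<partial>lborel \<partial>lborel) = (\<integral>\<^sup>+w. \<integral>\<^sup>+z. indicator N (z - P w) \<partial>lborel \<partial>(lborel :: 'a measure))"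
    by (rule lborel_pair.Fubini'[symmetric]) measurable
  also have "\<dots> = (\<integral>\<^sup>+w. 0 \<partial>(lborel :: 'a measure))"
  proof (intro nn_integral_cong)
    fix w :: 'a
    have "(\<integral>\<^sup>+z. indicator N (z + - P w) \<partial>lborel) = (\<integral>\<^sup>+z. indicator N z \<partial>lborel)"
      by (rule nn_integral_translate) measurable
    also have "\<dots> = 0" using N(1) by auto
    finally show "(\<integral>\<^sup>+z. indicator N (z - P w) \<partial>lborel) = 0" by simp
  qed
  finally have "(\<integral>\<^sup>+z. \<integral>\<^sup>+w. indicator N (z - P w) \<partial>lborel \<partial>(lborel :: 'a measure)) = 0" by simp
  then have "AE z in lborel. (\<integral>\<^sup>+w. indicator N (z - P w) \<partial>(lborel :: 'a measure)) = 0"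
    by (rule iffD1[OF nn_integral_0_iff_AE, rotated]) measurable
  then show ?thesis
  proof eventually_elim
    case (elim z)
    then have "AE w in lborel. indicator N (z - P w) = (0::ennreal)"
      by (subst (asm) nn_integral_0_iff_AE) auto
    then show ?case using N(2) by (auto simp: indicator_def elim!: eventually_mono split: if_splits)
  qed
qed

text \<open>
  The value at \<open>z\<close> depends on \<open>g\<close> only at the points \<open>z - P w\<close>. A condition on
  coordinates that \<open>P\<close> does not move, or on how far \<open>w\<close> has to be away from the origin, is
  passed on in this way.
\<close>

lemma conv_cong_on:
  fixes P :: "'a::euclidean_space \<Rightarrow> 'a"
  assumes [measurable]: "P \<in> borel_measurable borel" "\<kappa> \<in> borel_measurable borel" "g \<in> borel_measurable borel" "h \<in> borel_measurable borel"
    and E: "AE z in lborel. z \<in> E \<longrightarrow> g z = h z" "\<And>z w. z \<in> A \<Longrightarrow> \<kappa> w \<noteq> 0 \<Longrightarrow> z - P w \<in> E"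
  shows "AE z in lborel. z \<in> A \<longrightarrow> conv P \<kappa> g z = conv P \<kappa> h z"
  using AE_AE_shift[OF assms(1) E(1)]
proof eventually_elim
  case (elim z)
  show ?case
  proof
    assume "z \<in> A"
    from elim have "AE w in lborel. \<kappa> w *\<^sub>R g (z - P w) = \<kappa> w *\<^sub>R h (z - P w)"
      using E(2)[OF \<open>z \<in> A\<close>] by (auto elim!: eventually_mono)
    then show "conv P \<kappa> g z = conv P \<kappa> h z"
      unfolding conv_def by (intro integral_cong_AE) auto
  qed
qed

lemma conv_cong_AE:
  fixes P :: "'a::euclidean_space \<Rightarrow> 'a"
  assumes "P \<in> borel_measurable borel" "\<kappa> \<in> borel_measurable borel" "g \<in> borel_measurable borel" "h \<in> borel_measurable borel"
    and "AE z in lborel. g z = h z"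
  shows "AE z in lborel. conv P \<kappa> g z = conv P \<kappa> h z"
  using conv_cong_on[OF assms(1-4), of UNIV UNIV] assms(5) by simp

lemma conv_vanish_on:
  fixes P :: "'a::euclidean_space \<Rightarrow> 'a"
  assumes "P \<in> borel_measurable borel" "\<kappa> \<in> borel_measurable borel" "g \<in> borel_measurable borel"
    and "AE z in lborel. z \<in> E \<longrightarrow> g z = 0" "\<And>z w. z \<in> A \<Longrightarrow> \<kappa> w \<noteq> 0 \<Longrightarrow> z - P w \<in> E"
  shows "AE z in lborel. z \<in> A \<longrightarrow> conv P \<kappa> g z = 0"
  using conv_cong_on[of P \<kappa> g "\<lambda>_. 0" E A] assms by (simp add: conv_zero)

lemma bounded_support_integrable:
  fixes h :: "'a::euclidean_space \<Rightarrow> real"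
  assumes [measurable]: "h \<in> borel_measurable borel" and "\<And>x. \<bar>h x\<bar> \<le> B" "\<And>x. norm x > M \<Longrightarrow> h x = 0"
  shows "integrable lborel h"
proof (rule Bochner_Integration.integrable_bound)
  show "integrable lborel (\<lambda>x::'a. B * indicator (cball 0 M) x)"
    using emeasure_bounded_finite[OF bounded_cball[of "0::'a" M]]
    by (auto intro!: integrable_mult_right integrable_real_indicator)
  have "\<bar>h x\<bar> \<le> \<bar>B * indicator (cball 0 M) x\<bar>" for x
    using assms(2)[of x] assms(3)[of x] by (cases "norm x > M") (auto simp: indicator_def)
  then show "AE x in lborel. norm (h x) \<le> norm (B * indicator (cball 0 M) x)" by simp
qed measurable

lemma bounded_support_L2:
  fixes h :: "'a::euclidean_space \<Rightarrow> real"
  assumes [measurable]: "h \<in> borel_measurable borel" and "\<And>x. \<bar>h x\<bar> \<le> B" "\<And>x. norm x > M \<Longrightarrow> h x = 0"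
  shows "(\<lambda>x. h x *\<^sub>R c) \<in> L2"
proof -
  have "integrable lborel (\<lambda>x. (h x)\<^sup>2)"
  proof (rule bounded_support_integrable[where B = "B\<^sup>2" and M = M])
    show "\<bar>(h x)\<^sup>2\<bar> \<le> B\<^sup>2" for x
      using power_mono[OF assms(2), of x 2] by simp
  qed (use assms in auto)
  then show ?thesis by (simp add: L2_def power_mult_distrib)
qed

lemma test_function_L2:
  assumes "test_function \<phi>"
  shows "(\<lambda>x. \<phi> x *\<^sub>R c) \<in> L2"
    and "b \<in> Basis \<Longrightarrow> (\<lambda>x. frechet_derivative \<phi> (at x) b *\<^sub>R c) \<in> L2"
proof -
  obtain M where M: "\<And>x. norm x > M \<Longrightarrow> \<phi> x = 0" "\<And>x b. norm x > M \<Longrightarrow> frechet_derivative \<phi> (at x) b = 0"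
    using test_function_support[OF assms] by metis
  have *: "(\<lambda>x. h x *\<^sub>R c) \<in> L2" if h: "continuous_on UNIV h" "\<And>x. norm x > M \<Longrightarrow> h x = 0" for h :: "'a \<Rightarrow> real"
  proof -
    obtain B where "\<And>x. \<bar>h x\<bar> \<le> B" using continuous_bounded_of_support[OF h] by metis
    then show ?thesis
      by (rule bounded_support_L2[OF borel_measurable_continuous_onI[OF h(1)]]) (rule h)
  qed
  show "(\<lambda>x. \<phi> x *\<^sub>R c) \<in> L2" by (intro * test_function_continuous(1)[OF assms] M)
  show "b \<in> Basis \<Longrightarrow> (\<lambda>x. frechet_derivative \<phi> (at x) b *\<^sub>R c) \<in> L2"
    by (intro * test_function_continuous(2)[OF assms] M)
qed

lemma L2_test_integrable:
  assumes "(\<lambda>x. \<psi> x *\<^sub>R (1::complex)) \<in> L2" "u \<in> L2"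
  shows "integrable lborel (\<lambda>x. \<psi> x *\<^sub>R u x)"
proof -
  have "(\<lambda>x. Re (\<psi> x *\<^sub>R (1::complex))) \<in> borel_measurable borel"
    using L2_measurable[OF assms(1)] by measurable
  then have [measurable]: "\<psi> \<in> borel_measurable borel" by simp
  note [measurable] = L2_measurable[OF assms(2)]
  show ?thesis
    by (rule Bochner_Integration.integrable_bound[OF L2_integral_norm_mult_le(1)[OF assms]]) auto
qed

text \<open>
  Fubini, and the translation that moves the shift from \<open>u\<close> to \<open>\<psi>\<close>.
\<close>

lemma pairing_conv:
  fixes P :: "'a::euclidean_space \<Rightarrow> 'a"
  assumes [measurable]: "P \<in> borel_measurable borel" and \<kappa>: "integrable lborel \<kappa>" and u: "u \<in> L2"
    and \<psi>: "(\<lambda>x. \<psi> x *\<^sub>R (1::complex)) \<in> L2"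
  shows "(LINT z|lborel. \<psi> z *\<^sub>R conv P \<kappa> u z) = (LINT w|lborel. \<kappa> w *\<^sub>R (LINT z|lborel. \<psi> (z + P w) *\<^sub>R u z))"
proof -
  note [measurable] = L2_measurable[OF u] borel_measurable_integrable[OF \<kappa>]
  have "(\<lambda>x. Re (\<psi> x *\<^sub>R (1::complex))) \<in> borel_measurable borel"
    using L2_measurable[OF \<psi>] by measurable
  then have [measurable]: "\<psi> \<in> borel_measurable borel" by simp
  let ?f = "\<lambda>z w. \<psi> z *\<^sub>R (\<kappa> w *\<^sub>R u (z - P w))"
  have "(\<integral>\<^sup>+p. ennreal (norm (case_prod ?f p)) \<partial>(lborel \<Otimes>\<^sub>M lborel)) = (\<integral>\<^sup>+w. \<integral>\<^sup>+z. ennreal (norm (?f z w)) \<partial>lborel \<partial>lborel)"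
    by (subst lborel_pair.nn_integral_snd[symmetric]) auto
  also have "\<dots> \<le> (\<integral>\<^sup>+w. ennreal \<bar>\<kappa> w\<bar> * ennreal (norm_L2 (\<lambda>x. \<psi> x *\<^sub>R (1::complex)) * norm_L2 u) \<partial>lborel)"
  proof (intro nn_integral_mono)
    fix w
    have uw: "(\<lambda>z. u (z - P w)) \<in> L2" "norm_L2 (\<lambda>z. u (z - P w)) = norm_L2 u"
      using L2_translate[OF u, of "- P w"] by simp_all
    have "(\<integral>\<^sup>+z. ennreal (norm (?f z w)) \<partial>lborel) = (\<integral>\<^sup>+z. ennreal \<bar>\<kappa> w\<bar> * ennreal (cmod (\<psi> z *\<^sub>R 1) * cmod (u (z - P w))) \<partial>lborel)"
      by (intro nn_integral_cong) (simp add: ennreal_mult'[symmetric] abs_mult mult_ac)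
    also have "\<dots> = ennreal \<bar>\<kappa> w\<bar> * ennreal (LINT z|lborel. cmod (\<psi> z *\<^sub>R 1) * cmod (u (z - P w)))"
      using L2_integral_norm_mult_le(1)[OF \<psi> uw(1)]
      by (subst nn_integral_cmult) (auto intro!: arg_cong2[of _ _ _ _ "(*)"] nn_integral_eq_integral)
    also have "\<dots> \<le> ennreal \<bar>\<kappa> w\<bar> * ennreal (norm_L2 (\<lambda>x. \<psi> x *\<^sub>R (1::complex)) * norm_L2 u)"
      using L2_integral_norm_mult_le(2)[OF \<psi> uw(1)] uw(2) by (intro mult_left_mono ennreal_leI) auto
    finally show "(\<integral>\<^sup>+z. ennreal (norm (?f z w)) \<partial>lborel) \<le> \<dots>" .
  qed
  also have "\<dots> = ennreal (LINT w|lborel. \<bar>\<kappa> w\<bar>) * ennreal (norm_L2 (\<lambda>x. \<psi> x *\<^sub>R (1::complex)) * norm_L2 u)"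
    by (subst nn_integral_multc) (auto intro!: arg_cong2[of _ _ _ _ "(*)"] nn_integral_eq_integral integrable_abs \<kappa>)
  also have "\<dots> < \<infinity>" by (simp add: ennreal_mult_less_top)
  finally have int: "integrable (lborel \<Otimes>\<^sub>M lborel) (case_prod ?f)"
    by (intro integrableI_bounded) auto
  have "(LINT z|lborel. \<psi> z *\<^sub>R conv P \<kappa> u z) = (LINT z|lborel. LINT w|lborel. ?f z w)"
    unfolding conv_def by (simp del: scaleR_scaleR)
  also have "\<dots> = (LINT w|lborel. LINT z|lborel. ?f z w)"
    by (rule lborel_pair.Fubini_integral[OF int, symmetric])
  also have "\<dots> = (LINT w|lborel. \<kappa> w *\<^sub>R (LINT z|lborel. \<psi> (z + P w) *\<^sub>R u z))"
  proof (intro Bochner_Integration.integral_cong refl)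
    fix w
    have "(LINT z|lborel. ?f z w) = \<kappa> w *\<^sub>R (LINT z|lborel. \<psi> z *\<^sub>R u (z - P w))"
      by (subst integral_scaleR_right[symmetric]) (simp add: mult.commute)
    also have "(LINT z|lborel. \<psi> z *\<^sub>R u (z - P w)) = (LINT z|lborel. \<psi> (z + P w) *\<^sub>R u z)"
      using integral_translate[of "\<lambda>z. \<psi> z *\<^sub>R u (z - P w)" "P w"] by simp
    finally show "(LINT z|lborel. ?f z w) = \<kappa> w *\<^sub>R (LINT z|lborel. \<psi> (z + P w) *\<^sub>R u z)" .
  qed
  finally show ?thesis .
qed

lemma frechet_derivative_translate:
  assumes "test_function \<phi>"
  shows "frechet_derivative (\<lambda>z. \<phi> (z + v)) (at z) b = frechet_derivative \<phi> (at (z + v)) b"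
proof -
  have "((\<lambda>z. \<phi> (z + v)) has_derivative (\<lambda>u. frechet_derivative \<phi> (at (z + v)) u)) (at z)"
    by (rule has_derivative_compose[OF _ test_function_has_derivative[OF assms]])
       (auto intro!: derivative_eq_intros)
  then show ?thesis by (rule fun_cong[OF frechet_derivative_at, symmetric])
qed

text \<open>
  By \<open>pairing_conv\<close> the pairing with a test function is an average of pairings with its translates, and these
  are test functions too.
\<close>

lemma has_weak_deriv_conv:
  fixes P :: "'a::euclidean_space \<Rightarrow> 'a"
  assumes P: "P \<in> borel_measurable borel" and \<kappa>: "integrable lborel \<kappa>" and u: "u \<in> L2" and v: "v \<in> L2" and b: "b \<in> Basis"
    and w: "has_weak_deriv u b v"
  shows "has_weak_deriv (conv P \<kappa> u) b (conv P \<kappa> v)"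
  unfolding has_weak_deriv_def
proof (intro allI impI)
  fix \<phi> :: "'a \<Rightarrow> real" assume \<phi>: "test_function \<phi>"
  have "(LINT z|lborel. frechet_derivative \<phi> (at z) b *\<^sub>R conv P \<kappa> u z)
      = (LINT w|lborel. \<kappa> w *\<^sub>R (LINT z|lborel. frechet_derivative \<phi> (at (z + P w)) b *\<^sub>R u z))"
    by (rule pairing_conv[OF P \<kappa> u test_function_L2(2)[OF \<phi> b]])
  also have "\<dots> = (LINT w|lborel. - (\<kappa> w *\<^sub>R (LINT z|lborel. \<phi> (z + P w) *\<^sub>R v z)))"
  proof (intro Bochner_Integration.integral_cong refl)
    fix x
    have "test_function (\<lambda>z. \<phi> (z + P x))"
      using test_function_affine[OF \<phi>, of 1 "P x"] by (simp add: add.commute)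
    then have "(LINT z|lborel. frechet_derivative \<phi> (at (z + P x)) b *\<^sub>R u z) = - (LINT z|lborel. \<phi> (z + P x) *\<^sub>R v z)"
      using w unfolding has_weak_deriv_def frechet_derivative_translate[OF \<phi>, symmetric] by blast
    then show "\<kappa> x *\<^sub>R (LINT z|lborel. frechet_derivative \<phi> (at (z + P x)) b *\<^sub>R u z) = - (\<kappa> x *\<^sub>R (LINT z|lborel. \<phi> (z + P x) *\<^sub>R v z))"
      by simp
  qed
  also have "\<dots> = - (LINT z|lborel. \<phi> z *\<^sub>R conv P \<kappa> v z)"
    by (subst pairing_conv[OF P \<kappa> v test_function_L2(1)[OF \<phi>]]) simp
  finally show "(LINT z|lborel. frechet_derivative \<phi> (at z) b *\<^sub>R conv P \<kappa> u z) = - (LINT z|lborel. \<phi> z *\<^sub>R conv P \<kappa> v z)" .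
qed

section \<open>Approximate identities\<close>

definition translation_continuous :: "('a::euclidean_space \<Rightarrow> complex) \<Rightarrow> bool" where
  "translation_continuous g \<longleftrightarrow> (\<forall>e>0. \<exists>d>0. \<forall>v. norm v < d \<longrightarrow> norm_L2 (\<lambda>x. g (x - v) - g x) < e)"

lemma translation_continuous_closed:
  assumes g: "g \<in> L2"
    and approx: "\<And>e. e > 0 \<Longrightarrow> \<exists>h\<in>L2. translation_continuous h \<and> norm_L2 (\<lambda>x. g x - h x) < e"
  shows "translation_continuous g"
  unfolding translation_continuous_def
proof (intro allI impI)
  fix e :: real assume "e > 0"
  then have "e/3 > 0" by simp
  then obtain h where h: "h \<in> L2" "translation_continuous h" "norm_L2 (\<lambda>x. g x - h x) < e/3"
    using approx by blast
  then obtain d where d: "d > 0" "\<And>v. norm v < d \<Longrightarrow> norm_L2 (\<lambda>x. h (x - v) - h x) < e/3"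
    using \<open>e/3 > 0\<close> unfolding translation_continuous_def by blast
  show "\<exists>d>0. \<forall>v. norm v < d \<longrightarrow> norm_L2 (\<lambda>x. g (x - v) - g x) < e"
  proof (intro exI[of _ d] conjI allI impI d(1))
    fix v :: 'a assume v: "norm v < d"
    have L: "(\<lambda>x. g (x - v)) \<in> L2" "(\<lambda>x. h (x - v)) \<in> L2"
      using L2_translate(1)[OF g, of "-v"] L2_translate(1)[OF h(1), of "-v"] by simp_all
    have "norm_L2 (\<lambda>x. g (x - v) - h (x - v)) = norm_L2 (\<lambda>x. g x - h x)"
      using L2_translate(2)[OF L2_diff[OF g h(1)], of "-v"] by simp
    moreover have "norm_L2 (\<lambda>x. g (x - v) - g x) \<le> norm_L2 (\<lambda>x. g (x - v) - h (x - v)) + norm_L2 (\<lambda>x. h (x - v) - g x)"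
      by (rule norm_L2_triangle_diff[OF L g])
    moreover have "norm_L2 (\<lambda>x. h (x - v) - g x) \<le> norm_L2 (\<lambda>x. h (x - v) - h x) + norm_L2 (\<lambda>x. h x - g x)"
      by (rule norm_L2_triangle_diff[OF L(2) h(1) g])
    moreover have "norm_L2 (\<lambda>x. h x - g x) = norm_L2 (\<lambda>x. g x - h x)" by (rule norm_L2_diff_commute)
    ultimately show "norm_L2 (\<lambda>x. g (x - v) - g x) < e" using h(3) d(2)[OF v] by linarith
  qed
qed

lemma translation_continuous_add:
  assumes g: "g \<in> L2" "translation_continuous g" and h: "h \<in> L2" "translation_continuous h"
  shows "translation_continuous (\<lambda>x. g x + h x)"
  unfolding translation_continuous_def
proof (intro allI impI)
  fix e :: real assume "e > 0"
  then have "e/2 > 0" by simp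
  then obtain d where d: "d > 0" "\<And>v. norm v < d \<Longrightarrow> norm_L2 (\<lambda>x. g (x - v) - g x) < e/2"
    using g(2) unfolding translation_continuous_def by blast
  obtain d' where d': "d' > 0" "\<And>v. norm v < d' \<Longrightarrow> norm_L2 (\<lambda>x. h (x - v) - h x) < e/2"
    using h(2) \<open>e/2 > 0\<close> unfolding translation_continuous_def by blast
  show "\<exists>d>0. \<forall>v. norm v < d \<longrightarrow> norm_L2 (\<lambda>x. (g (x - v) + h (x - v)) - (g x + h x)) < e"
  proof (intro exI[of _ "min d d'"] conjI allI impI)
    fix v :: 'a assume v: "norm v < min d d'"
    have L: "(\<lambda>x. g (x - v) - g x) \<in> L2" "(\<lambda>x. h (x - v) - h x) \<in> L2"
      using L2_translate(1)[OF g(1), of "-v"] L2_translate(1)[OF h(1), of "-v"] g h by (auto intro!: L2_diff)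
    have "norm_L2 (\<lambda>x. (g (x - v) + h (x - v)) - (g x + h x)) \<le> norm_L2 (\<lambda>x. g (x - v) - g x) + norm_L2 (\<lambda>x. h (x - v) - h x)"
      using norm_L2_triangle[OF L] by (simp add: algebra_simps)
    then show "norm_L2 (\<lambda>x. (g (x - v) + h (x - v)) - (g x + h x)) < e" using d(2)[of v] d'(2)[of v] v by simp
  qed (use d d' in auto)
qed

lemma translation_continuous_zero: "translation_continuous (\<lambda>x. 0)"
  by (auto simp: translation_continuous_def norm_L2_def intro: exI[of _ 1])

lemma translation_continuous_sum:
  assumes "finite A" "\<And>i. i \<in> A \<Longrightarrow> g i \<in> L2" "\<And>i. i \<in> A \<Longrightarrow> translation_continuous (g i)"
  shows "translation_continuous (\<lambda>x. \<Sum>i\<in>A. g i x)"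
  using assms
proof (induction A rule: finite_induct)
  case (insert i A)
  have "translation_continuous (\<lambda>x. g i x + (\<Sum>i\<in>A. g i x))"
    by (rule translation_continuous_add) (use insert in \<open>auto intro: L2_sum\<close>)
  then show ?case using insert by simp
qed (simp add: translation_continuous_zero)

lemma L2_indicator:
  assumes "B \<in> sets borel" "emeasure lborel B < \<infinity>"
  shows "(\<lambda>x. indicator B x *\<^sub>R (c::complex)) \<in> L2"
    and "norm_L2 (\<lambda>x. indicator B x *\<^sub>R c) = cmod c * sqrt (measure lborel B)"
proof -
  have i: "(cmod (indicator B x *\<^sub>R c))\<^sup>2 = indicator B x * (cmod c)\<^sup>2" for x
    by (auto simp: indicator_def)
  have "integrable lborel (\<lambda>x. indicator B x * (cmod c)\<^sup>2)"
    by (intro integrable_mult_left integrable_real_indicator) (use assms in auto)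
  then show "(\<lambda>x. indicator B x *\<^sub>R (c::complex)) \<in> L2"
    using assms(1) unfolding L2_def mem_Collect_eq i by auto
  show "norm_L2 (\<lambda>x. indicator B x *\<^sub>R c) = cmod c * sqrt (measure lborel B)"
    unfolding norm_L2_def i using assms by (simp add: real_sqrt_mult)
qed

text \<open>
  The measure of \<open>U\<close> minus its translate tends to zero by dominated convergence, and the translate minus
  \<open>U\<close> has the same measure.
\<close>

lemma translation_continuous_indicator_open:
  assumes U: "open U" "emeasure lborel U < \<infinity>"
  shows "translation_continuous (\<lambda>x::'a::euclidean_space. indicator U x *\<^sub>R (c::complex))"
proof (rule ccontr)
  assume "\<not> ?thesis"
  then obtain e where e: "e > 0" "\<And>d. d > 0 \<Longrightarrow> \<exists>v. norm v < d \<and> norm_L2 (\<lambda>x::'a. indicator U (x - v) *\<^sub>R c - indicator U x *\<^sub>R c) \<ge> e"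
    unfolding translation_continuous_def by (metis linorder_not_le)
  have "\<exists>v. norm v < inverse (real (Suc n)) \<and> norm_L2 (\<lambda>x::'a. indicator U (x - v) *\<^sub>R c - indicator U x *\<^sub>R c) \<ge> e" for n
    by (rule e(2)) simp
  then obtain v :: "nat \<Rightarrow> 'a" where v: "\<And>n. norm (v n) < inverse (real (Suc n))"
    "\<And>n. norm_L2 (\<lambda>x::'a. indicator U (x - v n) *\<^sub>R c - indicator U x *\<^sub>R c) \<ge> e"
    by metis
  have v0: "v \<longlonglongrightarrow> 0"
  proof (rule Lim_null_comparison)
    show "\<forall>\<^sub>F n in sequentially. norm (v n) \<le> inverse (real (Suc n))"
      using v(1) by (auto intro: always_eventually less_imp_le)
  qed (rule LIMSEQ_inverse_real_of_nat)
  have [measurable]: "U \<in> sets borel" using U(1) by simp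
  have intU: "integrable lborel (indicator U :: 'a \<Rightarrow> real)" using U by (intro integrable_real_indicator) auto
  have intUv: "integrable lborel (\<lambda>x. indicator U (x - v n) :: real)" for n
    using integrable_translate[OF intU, of "- v n"] by simp
  have intUv': "(LINT x|lborel. indicator U (x - v n) :: real) = (LINT x|lborel. indicator U x)" for n
    using integral_translate[of "indicator U :: 'a \<Rightarrow> real" "- v n"] by simp
  let ?m = "\<lambda>n x. max 0 (indicator U x - indicator U (x - v n)) :: real"
  have mlim: "(\<lambda>n. LINT x|lborel. ?m n x) \<longlonglongrightarrow> (LINT x|(lborel :: 'a measure). 0)"
  proof (rule integral_dominated_convergence[where w = "indicator U"])
    show "AE x in lborel. (\<lambda>n. ?m n x) \<longlonglongrightarrow> 0"
    proof (rule AE_I2)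
      fix x
      show "(\<lambda>n. ?m n x) \<longlonglongrightarrow> 0"
      proof (cases "x \<in> U")
        case True
        have "(\<lambda>n. x - v n) \<longlonglongrightarrow> x - 0" by (intro tendsto_intros v0)
        then have "\<forall>\<^sub>F n in sequentially. x - v n \<in> U" using U(1) True by (simp add: topological_tendstoD)
        then show ?thesis by (intro tendsto_eventually) (auto simp: True elim: eventually_mono)
      qed (simp add: indicator_def)
    qed
  qed (auto simp: intU indicator_def)
  have "(norm_L2 (\<lambda>x. indicator U (x - v n) *\<^sub>R c - indicator U x *\<^sub>R c))\<^sup>2 = (cmod c)\<^sup>2 * (2 * (LINT x|lborel. ?m n x))" for n
  proof -
    have "(cmod (indicator U (x - v n) *\<^sub>R c - indicator U x *\<^sub>R c))\<^sup>2
       = (cmod c)\<^sup>2 * ((indicator U (x - v n) - indicator U x) + 2 * ?m n x)" for x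
      by (auto simp: indicator_def)
    moreover have "integrable lborel (?m n)"
      by (rule Bochner_Integration.integrable_bound[OF intU]) (auto simp: indicator_def)
    ultimately show ?thesis
      unfolding norm_L2_power2 using intU intUv[of n] intUv'[of n] by simp
  qed
  moreover have "(\<lambda>n. (cmod c)\<^sup>2 * (2 * (LINT x|lborel. ?m n x))) \<longlonglongrightarrow> (cmod c)\<^sup>2 * (2 * 0)"
    using mlim by (intro tendsto_intros) simp
  ultimately have lim: "(\<lambda>n. (norm_L2 (\<lambda>x. indicator U (x - v n) *\<^sub>R c - indicator U x *\<^sub>R c))\<^sup>2) \<longlonglongrightarrow> 0" by simp
  have "e\<^sup>2 \<le> (norm_L2 (\<lambda>x. indicator U (x - v n) *\<^sub>R c - indicator U x *\<^sub>R c))\<^sup>2" for n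
    using v(2)[of n] e(1) by (intro power_mono) auto
  then have "e\<^sup>2 \<le> 0" using lim by (intro LIMSEQ_le_const[OF lim]) auto
  then show False using e(1) by simp
qed

text \<open>
  Outer regularity reduces this to open sets.
\<close>

lemma translation_continuous_indicator:
  assumes B: "B \<in> sets borel" "emeasure lborel B < \<infinity>"
  shows "translation_continuous (\<lambda>x::'a::euclidean_space. indicator B x *\<^sub>R (c::complex))"
proof (rule translation_continuous_closed[OF L2_indicator(1)[OF B]])
  fix e :: real assume "e > 0"
  define e' where "e' = (e / (cmod c + 1))\<^sup>2"
  have c1: "cmod c + 1 > 0" by (simp add: add_nonneg_pos)
  have "e' > 0" using \<open>e > 0\<close> c1 by (simp add: e'_def)
  then obtain U where U: "open U" "B \<subseteq> U" "emeasure lborel (U - B) < ennreal e'"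
    using outer_regular_lborel[OF B(1)] by metis
  have "emeasure lborel U \<le> emeasure lborel B + emeasure lborel (U - B)"
    using emeasure_subadditive[of B lborel "U - B"] B U by (simp add: Un_absorb1)
  also have "\<dots> < \<infinity>" using B(2) U(3) by (auto simp: less_top[symmetric] top_unique)
  finally have finU: "emeasure lborel U < \<infinity>" .
  have d: "indicator B x *\<^sub>R c - indicator U x *\<^sub>R c = indicator (U - B) x *\<^sub>R (- c)" for x
    using U(2) by (auto simp: indicator_def)
  have fin: "emeasure lborel (U - B) < \<infinity>" using U(3) by (rule less_trans) simp
  have "measure lborel (U - B) < e'"
    using U(3) fin \<open>e' > 0\<close> by (simp add: emeasure_eq_ennreal_measure less_top ennreal_less_iff)
  then have "sqrt (measure lborel (U - B)) < e / (cmod c + 1)"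
    using \<open>e > 0\<close> c1 unfolding e'_def by (intro real_less_lsqrt) auto
  then have "(cmod c + 1) * sqrt (measure lborel (U - B)) < e"
    using c1 by (simp add: pos_less_divide_eq mult.commute)
  moreover have "cmod c * sqrt (measure lborel (U - B)) \<le> (cmod c + 1) * sqrt (measure lborel (U - B))"
    by (intro mult_right_mono) auto
  ultimately have "cmod c * sqrt (measure lborel (U - B)) < e" by (rule le_less_trans[rotated])
  then have "norm_L2 (\<lambda>x. indicator B x *\<^sub>R c - indicator U x *\<^sub>R c) < e"
    unfolding d by (subst L2_indicator(2)) (use B U fin in auto)
  then show "\<exists>h\<in>L2. translation_continuous h \<and> norm_L2 (\<lambda>x. indicator B x *\<^sub>R c - h x) < e"
    using U(1) finU
    by (intro bexI[of _ "\<lambda>x. indicator U x *\<^sub>R c"] conjI translation_continuous_indicator_open L2_indicator(1)) auto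
qed

text \<open>
  Simple functions dominated by \<open>2 |g|\<close> approximate \<open>g\<close> in norm.
\<close>

lemma L2_translation_continuous:
  assumes g: "g \<in> L2"
  shows "translation_continuous g"
proof (rule translation_continuous_closed[OF g])
  fix e :: real assume "e > 0"
  note [measurable] = L2_measurable[OF g]
  obtain F where F: "\<And>i. simple_function lborel (F i)" "\<And>x. (\<lambda>i. F i x) \<longlonglongrightarrow> g x" "\<And>i x. cmod (F i x) \<le> 2 * cmod (g x)"
    using borel_measurable_implies_sequence_metric[of g lborel 0] by (auto simp: dist_norm)
  have [measurable]: "F i \<in> borel_measurable borel" for i
    using borel_measurable_simple_function[OF F(1)] by simp
  have FL: "F i \<in> L2" for i by (rule L2_dominated[OF g _ F(3)]) measurable
  have TC: "translation_continuous (F i)" for i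
  proof -
    have fin: "finite (range (F i))" using simple_functionD(1)[OF F(1), of i] by simp
    have B: "F i -` {y} \<in> sets borel" for y
      using measurable_sets[of "F i" borel borel "{y}"] by simp
    have fm: "emeasure lborel (F i -` {y}) < \<infinity>" if "y \<noteq> 0" for y
    proof -
      have "ennreal ((cmod y)\<^sup>2) * emeasure lborel (F i -` {y}) = (\<integral>\<^sup>+x. ennreal ((cmod y)\<^sup>2) * indicator (F i -` {y}) x \<partial>lborel)"
        using B by (simp add: nn_integral_cmult_indicator)
      also have "\<dots> \<le> (\<integral>\<^sup>+x. ennreal ((cmod (F i x))\<^sup>2) \<partial>lborel)"
        by (intro nn_integral_mono) (auto simp: indicator_def)
      also have "\<dots> < \<infinity>" by (simp add: L2_nn_integral[OF FL])
      finally show ?thesis using that by (auto simp: ennreal_mult_less_top)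
    qed
    have "F i = (\<lambda>x. \<Sum>y\<in>range (F i) - {0}. indicator (F i -` {y}) x *\<^sub>R y)"
    proof
      fix x
      have "(\<Sum>y\<in>range (F i) - {0}. indicator (F i -` {y}) x *\<^sub>R y) = (\<Sum>y\<in>range (F i) - {0}. if y = F i x then F i x else 0)"
        by (intro sum.cong) (auto simp: indicator_def)
      then show "F i x = (\<Sum>y\<in>range (F i) - {0}. indicator (F i -` {y}) x *\<^sub>R y)"
        using fin by (simp add: sum.delta')
    qed
    moreover have "translation_continuous (\<lambda>x. \<Sum>y\<in>range (F i) - {0}. indicator (F i -` {y}) x *\<^sub>R y)"
      using fin B fm by (intro translation_continuous_sum translation_continuous_indicator L2_indicator(1)) auto
    ultimately show ?thesis by simp
  qed
  have "(\<lambda>i. LINT x|lborel. (cmod (g x - F i x))\<^sup>2) \<longlonglongrightarrow> (LINT x|(lborel::'a measure). 0)"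
  proof (rule integral_dominated_convergence[where w = "\<lambda>x. 9 * (cmod (g x))\<^sup>2"])
    show "AE x in lborel. (\<lambda>i. (cmod (g x - F i x))\<^sup>2) \<longlonglongrightarrow> 0"
    proof (rule AE_I2)
      fix x
      have "(\<lambda>i. (cmod (g x - F i x))\<^sup>2) \<longlonglongrightarrow> (cmod (g x - g x))\<^sup>2" by (intro tendsto_intros F)
      then show "(\<lambda>i. (cmod (g x - F i x))\<^sup>2) \<longlonglongrightarrow> 0" by simp
    qed
    have "cmod (g x - F i x) \<le> 3 * cmod (g x)" for x i
      using norm_triangle_ineq4[of "g x" "F i x"] F(3)[of i x] by simp
    then have "(cmod (g x - F i x))\<^sup>2 \<le> (3 * cmod (g x))\<^sup>2" for x i by (intro power_mono) auto
    then show "AE x in lborel. norm ((cmod (g x - F i x))\<^sup>2) \<le> 9 * (cmod (g x))\<^sup>2" for i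
      by (simp add: power_mult_distrib)
  qed (use L2_integrable[OF g] in auto)
  then have "(\<lambda>i. sqrt (LINT x|lborel. (cmod (g x - F i x))\<^sup>2)) \<longlonglongrightarrow> sqrt 0" by (intro tendsto_intros) simp
  then have "\<forall>\<^sub>F i in sequentially. norm_L2 (\<lambda>x. g x - F i x) < e"
    unfolding norm_L2_def using \<open>e > 0\<close> by (intro order_tendstoD) auto
  then obtain i where "norm_L2 (\<lambda>x. g x - F i x) < e" by (auto dest: eventually_happens)
  then show "\<exists>h\<in>L2. translation_continuous h \<and> norm_L2 (\<lambda>x. g x - h x) < e"
    using FL TC by blast
qed

text \<open>
  Up to the constant \<open>c\<close> the difference is an average of the functions \<open>g (z - P w) - g z\<close> with
  \<open>P w\<close> small.
\<close>

lemma conv_approximate_identity: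
  fixes P :: "'a::euclidean_space \<Rightarrow> 'a" and \<kappa> :: "nat \<Rightarrow> 'a \<Rightarrow> real"
  assumes P[measurable]: "P \<in> borel_measurable borel" and \<kappa>: "\<And>n. integrable lborel (\<kappa> n)"
    and A: "\<And>n. (LINT w|lborel. \<bar>\<kappa> n w\<bar>) \<le> A" and c: "\<And>n. (LINT w|lborel. \<kappa> n w) = c"
    and conc: "\<And>d. d > 0 \<Longrightarrow> \<forall>\<^sub>F n in sequentially. \<forall>w. \<kappa> n w \<noteq> 0 \<longrightarrow> norm (P w) < d"
    and g: "g \<in> L2"
  shows "(\<lambda>n. norm_L2 (\<lambda>z. conv P (\<kappa> n) g z - c *\<^sub>R g z)) \<longlonglongrightarrow> 0"
proof (rule LIMSEQ_I)
  fix e :: real assume "e > 0"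
  note [measurable] = L2_measurable[OF g]
  have "A \<ge> 0" by (rule order_trans[OF _ A[of 0]]) (simp add: integral_nonneg_AE)
  define B where "B = e / (A + 1)"
  have "B > 0" "A * B < e" using \<open>e > 0\<close> \<open>A \<ge> 0\<close> by (auto simp: B_def field_simps)
  obtain d where d: "d > 0" "\<And>v. norm v < d \<Longrightarrow> norm_L2 (\<lambda>x. g (x - v) - g x) < B"
    using L2_translation_continuous[OF g] \<open>B > 0\<close> unfolding translation_continuous_def by blast
  from conc[OF d(1)] obtain N where N: "\<And>n w. n \<ge> N \<Longrightarrow> \<kappa> n w \<noteq> 0 \<Longrightarrow> norm (P w) < d"
    by (auto simp: eventually_sequentially)
  have "norm_L2 (\<lambda>z. conv P (\<kappa> n) g z - c *\<^sub>R g z) < e" if "n \<ge> N" for n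
  proof -
    have m: "(\<lambda>(z, w). g (z - P w) - g z) \<in> borel_measurable (lborel \<Otimes>\<^sub>M lborel)" by measurable
    have b: "(\<integral>\<^sup>+z. ennreal ((cmod (g (z - P w) - g z))\<^sup>2) \<partial>lborel) \<le> ennreal (B\<^sup>2)" if "\<kappa> n w \<noteq> 0" for w
    proof -
      have "(\<lambda>z. g (z - P w)) \<in> L2" using L2_translate(1)[OF g, of "- P w"] by simp
      then show ?thesis
        using d(2)[OF N[OF \<open>n \<ge> N\<close> that]]
        by (subst L2_nn_integral[OF L2_diff[OF _ g]]) (auto intro!: ennreal_leI power_mono norm_L2_nonneg)
    qed
    note * = averaging_L2[OF \<kappa>[of n] m b less_imp_le[OF \<open>B > 0\<close>]]
    have eq: "AE z in lborel. (LINT w|lborel. \<kappa> n w *\<^sub>R (g (z - P w) - g z)) = conv P (\<kappa> n) g z - c *\<^sub>R g z"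
      using conv_L2(1)[OF P \<kappa>[of n] g]
    proof eventually_elim
      case (elim z)
      have "integrable lborel (\<lambda>w. \<kappa> n w *\<^sub>R g z)" using \<kappa>[of n] by simp
      moreover have "(LINT w|lborel. \<kappa> n w *\<^sub>R g z) = c *\<^sub>R g z" using c[of n] \<kappa>[of n] by simp
      ultimately show ?case using elim by (simp add: scaleR_diff_right conv_def)
    qed
    have "norm_L2 (\<lambda>z. conv P (\<kappa> n) g z - c *\<^sub>R g z) = norm_L2 (\<lambda>z. LINT w|lborel. \<kappa> n w *\<^sub>R (g (z - P w) - g z))"
      using L2_measurable[OF *(2)] L2_measurable[OF L2_diff[OF conv_L2(2)[OF P \<kappa>[of n] g] L2_scaleR[OF g, of c]]] eq
      by (intro norm_L2_cong_AE) auto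
    also have "\<dots> \<le> (LINT w|lborel. \<bar>\<kappa> n w\<bar>) * B" by (rule *(3))
    also have "\<dots> \<le> A * B" using A \<open>B > 0\<close> by (intro mult_right_mono) auto
    finally show ?thesis using \<open>A * B < e\<close> by simp
  qed
  then show "\<exists>no. \<forall>n\<ge>no. norm (norm_L2 (\<lambda>z. conv P (\<kappa> n) g z - c *\<^sub>R g z) - 0) < e"
    by (intro exI[of _ N]) (simp add: abs_norm_L2)
qed

section \<open>Weak derivatives\<close>

text \<open>
  Averages of \<open>u\<close> against test functions concentrated near a point vanish, and they converge to
  \<open>u\<close>.
\<close>

lemma L2_eq_0_if_test:
  fixes u :: "'a::euclidean_space \<Rightarrow> complex"
  assumes u: "u \<in> L2" and zero: "\<And>\<phi>. test_function \<phi> \<Longrightarrow> (LINT x|lborel. \<phi> x *\<^sub>R u x) = 0"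
  shows "AE x in lborel. u x = 0"
proof -
  note [measurable] = L2_measurable[OF u]
  define \<rho> :: "nat \<Rightarrow> 'a \<Rightarrow> real" where "\<rho> n x = cutoff Basis 1 (real (Suc n) *\<^sub>R x)" for n x
  have test: "test_function (\<rho> n)" for n
    using test_function_affine[OF test_function_cutoff, of "real (Suc n)" 1 0] by (simp add: \<rho>_def[abs_def])
  have small: "norm x \<le> real DIM('a) * (2 / real (Suc n))" if "\<rho> n x \<noteq> 0" for n x
  proof -
    have "\<bar>x \<bullet> b\<bar> \<le> 2 / real (Suc n)" if "b \<in> Basis" for b
    proof -
      have "\<bar>real (Suc n) *\<^sub>R x \<bullet> b\<bar> < 2"
        using cutoff_eq_0[of Basis b 1 "real (Suc n) *\<^sub>R x"] \<open>b \<in> Basis\<close> \<open>\<rho> n x \<noteq> 0\<close> unfolding \<rho>_def by force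
      then have "real (Suc n) * \<bar>x \<bullet> b\<bar> < 2" by (simp add: abs_mult del: of_nat_Suc)
      then show ?thesis by (simp add: pos_le_divide_eq mult.commute del: of_nat_Suc)
    qed
    then have "(\<Sum>b\<in>Basis. \<bar>x \<bullet> b\<bar>) \<le> real DIM('a) * (2 / real (Suc n))"
      by (rule sum_bounded_above)
    then show ?thesis using norm_le_l1[of x] by linarith
  qed
  have cont: "continuous_on UNIV (\<rho> n)" for n by (rule test_function_continuous(1)[OF test])
  have [measurable]: "\<rho> n \<in> borel_measurable borel" for n by (rule borel_measurable_continuous_onI[OF cont])
  have nonneg: "\<rho> n x \<ge> 0" for n x by (simp add: \<rho>_def cutoff_nonneg)
  have int: "integrable lborel (\<rho> n)" for n
  proof (rule bounded_support_integrable[where B = 1])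
    show "\<bar>\<rho> n x\<bar> \<le> 1" for x by (simp add: \<rho>_def cutoff_nonneg cutoff_le_1)
    show "norm x > real DIM('a) * (2 / real (Suc n)) \<Longrightarrow> \<rho> n x = 0" for x using small[of n x] by force
  qed measurable
  define I where "I n = (LINT x|lborel. \<rho> n x)" for n
  have I: "I n > 0" for n
  proof -
    have "I n \<noteq> 0"
    proof
      assume "I n = 0"
      then have "AE x in lborel. \<rho> n x = 0"
        unfolding I_def by (subst (asm) integral_nonneg_eq_0_iff_AE[OF int]) (auto simp: nonneg)
      moreover have "\<rho> n x = 1" if "x \<in> ball 0 (1 / real (Suc n))" for x
        unfolding \<rho>_def
      proof (rule cutoff_eq_1)
        fix b :: 'a assume "b \<in> Basis"
        then have "\<bar>x \<bullet> b\<bar> \<le> 1 / real (Suc n)" using Basis_le_norm[of b x] that by simp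
        then have "real (Suc n) * \<bar>x \<bullet> b\<bar> \<le> 1" by (simp add: pos_le_divide_eq mult.commute del: of_nat_Suc)
        then show "\<bar>real (Suc n) *\<^sub>R x \<bullet> b\<bar> \<le> 1" by (simp add: abs_mult del: of_nat_Suc)
      qed
      ultimately have "AE x in lborel. x \<notin> ball (0::'a) (1 / real (Suc n))"
        by (auto elim!: eventually_mono)
      then have "ball (0::'a) (1 / real (Suc n)) \<in> null_sets lborel"
        by (subst AE_iff_null_sets) auto
      then have "emeasure lborel (ball (0::'a) (1 / real (Suc n))) = 0" by auto
      then have "negligible (ball (0::'a) (1 / real (Suc n)))"
        by (simp add: negligible_iff_emeasure0)
      then show False using open_not_negligible[of "ball (0::'a) (1 / real (Suc n))"] by simp
    qed
    moreover have "I n \<ge> 0" unfolding I_def by (simp add: integral_nonneg_AE nonneg)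
    ultimately show ?thesis by simp
  qed
  define \<kappa> where "\<kappa> n x = \<rho> n x / I n" for n x
  have z: "conv uminus (\<kappa> n) u z = 0" for n z
  proof -
    have "conv uminus (\<kappa> n) u z = (LINT w|lborel. (\<kappa> n w / 1) *\<^sub>R u (z + w))"
      by (simp add: conv_def)
    also have "\<dots> = (LINT w|lborel. \<kappa> n (w - z) *\<^sub>R u w)"
      using integral_translate[of "\<lambda>w. \<kappa> n (w - z) *\<^sub>R u w" z] by (simp add: \<kappa>_def add.commute)
    also have "\<dots> = inverse (I n) *\<^sub>R (LINT w|lborel. \<rho> n (w - z) *\<^sub>R u w)"
      by (subst integral_scaleR_right[symmetric]) (simp add: \<kappa>_def divide_inverse mult.commute)
    also have "(LINT w|lborel. \<rho> n (w - z) *\<^sub>R u w) = 0"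
      using zero[OF test_function_affine[OF test[of n], of 1 "- z"]] by simp
    finally show ?thesis by simp
  qed
  have "(\<lambda>n. norm_L2 (\<lambda>z. conv uminus (\<kappa> n) u z - 1 *\<^sub>R u z)) \<longlonglongrightarrow> 0"
  proof (rule conv_approximate_identity[where A = 1])
    show "integrable lborel (\<kappa> n)" for n using int by (simp add: \<kappa>_def[abs_def])
    show "(LINT w|lborel. \<kappa> n w) = 1" for n using I[of n] by (simp add: \<kappa>_def[abs_def] I_def)
    then show "(LINT w|lborel. \<bar>\<kappa> n w\<bar>) \<le> 1" for n using nonneg I[of n] by (simp add: \<kappa>_def)
    fix d :: real assume "d > 0"
    have "(\<lambda>n. real DIM('a) * (2 * inverse (real (Suc n)))) \<longlonglongrightarrow> real DIM('a) * (2 * 0)"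
      by (intro tendsto_intros LIMSEQ_inverse_real_of_nat)
    then have "\<forall>\<^sub>F n in sequentially. real DIM('a) * (2 * inverse (real (Suc n))) < d"
      using \<open>d > 0\<close> by (intro order_tendstoD) auto
    then show "\<forall>\<^sub>F n in sequentially. \<forall>w. \<kappa> n w \<noteq> 0 \<longrightarrow> norm (- w) < d"
    proof eventually_elim
      case (elim n)
      show ?case
      proof (intro allI impI)
        fix w assume "\<kappa> n w \<noteq> 0"
        then have "\<rho> n w \<noteq> 0" by (simp add: \<kappa>_def)
        from small[OF this] elim show "norm (- w) < d" by (simp add: divide_inverse)
      qed
    qed
  qed (use u in auto)
  then have "(\<lambda>n::nat. norm_L2 u) \<longlonglongrightarrow> 0" by (simp add: z norm_L2_def)
  then have "norm_L2 u = 0" by (simp add: LIMSEQ_const_iff)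
  then show ?thesis by (rule norm_L2_eq_0_AE[OF u])
qed

lemma test_integrable:
  assumes "test_function \<phi>" "u \<in> L2"
  shows "integrable lborel (\<lambda>x. \<phi> x *\<^sub>R u x)"
    and "b \<in> Basis \<Longrightarrow> integrable lborel (\<lambda>x. frechet_derivative \<phi> (at x) b *\<^sub>R u x)"
  by (rule L2_test_integrable[OF test_function_L2(1)[OF assms(1)] assms(2)],
      rule L2_test_integrable[OF test_function_L2(2)[OF assms(1)] assms(2)])

lemma has_weak_deriv_unique:
  assumes "v \<in> L2" "v' \<in> L2" "has_weak_deriv u b v" "has_weak_deriv u b v'"
  shows "AE x in lborel. v x = v' x"
proof -
  have "AE x in lborel. v x - v' x = 0"
  proof (rule L2_eq_0_if_test)
    fix \<phi> :: "'a \<Rightarrow> real" assume \<phi>: "test_function \<phi>"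
    then have "- (LINT x|lborel. \<phi> x *\<^sub>R v x) = - (LINT x|lborel. \<phi> x *\<^sub>R v' x)"
      using assms(3,4) unfolding has_weak_deriv_def by metis
    then show "(LINT x|lborel. \<phi> x *\<^sub>R (v x - v' x)) = 0"
      using test_integrable(1)[OF \<phi>] assms(1,2) by (simp add: scaleR_diff_right)
  qed (intro L2_diff assms)
  then show ?thesis by simp
qed

lemma weak_deriv_AE:
  assumes "v \<in> L2" "has_weak_deriv u b v"
  shows "weak_deriv u b \<in> L2" "AE x in lborel. weak_deriv u b x = v x"
proof -
  have *: "weak_deriv u b \<in> L2 \<and> has_weak_deriv u b (weak_deriv u b)"
    unfolding weak_deriv_def by (rule someI[of _ v]) (use assms in auto)
  then show "weak_deriv u b \<in> L2" by simp
  show "AE x in lborel. weak_deriv u b x = v x"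
    by (rule has_weak_deriv_unique) (use * assms in auto)
qed

lemma has_weak_deriv_cmult:
  assumes "has_weak_deriv u b v"
  shows "has_weak_deriv (\<lambda>x. c * u x) b (\<lambda>x. c * v x)"
proof -
  have *: "(LINT x|lborel. \<psi> x *\<^sub>R (c * w x)) = c * (LINT x|lborel. \<psi> x *\<^sub>R w x)" for \<psi> :: "'a \<Rightarrow> real" and w
    by (subst integral_mult_right_zero[symmetric]) (simp add: algebra_simps)
  show ?thesis using assms unfolding has_weak_deriv_def * by simp
qed

lemma has_weak_deriv_diff:
  fixes u :: "'a::euclidean_space \<Rightarrow> complex"
  assumes "u \<in> L2" "u' \<in> L2" "v \<in> L2" "v' \<in> L2" "b \<in> Basis" "has_weak_deriv u b v" "has_weak_deriv u' b v'"
  shows "has_weak_deriv (\<lambda>x. u x - u' x) b (\<lambda>x. v x - v' x)"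
  unfolding has_weak_deriv_def
proof (intro allI impI)
  fix \<phi> :: "'a \<Rightarrow> real" assume \<phi>: "test_function \<phi>"
  note I = test_integrable(2)[OF \<phi> assms(1,5)] test_integrable(2)[OF \<phi> assms(2,5)]
    test_integrable(1)[OF \<phi> assms(3)] test_integrable(1)[OF \<phi> assms(4)]
  show "(LINT x|lborel. frechet_derivative \<phi> (at x) b *\<^sub>R (u x - u' x)) = - (LINT x|lborel. \<phi> x *\<^sub>R (v x - v' x))"
    unfolding scaleR_diff_right Bochner_Integration.integral_diff[OF I(1,2)] Bochner_Integration.integral_diff[OF I(3,4)]
    using assms(6,7) \<phi> unfolding has_weak_deriv_def by simp
qed

lemma has_weak_deriv_zero: "has_weak_deriv (\<lambda>x. 0) b (\<lambda>x. 0)"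
  by (simp add: has_weak_deriv_def)

text \<open>
  The bilinear pairing with a real test function is expressed by the real inner product of \<open>L\<^sup>2\<close>, to
  which the Cauchy-Schwarz inequality applies.
\<close>

lemma has_weak_deriv_inner_iff:
  assumes "u \<in> L2" "v \<in> L2" "b \<in> Basis"
  shows "has_weak_deriv u b v \<longleftrightarrow> (\<forall>\<phi> c. test_function \<phi> \<longrightarrow>
    (LINT x|lborel. (frechet_derivative \<phi> (at x) b *\<^sub>R c) \<bullet> u x) = - (LINT x|lborel. (\<phi> x *\<^sub>R c) \<bullet> v x))"
proof -
  have i: "(LINT x|lborel. (\<psi> x *\<^sub>R c) \<bullet> w x) = c \<bullet> (LINT x|lborel. \<psi> x *\<^sub>R w x)"
    if "integrable lborel (\<lambda>x. \<psi> x *\<^sub>R w x)" for \<psi> and w :: "'a \<Rightarrow> complex" and c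
    using integral_inner_right[OF that, of c] by simp
  have "(LINT x|lborel. frechet_derivative \<phi> (at x) b *\<^sub>R u x) = - (LINT x|lborel. \<phi> x *\<^sub>R v x)
      \<longleftrightarrow> (\<forall>c. (LINT x|lborel. (frechet_derivative \<phi> (at x) b *\<^sub>R c) \<bullet> u x) = - (LINT x|lborel. (\<phi> x *\<^sub>R c) \<bullet> v x))"
    if \<phi>: "test_function \<phi>" for \<phi>
    unfolding i[OF test_integrable(1)[OF \<phi> assms(2)]] i[OF test_integrable(2)[OF \<phi> assms(1,3)]]
    by (subst vector_eq_ldot[symmetric]) (simp only: inner_minus_right)
  then show ?thesis unfolding has_weak_deriv_def by blast
qed

lemma has_weak_deriv_L2_limit:
  fixes u :: "'a::euclidean_space \<Rightarrow> complex"
  assumes L: "\<And>n. U n \<in> L2" "u \<in> L2" "\<And>n. V n \<in> L2" "v \<in> L2" "b \<in> Basis"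
    and d: "\<And>n. has_weak_deriv (U n) b (V n)"
    and U: "(\<lambda>n. norm_L2 (\<lambda>x. U n x - u x)) \<longlonglongrightarrow> 0" and V: "(\<lambda>n. norm_L2 (\<lambda>x. V n x - v x)) \<longlonglongrightarrow> 0"
  shows "has_weak_deriv u b v"
  unfolding has_weak_deriv_inner_iff[OF L(2,4,5)]
proof (intro allI impI)
  fix \<phi> :: "'a \<Rightarrow> real" and c :: complex assume \<phi>: "test_function \<phi>"
  note T = test_function_L2(1)[OF \<phi>, of c] test_function_L2(2)[OF \<phi> L(5), of c]
  have z: "(\<lambda>n::nat. norm_L2 (\<lambda>x. w x - w x)) \<longlonglongrightarrow> 0" for w :: "'a \<Rightarrow> complex" by (simp add: norm_L2_def)
  have 1: "(\<lambda>n. LINT x|lborel. (frechet_derivative \<phi> (at x) b *\<^sub>R c) \<bullet> U n x) \<longlonglongrightarrow> (LINT x|lborel. (frechet_derivative \<phi> (at x) b *\<^sub>R c) \<bullet> u x)"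
    by (rule L2_inner_tendsto[OF T(2) T(2) L(1,2) z U])
  have 2: "(\<lambda>n. - (LINT x|lborel. (\<phi> x *\<^sub>R c) \<bullet> V n x)) \<longlonglongrightarrow> - (LINT x|lborel. (\<phi> x *\<^sub>R c) \<bullet> v x)"
    by (rule tendsto_minus[OF L2_inner_tendsto[OF T(1) T(1) L(3,4) z V]])
  have "(LINT x|lborel. (frechet_derivative \<phi> (at x) b *\<^sub>R c) \<bullet> U n x) = - (LINT x|lborel. (\<phi> x *\<^sub>R c) \<bullet> V n x)" for n
    using d[of n] \<phi> unfolding has_weak_deriv_inner_iff[OF L(1,3,5)] by blast
  with 1 2 show "(LINT x|lborel. (frechet_derivative \<phi> (at x) b *\<^sub>R c) \<bullet> u x) = - (LINT x|lborel. (\<phi> x *\<^sub>R c) \<bullet> v x)"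
    by (simp add: LIMSEQ_unique)
qed

lemma has_weak_deriv_smooth_mult:
  fixes u :: "'a::euclidean_space \<Rightarrow> complex"
  assumes \<eta>: "\<And>k. Ck k \<eta>" and L: "u \<in> L2" "v \<in> L2" "b \<in> Basis" and w: "has_weak_deriv u b v"
    and \<eta>L: "(\<lambda>x. \<eta> x *\<^sub>R v x) \<in> L2" "(\<lambda>x. frechet_derivative \<eta> (at x) b *\<^sub>R u x) \<in> L2"
  shows "has_weak_deriv (\<lambda>x. \<eta> x *\<^sub>R u x) b (\<lambda>x. \<eta> x *\<^sub>R v x + frechet_derivative \<eta> (at x) b *\<^sub>R u x)"
  unfolding has_weak_deriv_def
proof (intro allI impI)
  fix \<phi> :: "'a \<Rightarrow> real" assume \<phi>: "test_function \<phi>"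
  let ?D = "\<lambda>\<psi> x. frechet_derivative \<psi> (at x) b"
  have test: "test_function (\<lambda>x. \<eta> x * \<phi> x)" by (rule test_function_mult[OF \<phi> \<eta>])
  have D: "?D (\<lambda>x. \<eta> x * \<phi> x) x = \<eta> x * ?D \<phi> x + ?D \<eta> x * \<phi> x" for x
    using fun_cong[OF frechet_derivative_at[OF has_derivative_mult[OF Ck_has_derivative[OF \<eta>] test_function_has_derivative[OF \<phi>]]], of x b] by simp
  note I1 = test_integrable(2)[OF test L(1,3)]
  note I2 = test_integrable(1)[OF \<phi> \<eta>L(1)]
  note I3 = test_integrable(1)[OF \<phi> \<eta>L(2)]
  have "(LINT x|lborel. ?D \<phi> x *\<^sub>R \<eta> x *\<^sub>R u x) = (LINT x|lborel. ?D (\<lambda>x. \<eta> x * \<phi> x) x *\<^sub>R u x - \<phi> x *\<^sub>R ?D \<eta> x *\<^sub>R u x)"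
    by (intro Bochner_Integration.integral_cong refl) (simp add: D algebra_simps)
  also have "\<dots> = (LINT x|lborel. ?D (\<lambda>x. \<eta> x * \<phi> x) x *\<^sub>R u x) - (LINT x|lborel. \<phi> x *\<^sub>R ?D \<eta> x *\<^sub>R u x)"
    by (rule Bochner_Integration.integral_diff[OF I1 I3])
  also have "(LINT x|lborel. ?D (\<lambda>x. \<eta> x * \<phi> x) x *\<^sub>R u x) = - (LINT x|lborel. (\<eta> x * \<phi> x) *\<^sub>R v x)"
    using w test unfolding has_weak_deriv_def by blast
  also have "(LINT x|lborel. (\<eta> x * \<phi> x) *\<^sub>R v x) = (LINT x|lborel. \<phi> x *\<^sub>R \<eta> x *\<^sub>R v x)"
    by (simp add: mult.commute)
  also have "- (LINT x|lborel. \<phi> x *\<^sub>R \<eta> x *\<^sub>R v x) - (LINT x|lborel. \<phi> x *\<^sub>R ?D \<eta> x *\<^sub>R u x) = - (LINT x|lborel. \<phi> x *\<^sub>R (\<eta> x *\<^sub>R v x + ?D \<eta> x *\<^sub>R u x))"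
    using Bochner_Integration.integral_add[OF I2 I3] by (simp add: scaleR_add_right)
  finally show "(LINT x|lborel. ?D \<phi> x *\<^sub>R \<eta> x *\<^sub>R u x) = - (LINT x|lborel. \<phi> x *\<^sub>R (\<eta> x *\<^sub>R v x + ?D \<eta> x *\<^sub>R u x))" .
qed

section \<open>Difference quotients\<close>

definition dquot :: "real \<Rightarrow> 'a \<Rightarrow> ('a::euclidean_space \<Rightarrow> 'b::real_vector) \<Rightarrow> 'a \<Rightarrow> 'b" where
  "dquot t b u x = (u (x + t *\<^sub>R b) - u x) /\<^sub>R t"

text \<open>
  Differentiability as convergence of difference quotients in norm. It implies weak differentiability, and it turns
  integration by parts into invariance under translation.
\<close>

definition strong_deriv :: "('a::euclidean_space \<Rightarrow> complex) \<Rightarrow> 'a \<Rightarrow> ('a \<Rightarrow> complex) \<Rightarrow> bool" where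
  "strong_deriv u b v \<longleftrightarrow> ((\<lambda>t. norm_L2 (\<lambda>x. dquot t b u x - v x)) \<longlongrightarrow> 0) (at 0)"

definition L1_deriv :: "('a::euclidean_space \<Rightarrow> real) \<Rightarrow> 'a \<Rightarrow> ('a \<Rightarrow> real) \<Rightarrow> bool" where
  "L1_deriv \<kappa> b \<kappa>' \<longleftrightarrow> ((\<lambda>t. LINT x|lborel. \<bar>dquot t b \<kappa> x - \<kappa>' x\<bar>) \<longlongrightarrow> 0) (at 0)"

lemma dquot_L2: "u \<in> L2 \<Longrightarrow> dquot t b u \<in> L2"
  unfolding dquot_def by (intro L2_scaleR L2_diff L2_translate)

lemma dquot_commute: "dquot t b (dquot s a u) x = dquot s a (dquot t b u) x"
  by (simp add: dquot_def algebra_simps)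

lemma inner_dquot:
  assumes "u \<in> L2" "v \<in> L2"
  shows "(LINT x|lborel. dquot t b u x \<bullet> v x) = - (LINT x|lborel. u x \<bullet> dquot (- t) b v x)"
proof -
  note [measurable] = L2_measurable[OF assms(1)] L2_measurable[OF assms(2)]
  note T = L2_translate(1)[OF assms(1), of "t *\<^sub>R b"] L2_translate(1)[OF assms(2), of "- (t *\<^sub>R b)"]
  have s: "(LINT x|lborel. u (x + t *\<^sub>R b) \<bullet> v x) = (LINT x|lborel. u x \<bullet> v (x + - (t *\<^sub>R b)))"
    using integral_translate[of "\<lambda>x. u x \<bullet> v (x + - (t *\<^sub>R b))" "t *\<^sub>R b"] by simp
  have "(LINT x|lborel. dquot t b u x \<bullet> v x) = (LINT x|lborel. inverse t * (u (x + t *\<^sub>R b) \<bullet> v x - u x \<bullet> v x))"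
    by (simp add: dquot_def inner_diff_left)
  also have "\<dots> = inverse t * ((LINT x|lborel. u x \<bullet> v (x + - (t *\<^sub>R b))) - (LINT x|lborel. u x \<bullet> v x))"
    using L2_integrable_inner[OF T(1) assms(2)] L2_integrable_inner[OF assms] s by simp
  also have "\<dots> = (LINT x|lborel. inverse t * (u x \<bullet> v (x + - (t *\<^sub>R b)) - u x \<bullet> v x))"
    using L2_integrable_inner[OF assms(1) T(2)] L2_integrable_inner[OF assms] by simp
  also have "\<dots> = (LINT x|lborel. - (u x \<bullet> dquot (- t) b v x))"
    by (intro Bochner_Integration.integral_cong refl) (simp add: dquot_def inner_diff_right)
  finally show ?thesis by simp
qed

lemma step_sequence:
  "filterlim (\<lambda>n. inverse (real (Suc n))) (at 0) sequentially"
  "filterlim (\<lambda>n. - inverse (real (Suc n))) (at 0) sequentially"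
  using LIMSEQ_inverse_real_of_nat tendsto_minus[OF LIMSEQ_inverse_real_of_nat]
  by (auto intro!: filterlim_atI simp del: of_nat_Suc)

lemma strong_deriv_seq:
  assumes "strong_deriv u b v"
  shows "(\<lambda>n. norm_L2 (\<lambda>x. dquot (inverse (real (Suc n))) b u x - v x)) \<longlonglongrightarrow> 0"
    and "(\<lambda>n. norm_L2 (\<lambda>x. dquot (- inverse (real (Suc n))) b u x - v x)) \<longlonglongrightarrow> 0"
  using filterlim_compose[OF assms[unfolded strong_deriv_def] step_sequence(1)]
    filterlim_compose[OF assms[unfolded strong_deriv_def] step_sequence(2)] by auto

text \<open>
  By the mean value theorem the difference quotients for \<open>|t| < 1\<close> are bounded by \<open>B\<close> and have a
  common bounded support. Dominated convergence applies.
\<close>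

lemma dquot_tendsto_deriv:
  fixes h h' :: "'a::euclidean_space \<Rightarrow> real"
  assumes [measurable]: "h \<in> borel_measurable borel" "h' \<in> borel_measurable borel"
    and deriv: "\<And>x. ((\<lambda>t. h (x + t *\<^sub>R b)) has_real_derivative h' x) (at 0)"
    and B: "\<And>x. \<bar>h' x\<bar> \<le> B" and M: "\<And>x. norm x > M \<Longrightarrow> h x = 0" "\<And>x. norm x > M \<Longrightarrow> h' x = 0"
    and p: "p > 0"
  shows "((\<lambda>t. LINT x|lborel. \<bar>dquot t b h x - h' x\<bar> ^ p) \<longlongrightarrow> 0) (at 0)"
  unfolding tendsto_at_iff_sequentially
proof (intro allI impI)
  fix X :: "nat \<Rightarrow> real" assume X: "\<forall>i. X i \<in> UNIV - {0}" "X \<longlonglongrightarrow> 0"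
  have deriv': "((\<lambda>t. h (x + t *\<^sub>R b)) has_real_derivative h' (x + s *\<^sub>R b)) (at s)" for x s
  proof -
    have "((\<lambda>t. h ((x + s *\<^sub>R b) + (t - s) *\<^sub>R b)) has_real_derivative h' (x + s *\<^sub>R b)) (at s)"
      using DERIV_shift[of "\<lambda>t. h ((x + s *\<^sub>R b) + t *\<^sub>R b)" "h' (x + s *\<^sub>R b)" s "- s"] deriv[of "x + s *\<^sub>R b"] by simp
    then show ?thesis by (simp add: algebra_simps)
  qed
  have lip: "\<bar>h (x + t *\<^sub>R b) - h x\<bar> \<le> B * \<bar>t\<bar>" for x t
    using field_differentiable_bound[of UNIV "\<lambda>t. h (x + t *\<^sub>R b)" "\<lambda>s. h' (x + s *\<^sub>R b)" B t 0] deriv' B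
    by simp
  have "B \<ge> 0" using B[of 0] by linarith
  have "\<forall>\<^sub>F i in sequentially. \<bar>X i\<bar> < 1"
    using tendsto_rabs[OF X(2)] by (intro order_tendstoD) auto
  then obtain N where N: "\<And>i. i \<ge> N \<Longrightarrow> \<bar>X i\<bar> < 1" by (auto simp: eventually_sequentially)
  let ?S = "cball (0::'a) (M + norm b)"
  have dom: "\<bar>dquot t b h x - h' x\<bar> \<le> 2 * B * indicator ?S x" if "\<bar>t\<bar> < 1" for t x
  proof (cases "x \<in> ?S")
    case True
    have "\<bar>dquot t b h x\<bar> \<le> B"
    proof (cases "t = 0")
      case False
      then show ?thesis using lip[of x t] by (simp add: dquot_def abs_mult field_simps)
    qed (simp add: dquot_def \<open>B \<ge> 0\<close>)
    then show ?thesis using B[of x] True by simp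
  next
    case False
    then have n: "norm x > M + norm b" by simp
    have "norm (t *\<^sub>R b) \<le> norm b" using that mult_right_mono[of "\<bar>t\<bar>" 1 "norm b"] by simp
    then have "norm (x + t *\<^sub>R b) > M" using norm_triangle_ineq2[of x "- (t *\<^sub>R b)"] n by simp
    moreover have "norm x > M" using n norm_ge_zero[of b] by linarith
    ultimately show ?thesis using M \<open>B \<ge> 0\<close> by (simp add: dquot_def indicator_def)
  qed
  have "(\<lambda>i. LINT x|lborel. \<bar>dquot (X (i + N)) b h x - h' x\<bar> ^ p) \<longlonglongrightarrow> (LINT x|(lborel :: 'a measure). 0)"
  proof (rule integral_dominated_convergence[where w = "\<lambda>x. (2 * B) ^ p * indicator ?S x"])
    show "(\<lambda>x. \<bar>dquot (X (i + N)) b h x - h' x\<bar> ^ p) \<in> borel_measurable lborel" for i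
      unfolding dquot_def by measurable
    show "integrable lborel (\<lambda>x. (2 * B) ^ p * indicator ?S x)"
      using emeasure_bounded_finite[OF bounded_cball[of "0::'a" "M + norm b"]]
      by (auto intro!: integrable_mult_right integrable_real_indicator)
    show "AE x in lborel. (\<lambda>i. \<bar>dquot (X (i + N)) b h x - h' x\<bar> ^ p) \<longlonglongrightarrow> 0"
    proof (rule AE_I2)
      fix x
      have "((\<lambda>t. dquot t b h x) \<longlongrightarrow> h' x) (at 0)"
        using deriv[of x] by (simp add: DERIV_def dquot_def divide_inverse mult.commute)
      moreover have "filterlim (\<lambda>i. X (i + N)) (at 0) sequentially"
        using X LIMSEQ_ignore_initial_segment[OF X(2), of N] by (intro filterlim_atI) auto
      ultimately have "(\<lambda>i. dquot (X (i + N)) b h x) \<longlonglongrightarrow> h' x" by (rule filterlim_compose)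
      then have "(\<lambda>i. \<bar>dquot (X (i + N)) b h x - h' x\<bar> ^ p) \<longlonglongrightarrow> \<bar>h' x - h' x\<bar> ^ p" by (intro tendsto_intros)
      moreover have "\<bar>h' x - h' x\<bar> ^ p = 0" using p by simp
      ultimately show "(\<lambda>i. \<bar>dquot (X (i + N)) b h x - h' x\<bar> ^ p) \<longlonglongrightarrow> 0" by (simp only:)
    qed
    show "AE x in lborel. norm (\<bar>dquot (X (i + N)) b h x - h' x\<bar> ^ p) \<le> (2 * B) ^ p * indicator ?S x" for i
    proof (rule AE_I2)
      fix x
      have "\<bar>dquot (X (i + N)) b h x - h' x\<bar> ^ p \<le> (2 * B * indicator ?S x) ^ p"
        by (intro power_mono dom N) auto
      also have "\<dots> = (2 * B) ^ p * indicator ?S x" using p by (auto simp: indicator_def)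
      finally show "norm (\<bar>dquot (X (i + N)) b h x - h' x\<bar> ^ p) \<le> (2 * B) ^ p * indicator ?S x" by simp
    qed
  qed auto
  then show "((\<lambda>t. LINT x|lborel. \<bar>dquot t b h x - h' x\<bar> ^ p) \<circ> X) \<longlonglongrightarrow> 0"
    unfolding o_def Bochner_Integration.integral_zero by (rule LIMSEQ_offset)
qed

lemma test_function_strong_deriv:
  assumes \<phi>: "test_function \<phi>" and b: "b \<in> Basis"
  shows "strong_deriv (\<lambda>x. \<phi> x *\<^sub>R c) b (\<lambda>x. frechet_derivative \<phi> (at x) b *\<^sub>R c)"
proof -
  let ?D = "\<lambda>x. frechet_derivative \<phi> (at x) b"
  obtain M where M: "\<And>x. norm x > M \<Longrightarrow> \<phi> x = 0" "\<And>x b. norm x > M \<Longrightarrow> frechet_derivative \<phi> (at x) b = 0"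
    using test_function_support[OF \<phi>] by metis
  obtain B where B: "\<And>x. \<bar>?D x\<bar> \<le> B"
    using continuous_bounded_of_support[OF test_function_continuous(2)[OF \<phi> b] M(2)] by metis
  have d: "((\<lambda>t. \<phi> (x + t *\<^sub>R b)) has_real_derivative ?D x) (at 0)" for x
  proof -
    have "((\<lambda>t. \<phi> (x + t *\<^sub>R b)) has_derivative (\<lambda>t. frechet_derivative \<phi> (at (x + 0 *\<^sub>R b)) (t *\<^sub>R b))) (at 0)"
      by (rule has_derivative_compose[OF _ test_function_has_derivative[OF \<phi>]]) (auto intro!: derivative_eq_intros)
    moreover have "frechet_derivative \<phi> (at x) (t *\<^sub>R b) = ?D x * t" for t
      using linear_scale[OF has_derivative_linear[OF test_function_has_derivative[OF \<phi>, of x]], of t b] by simp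
    ultimately show ?thesis by (simp add: has_field_derivative_def)
  qed
  have "((\<lambda>t. LINT x|lborel. \<bar>dquot t b \<phi> x - ?D x\<bar> ^ 2) \<longlongrightarrow> 0) (at 0)"
    by (rule dquot_tendsto_deriv[OF borel_measurable_continuous_onI[OF test_function_continuous(1)[OF \<phi>]]
          borel_measurable_continuous_onI[OF test_function_continuous(2)[OF \<phi> b]] d B M]) auto
  then have "((\<lambda>t. cmod c * sqrt (LINT x|lborel. \<bar>dquot t b \<phi> x - ?D x\<bar> ^ 2)) \<longlongrightarrow> cmod c * sqrt 0) (at 0)"
    by (intro tendsto_intros)
  moreover have "norm_L2 (\<lambda>x. dquot t b (\<lambda>x. \<phi> x *\<^sub>R c) x - ?D x *\<^sub>R c) = cmod c * sqrt (LINT x|lborel. \<bar>dquot t b \<phi> x - ?D x\<bar> ^ 2)" for t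
  proof -
    have "dquot t b (\<lambda>x. \<phi> x *\<^sub>R c) x - ?D x *\<^sub>R c = (dquot t b \<phi> x - ?D x) *\<^sub>R c" for x
      by (simp add: dquot_def algebra_simps)
    then have "norm_L2 (\<lambda>x. dquot t b (\<lambda>x. \<phi> x *\<^sub>R c) x - ?D x *\<^sub>R c) = sqrt (LINT x|lborel. \<bar>dquot t b \<phi> x - ?D x\<bar> ^ 2 * (cmod c)\<^sup>2)"
      unfolding norm_L2_def by (simp add: power_mult_distrib)
    then show ?thesis by (simp add: real_sqrt_mult)
  qed
  ultimately show ?thesis by (simp add: strong_deriv_def)
qed

lemma strong_deriv_imp_weak:
  assumes u: "u \<in> L2" and v: "v \<in> L2" and b: "b \<in> Basis" and s: "strong_deriv u b v"
  shows "has_weak_deriv u b v"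
  unfolding has_weak_deriv_inner_iff[OF u v b]
proof (intro allI impI)
  fix \<phi> :: "'a \<Rightarrow> real" and c :: complex assume \<phi>: "test_function \<phi>"
  note T = test_function_L2(1)[OF \<phi>, of c] test_function_L2(2)[OF \<phi> b, of c]
  let ?t = "\<lambda>n. inverse (real (Suc n))"
  have z: "(\<lambda>n::nat. norm_L2 (\<lambda>x. w x - w x)) \<longlonglongrightarrow> 0" for w :: "'a \<Rightarrow> complex" by (simp add: norm_L2_def)
  have 1: "(\<lambda>n. LINT x|lborel. dquot (?t n) b (\<lambda>x. \<phi> x *\<^sub>R c) x \<bullet> u x) \<longlonglongrightarrow> (LINT x|lborel. (frechet_derivative \<phi> (at x) b *\<^sub>R c) \<bullet> u x)"
    by (rule L2_inner_tendsto[OF dquot_L2[OF T(1)] T(2) u u strong_deriv_seq(1)[OF test_function_strong_deriv[OF \<phi> b]] z])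
  have 2: "(\<lambda>n. - (LINT x|lborel. (\<phi> x *\<^sub>R c) \<bullet> dquot (- ?t n) b u x)) \<longlonglongrightarrow> - (LINT x|lborel. (\<phi> x *\<^sub>R c) \<bullet> v x)"
    by (rule tendsto_minus[OF L2_inner_tendsto[OF T(1) T(1) dquot_L2[OF u] v z strong_deriv_seq(2)[OF s]]])
  show "(LINT x|lborel. (frechet_derivative \<phi> (at x) b *\<^sub>R c) \<bullet> u x) = - (LINT x|lborel. (\<phi> x *\<^sub>R c) \<bullet> v x)"
    by (rule LIMSEQ_unique[OF 1]) (use 2 in \<open>simp only: inner_dquot[OF T(1) u]\<close>)
qed

text \<open>
  A translation of the convolution in a direction fixed by \<open>P\<close> amounts to a translation of the kernel. The
  difference quotients of the convolution are convolutions with those of the kernel, and Young's inequality applies.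
\<close>

lemma strong_deriv_conv:
  fixes P :: "'a::euclidean_space \<Rightarrow> 'a"
  assumes P[measurable]: "P \<in> borel_measurable borel" and Pb: "\<And>w t. P (w + t *\<^sub>R b) = P w + t *\<^sub>R b"
    and \<kappa>: "integrable lborel \<kappa>" "integrable lborel \<kappa>'" "L1_deriv \<kappa> b \<kappa>'" and g: "g \<in> L2"
  shows "strong_deriv (conv P \<kappa> g) b (conv P \<kappa>' g)"
proof -
  note [measurable] = L2_measurable[OF g] borel_measurable_integrable[OF \<kappa>(1)]
  have int: "integrable lborel (dquot t b \<kappa>)" for t
    unfolding dquot_def using integrable_translate[OF \<kappa>(1), of "t *\<^sub>R b"] \<kappa>(1) by simp
  have bound: "norm_L2 (\<lambda>z. dquot t b (conv P \<kappa> g) z - conv P \<kappa>' g z) \<le> (LINT x|lborel. \<bar>dquot t b \<kappa> x - \<kappa>' x\<bar>) * norm_L2 g" for t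
  proof -
    have shift: "conv P \<kappa> g (z + t *\<^sub>R b) = conv P (\<lambda>w. \<kappa> (w + t *\<^sub>R b)) g z" for z
      unfolding conv_def
      using integral_translate[of "\<lambda>w. \<kappa> w *\<^sub>R g (z + t *\<^sub>R b - P w)" "t *\<^sub>R b"] by (simp add: Pb)
    have "AE z in lborel. conv P (\<lambda>w. inverse t * (\<kappa> (w + t *\<^sub>R b) - \<kappa> w)) g z = dquot t b (conv P \<kappa> g) z"
      using conv_kernel_diff[OF P integrable_translate[OF \<kappa>(1), of "t *\<^sub>R b"] \<kappa>(1) g]
      by eventually_elim (simp add: conv_kernel_cmult dquot_def shift)
    moreover have "(\<lambda>w. inverse t * (\<kappa> (w + t *\<^sub>R b) - \<kappa> w)) = dquot t b \<kappa>" by (simp add: dquot_def fun_eq_iff)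
    ultimately have "AE z in lborel. conv P (dquot t b \<kappa>) g z = dquot t b (conv P \<kappa> g) z" by simp
    then have "AE z in lborel. conv P (\<lambda>w. dquot t b \<kappa> w - \<kappa>' w) g z = dquot t b (conv P \<kappa> g) z - conv P \<kappa>' g z"
      using conv_kernel_diff[OF P int[of t] \<kappa>(2) g] by eventually_elim simp
    then have "norm_L2 (\<lambda>z. dquot t b (conv P \<kappa> g) z - conv P \<kappa>' g z) = norm_L2 (conv P (\<lambda>w. dquot t b \<kappa> w - \<kappa>' w) g)"
      using \<kappa> int g P
      by (intro norm_L2_cong_AE L2_measurable L2_diff dquot_L2 conv_L2(2) Bochner_Integration.integrable_diff) (auto elim!: eventually_mono)
    also have "\<dots> \<le> (LINT x|lborel. \<bar>dquot t b \<kappa> x - \<kappa>' x\<bar>) * norm_L2 g"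
      by (intro conv_L2(3) Bochner_Integration.integrable_diff int \<kappa> g P)
    finally show ?thesis .
  qed
  have lim: "((\<lambda>t. (LINT x|lborel. \<bar>dquot t b \<kappa> x - \<kappa>' x\<bar>) * norm_L2 g) \<longlongrightarrow> 0) (at 0)"
    using tendsto_mult_left_zero[OF \<kappa>(3)[unfolded L1_deriv_def]] .
  show ?thesis
    unfolding strong_deriv_def
    by (rule tendsto_sandwich[OF _ _ tendsto_const lim]) (simp_all add: bound norm_L2_nonneg)
qed

text \<open>
  Two integrations by parts turn the integral of \<open>D\<^sub>b u\<^sub>a \<bullet> D\<^sub>a u\<^sub>b\<close> into
  that of \<open>D\<^sub>a u\<^sub>a \<bullet> D\<^sub>b u\<^sub>b\<close>, and symmetry of \<open>v\<close> makes the
  former a square. The integrations by parts are carried out on difference quotients, so that no second derivatives of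
  \<open>u\<close> are needed.
\<close>

lemma curl_free_norm:
  assumes fin: "finite D"
    and u: "\<And>a. a \<in> D \<Longrightarrow> u a \<in> L2" and v: "\<And>a b. a \<in> D \<Longrightarrow> b \<in> D \<Longrightarrow> v a b \<in> L2"
    and s: "\<And>a b. a \<in> D \<Longrightarrow> b \<in> D \<Longrightarrow> strong_deriv (u a) b (v a b)"
    and sym: "\<And>a b x. a \<in> D \<Longrightarrow> b \<in> D \<Longrightarrow> v a b x = v b a x"
  shows "(\<Sum>a\<in>D. \<Sum>b\<in>D. (norm_L2 (v a b))\<^sup>2) = (norm_L2 (\<lambda>x. \<Sum>a\<in>D. v a a x))\<^sup>2"
proof -
  have swap: "(LINT x|lborel. v a b x \<bullet> v b a x) = (LINT x|lborel. v a a x \<bullet> v b b x)" if ab: "a \<in> D" "b \<in> D" for a b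
  proof -
    let ?t = "\<lambda>n. inverse (real (Suc n))"
    have 1: "(\<lambda>n. LINT x|lborel. dquot (?t n) b (u a) x \<bullet> dquot (?t n) a (u b) x) \<longlonglongrightarrow> (LINT x|lborel. v a b x \<bullet> v b a x)"
      by (intro L2_inner_tendsto dquot_L2 u v strong_deriv_seq s ab)
    have 2: "(\<lambda>n. LINT x|lborel. dquot (- ?t n) a (u a) x \<bullet> dquot (- ?t n) b (u b) x) \<longlonglongrightarrow> (LINT x|lborel. v a a x \<bullet> v b b x)"
      by (intro L2_inner_tendsto dquot_L2 u v strong_deriv_seq s ab)
    have "(LINT x|lborel. dquot t b (u a) x \<bullet> dquot t a (u b) x) = (LINT x|lborel. dquot (- t) a (u a) x \<bullet> dquot (- t) b (u b) x)" for t
    proof -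
      have "(LINT x|lborel. dquot t b (u a) x \<bullet> dquot t a (u b) x) = - (LINT x|lborel. u a x \<bullet> dquot (- t) b (dquot t a (u b)) x)"
        by (rule inner_dquot) (intro dquot_L2 u ab)+
      also have "\<dots> = - (LINT x|lborel. u a x \<bullet> dquot (- (- t)) a (dquot (- t) b (u b)) x)"
        by (subst dquot_commute) simp
      also have "\<dots> = (LINT x|lborel. dquot (- t) a (u a) x \<bullet> dquot (- t) b (u b) x)"
        by (rule inner_dquot[symmetric]) (intro dquot_L2 u ab)+
      finally show ?thesis .
    qed
    with 1 2 show ?thesis by (simp add: LIMSEQ_unique)
  qed
  have "(norm_L2 (v a b))\<^sup>2 = (LINT x|lborel. v a a x \<bullet> v b b x)" if "a \<in> D" "b \<in> D" for a b
  proof -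
    have "(norm_L2 (v a b))\<^sup>2 = (LINT x|lborel. v a b x \<bullet> v b a x)"
      unfolding norm_L2_power2 using sym[OF that] by (simp add: power2_norm_eq_inner)
    then show ?thesis using swap[OF that] by simp
  qed
  then have "(\<Sum>a\<in>D. \<Sum>b\<in>D. (norm_L2 (v a b))\<^sup>2) = (\<Sum>a\<in>D. \<Sum>b\<in>D. LINT x|lborel. v a a x \<bullet> v b b x)"
    by simp
  also have "\<dots> = (LINT x|lborel. (\<Sum>a\<in>D. (\<Sum>b\<in>D. v a a x \<bullet> v b b x)))"
    by (simp add: Bochner_Integration.integral_sum Bochner_Integration.integrable_sum L2_integrable_inner v)
  also have "\<dots> = (norm_L2 (\<lambda>x. \<Sum>a\<in>D. v a a x))\<^sup>2"
  proof -
    have "(\<Sum>a\<in>D. (\<Sum>b\<in>D. v a a x \<bullet> v b b x)) = (cmod (\<Sum>a\<in>D. v a a x))\<^sup>2" for x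
      unfolding power2_norm_eq_inner inner_sum_left by (simp only: inner_sum_right)
    then show ?thesis unfolding norm_L2_power2 by simp
  qed
  finally show ?thesis .
qed

section \<open>Kernels in some of the coordinates\<close>

definition proj :: "'a::euclidean_space set \<Rightarrow> 'a \<Rightarrow> 'a" where
  "proj D x = (\<Sum>b\<in>D. (x \<bullet> b) *\<^sub>R b)"

definition sq :: "'a::euclidean_space set \<Rightarrow> 'a \<Rightarrow> real" where
  "sq D x = (\<Sum>b\<in>D. (x \<bullet> b)\<^sup>2)"

text \<open>
  The weight of mass \<open>1\<close> in the coordinates outside \<open>D\<close>.
\<close>

definition slab :: "'a::euclidean_space set \<Rightarrow> 'a \<Rightarrow> real" where
  "slab D x = (if \<forall>b\<in>Basis - D. 0 \<le> x \<bullet> b \<and> x \<bullet> b \<le> 1 then 1 else 0)"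

definition dilate :: "'a::euclidean_space set \<Rightarrow> real \<Rightarrow> 'a \<Rightarrow> 'a" where
  "dilate D \<mu> x = 0 + (\<Sum>b\<in>Basis. ((if b \<in> D then \<mu> else 1) * (x \<bullet> b)) *\<^sub>R b)"

lemma proj_inner: "D \<subseteq> Basis \<Longrightarrow> b \<in> Basis \<Longrightarrow> proj D x \<bullet> b = (if b \<in> D then x \<bullet> b else 0)"
  unfolding proj_def inner_sum_left
  by (subst sum.cong[OF refl, of D _ "\<lambda>a. if a = b then x \<bullet> b else 0"])
     (auto simp: inner_Basis sum.delta finite_subset[OF _ finite_Basis])

lemma proj_translate:
  assumes "D \<subseteq> Basis" "b \<in> D"
  shows "proj D (w + t *\<^sub>R b) = proj D w + t *\<^sub>R b"
proof (rule euclidean_eqI)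
  fix c :: 'a assume "c \<in> Basis"
  moreover have "b \<in> Basis" using assms by auto
  ultimately show "proj D (w + t *\<^sub>R b) \<bullet> c = (proj D w + t *\<^sub>R b) \<bullet> c"
    using assms by (auto simp: proj_inner inner_simps inner_Basis)
qed

lemma sq_nonneg: "sq D x \<ge> 0"
  by (simp add: sq_def sum_nonneg)

lemma norm_proj_sq: "D \<subseteq> Basis \<Longrightarrow> (norm (proj D x))\<^sup>2 = sq D x"
proof -
  assume D: "D \<subseteq> Basis"
  have "(norm (proj D x))\<^sup>2 = (\<Sum>b\<in>Basis. (proj D x \<bullet> b)\<^sup>2)"
    by (subst power2_norm_eq_inner, subst euclidean_inner) (simp add: power2_eq_square)
  also have "\<dots> = (\<Sum>b\<in>Basis. if b \<in> D then (x \<bullet> b)\<^sup>2 else 0)"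
    by (intro sum.cong refl) (simp add: proj_inner[OF D])
  also have "\<dots> = sq D x"
    unfolding sq_def using D by (simp add: sum.inter_restrict[symmetric] Int_absorb1)
  finally show ?thesis .
qed

lemma proj_measurable [measurable]: "proj D \<in> borel_measurable borel"
  unfolding proj_def[abs_def] by measurable

lemma sq_measurable [measurable]: "sq D \<in> borel_measurable borel"
  unfolding sq_def[abs_def] by measurable

lemma slab_measurable [measurable]: "slab D \<in> borel_measurable borel"
  unfolding slab_def[abs_def] by measurable

lemma inner_le_sq: "finite D \<Longrightarrow> b \<in> D \<Longrightarrow> (x \<bullet> b)\<^sup>2 \<le> sq D x"
  unfolding sq_def by (rule member_le_sum) auto

lemma slab_cases: "slab D x = 0 \<or> slab D x = 1"
  by (simp add: slab_def)

lemma norm_le_of_slab: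
  fixes x :: "'a::euclidean_space"
  assumes "D \<subseteq> Basis" "slab D x \<noteq> 0" "sq D x \<le> S"
  shows "norm x \<le> real DIM('a) * (1 + S)"
proof -
  have fin: "finite D" using assms(1) finite_Basis finite_subset by blast
  have "S \<ge> 0" using assms(3) sq_nonneg[of D x] by linarith
  have "\<bar>x \<bullet> b\<bar> \<le> 1 + S" if "b \<in> Basis" for b
  proof (cases "b \<in> D")
    case True
    have "2 * \<bar>x \<bullet> b\<bar> * 1 \<le> \<bar>x \<bullet> b\<bar>\<^sup>2 + 1\<^sup>2" by (rule sum_squares_bound)
    then have "2 * \<bar>x \<bullet> b\<bar> \<le> S + 1" using inner_le_sq[OF fin True, of x] assms(3) by simp
    then show ?thesis by linarith
  next
    case False
    then have "0 \<le> x \<bullet> b \<and> x \<bullet> b \<le> 1" using assms(2) that by (auto simp: slab_def split: if_splits)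
    then show ?thesis using \<open>S \<ge> 0\<close> by linarith
  qed
  then have "(\<Sum>b\<in>Basis. \<bar>x \<bullet> b\<bar>) \<le> real DIM('a) * (1 + S)" by (rule sum_bounded_above)
  then show ?thesis using norm_le_l1[of x] by linarith
qed

text \<open>
  The component in direction \<open>a\<close> of a radial field \<open>x \<phi>(|x|\<^sup>2)\<close> in the coordinates in
  \<open>D\<close>. Such a field is a gradient, hence curl-free.
\<close>

definition radial :: "'a::euclidean_space set \<Rightarrow> (real \<Rightarrow> real) \<Rightarrow> 'a \<Rightarrow> 'a \<Rightarrow> real" where
  "radial D \<phi> a w = (w \<bullet> a) * \<phi> (sq D w) * slab D w"

text \<open>
  The derivative of \<open>radial\<close> in direction \<open>b\<close>.
\<close>

definition radial' :: "'a::euclidean_space set \<Rightarrow> (real \<Rightarrow> real) \<Rightarrow> (real \<Rightarrow> real) \<Rightarrow> 'a \<Rightarrow> 'a \<Rightarrow> 'a \<Rightarrow> real" where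
  "radial' D \<phi> \<phi>' a b w = ((if a = b then \<phi> (sq D w) else 0) + 2 * (w \<bullet> a) * (w \<bullet> b) * \<phi>' (sq D w)) * slab D w"

lemma radial_derivative:
  fixes D :: "'a::euclidean_space set"
  assumes D: "D \<subseteq> Basis" and a: "a \<in> D" and b: "b \<in> D"
    and \<phi>: "\<And>s. (\<phi> has_real_derivative \<phi>' s) (at s)" and [measurable]: "\<phi>' \<in> borel_measurable borel"
    and B: "\<And>s. \<bar>\<phi> s\<bar> \<le> B" "\<And>s. \<bar>\<phi>' s\<bar> \<le> B" and S: "\<And>s. s > S \<Longrightarrow> \<phi> s = 0" "\<And>s. s > S \<Longrightarrow> \<phi>' s = 0"
  shows "integrable lborel (radial D \<phi> a)" "integrable lborel (radial' D \<phi> \<phi>' a b)"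
    and "L1_deriv (radial D \<phi> a) b (radial' D \<phi> \<phi>' a b)"
proof -
  have fin: "finite D" using D finite_Basis finite_subset by blast
  have bB: "b \<in> Basis" "a \<in> Basis" using D a b by auto
  have "continuous_on UNIV \<phi>" using \<phi> DERIV_isCont continuous_on_eq_continuous_at by blast
  then have [measurable]: "\<phi> \<in> borel_measurable borel" by (rule borel_measurable_continuous_onI)
  have m: "radial D \<phi> a \<in> borel_measurable borel" "radial' D \<phi> \<phi>' a b \<in> borel_measurable borel"
    unfolding radial_def[abs_def] radial'_def[abs_def] by measurable
  define T where "T = \<bar>S\<bar>"
  have sT: "s > T \<Longrightarrow> s > S" for s unfolding T_def by linarith
  have "B \<ge> 0" using B(1)[of 0] by linarith
  have "T \<ge> 0" by (simp add: T_def)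
  define M where "M = real DIM('a) * (1 + T)"
  have out: "slab D x = 0 \<or> sq D x > S" if "norm x > M" for x
    using norm_le_of_slab[OF D, of x T] that sT[of "sq D x"] unfolding M_def by force
  have M: "radial D \<phi> a x = 0" "radial' D \<phi> \<phi>' a b x = 0" if "norm x > M" for x
    using out[OF that] S by (auto simp: radial_def radial'_def)
  have ab: "\<bar>x \<bullet> c\<bar> \<le> 1 + T" if "c \<in> D" "sq D x \<le> T" for x c
  proof -
    have "2 * \<bar>x \<bullet> c\<bar> * 1 \<le> \<bar>x \<bullet> c\<bar>\<^sup>2 + 1\<^sup>2" by (rule sum_squares_bound)
    then have "2 * \<bar>x \<bullet> c\<bar> \<le> T + 1" using inner_le_sq[OF fin that(1), of x] that(2) by simp
    then show ?thesis by linarith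
  qed
  have bound1: "\<bar>radial D \<phi> a x\<bar> \<le> (1 + T) * B" for x
  proof (cases "sq D x \<le> T")
    case True
    have "\<bar>x \<bullet> a\<bar> * \<bar>\<phi> (sq D x)\<bar> * \<bar>slab D x\<bar> \<le> (1 + T) * B * 1"
      using ab[OF a True] B \<open>B \<ge> 0\<close> \<open>T \<ge> 0\<close> slab_cases[of D x] by (intro mult_mono) auto
    then show ?thesis by (simp add: radial_def abs_mult)
  next
    case False
    then show ?thesis using S sT[of "sq D x"] \<open>B \<ge> 0\<close> \<open>T \<ge> 0\<close> by (simp add: radial_def)
  qed
  have bound2: "\<bar>radial' D \<phi> \<phi>' a b x\<bar> \<le> B + 2 * ((1 + T) * (1 + T) * B)" for x
  proof (cases "sq D x \<le> T")
    case True
    have "\<bar>x \<bullet> a\<bar> * \<bar>x \<bullet> b\<bar> * \<bar>\<phi>' (sq D x)\<bar> \<le> (1 + T) * (1 + T) * B"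
      using ab[OF a True] ab[OF b True] B \<open>B \<ge> 0\<close> \<open>T \<ge> 0\<close> by (intro mult_mono) auto
    then have "\<bar>2 * (x \<bullet> a) * (x \<bullet> b) * \<phi>' (sq D x)\<bar> \<le> 2 * ((1 + T) * (1 + T) * B)"
      by (simp add: abs_mult)
    moreover have "\<bar>if a = b then \<phi> (sq D x) else 0\<bar> \<le> B" using B \<open>B \<ge> 0\<close> by simp
    ultimately have "\<bar>(if a = b then \<phi> (sq D x) else 0) + 2 * (x \<bullet> a) * (x \<bullet> b) * \<phi>' (sq D x)\<bar> \<le> B + 2 * ((1 + T) * (1 + T) * B)"
      by linarith
    then show ?thesis using slab_cases[of D x] \<open>B \<ge> 0\<close> \<open>T \<ge> 0\<close> unfolding radial'_def by auto
  next
    case False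
    then show ?thesis using S sT[of "sq D x"] \<open>B \<ge> 0\<close> \<open>T \<ge> 0\<close> by (simp add: radial'_def)
  qed
  show "integrable lborel (radial D \<phi> a)" "integrable lborel (radial' D \<phi> \<phi>' a b)"
    by (rule bounded_support_integrable[OF m(1) bound1 M(1)], assumption,
        rule bounded_support_integrable[OF m(2) bound2 M(2)], assumption)
  have deriv: "((\<lambda>t. radial D \<phi> a (x + t *\<^sub>R b)) has_real_derivative radial' D \<phi> \<phi>' a b x) (at 0)" for x
  proof -
    have slab: "slab D (x + t *\<^sub>R b) = slab D x" for t
    proof -
      have "(x + t *\<^sub>R b) \<bullet> c = x \<bullet> c" if "c \<in> Basis - D" for c
        using that b bB by (auto simp: inner_simps inner_Basis)
      then show ?thesis by (simp add: slab_def)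
    qed
    have sqd: "((\<lambda>t. sq D (x + t *\<^sub>R b)) has_real_derivative 2 * (x \<bullet> b)) (at 0)"
    proof -
      have "((\<lambda>t. sq D (x + t *\<^sub>R b)) has_real_derivative (\<Sum>c\<in>D. 2 * (x \<bullet> c) * (b \<bullet> c))) (at 0)"
        unfolding sq_def inner_simps by (rule DERIV_sum) (auto intro!: derivative_eq_intros)
      moreover have "(\<Sum>c\<in>D. 2 * (x \<bullet> c) * (b \<bullet> c)) = (\<Sum>c\<in>D. if c = b then 2 * (x \<bullet> b) else 0)"
        using D bB by (intro sum.cong) (auto simp: inner_Basis)
      ultimately show ?thesis using fin b by (simp add: sum.delta)
    qed
    have \<phi>d: "((\<lambda>t. \<phi> (sq D (x + t *\<^sub>R b))) has_real_derivative \<phi>' (sq D x) * (2 * (x \<bullet> b))) (at 0)"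
      using DERIV_chain2[OF \<phi> sqd] by simp
    have ad: "((\<lambda>t. (x + t *\<^sub>R b) \<bullet> a) has_real_derivative b \<bullet> a) (at 0)"
      unfolding inner_simps by (auto intro!: derivative_eq_intros)
    have "((\<lambda>t. ((x + t *\<^sub>R b) \<bullet> a) * \<phi> (sq D (x + t *\<^sub>R b)) * slab D x) has_real_derivative
        (b \<bullet> a * \<phi> (sq D x) + \<phi>' (sq D x) * (2 * (x \<bullet> b)) * (x \<bullet> a)) * slab D x) (at 0)"
      using DERIV_cmult_right[OF DERIV_mult[OF ad \<phi>d], of "slab D x"] by simp
    then show ?thesis
      unfolding radial_def radial'_def slab using bB by (simp add: inner_Basis algebra_simps split: if_splits)
  qed
  show "L1_deriv (radial D \<phi> a) b (radial' D \<phi> \<phi>' a b)"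
    unfolding L1_deriv_def using dquot_tendsto_deriv[OF m deriv bound2 M, where p = 1] by simp
qed

lemma dilate_inner: "b \<in> Basis \<Longrightarrow> dilate D \<mu> x \<bullet> b = (if b \<in> D then \<mu> else 1) * (x \<bullet> b)"
  unfolding dilate_def by (simp add: inner_sum_left_Basis)

lemma sq_dilate: "D \<subseteq> Basis \<Longrightarrow> sq D (dilate D \<mu> x) = \<mu>\<^sup>2 * sq D x"
  unfolding sq_def sum_distrib_left
  by (intro sum.cong refl) (auto simp: dilate_inner subset_iff power_mult_distrib)

lemma slab_dilate: "slab D (dilate D \<mu> x) = slab D x"
  by (simp add: slab_def dilate_inner)

lemma integral_dilate:
  fixes f :: "'a::euclidean_space \<Rightarrow> real"
  assumes D: "D \<subseteq> Basis" and \<mu>: "\<mu> > 0" and f: "integrable lborel f"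
  shows "integrable lborel (\<lambda>x. f (dilate D \<mu> x))"
    and "(LINT x|lborel. f x) = \<mu> ^ card D * (LINT x|lborel. f (dilate D \<mu> x))"
proof -
  note [measurable] = borel_measurable_integrable[OF f]
  have [measurable]: "dilate D \<mu> \<in> borel_measurable borel"
    unfolding dilate_def[abs_def] by measurable
  have "(\<Prod>j\<in>Basis. \<bar>if j \<in> D then \<mu> else 1\<bar>) = (\<Prod>j\<in>Basis. if j \<in> D then \<mu> else 1)"
    using \<mu> by (intro prod.cong) auto
  also have "\<dots> = \<mu> ^ card D"
    using D by (simp add: prod.inter_restrict[symmetric] Int_absorb1)
  finally have p: "(\<Prod>j\<in>Basis. \<bar>if j \<in> D then \<mu> else 1\<bar>) = \<mu> ^ card D" .
  have eq: "lborel = density (distr lborel borel (dilate D \<mu>)) (\<lambda>_. ennreal (\<mu> ^ card D))"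
    using lborel_affine_euclidean[of "\<lambda>j. if j \<in> D then \<mu> else 1" "0::'a"] \<mu>
    unfolding p dilate_def[symmetric] dilate_def[abs_def, symmetric] by simp
  have pos: "\<mu> ^ card D > 0" using \<mu> by simp
  have "integrable (density (distr lborel borel (dilate D \<mu>)) (\<lambda>_. ennreal (\<mu> ^ card D))) f"
    using f by (subst eq[symmetric])
  then have "integrable (distr lborel borel (dilate D \<mu>)) (\<lambda>x. \<mu> ^ card D * f x)"
    using pos by (subst (asm) integrable_density) auto
  then have "integrable (distr lborel borel (dilate D \<mu>)) f" using pos \<mu> by simp
  then show "integrable lborel (\<lambda>x. f (dilate D \<mu> x))"
    by (subst (asm) integrable_distr_eq) auto
  have "(LINT x|lborel. f x) = (LINT x|density (distr lborel borel (dilate D \<mu>)) (\<lambda>_. ennreal (\<mu> ^ card D)). f x)"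
    by (subst eq) simp
  also have "\<dots> = (LINT x|distr lborel borel (dilate D \<mu>). \<mu> ^ card D * f x)"
    using pos by (subst integral_density) auto
  also have "\<dots> = \<mu> ^ card D * (LINT x|lborel. f (dilate D \<mu> x))"
    by (subst integral_distr) auto
  finally show "(LINT x|lborel. f x) = \<mu> ^ card D * (LINT x|lborel. f (dilate D \<mu> x))" .
qed

text \<open>
  The radial field with this profile is \<open>x / |x|\<^bsup>2m\<^esup>\<close>, cut off inside the radius
  \<open>1/\<mu>\<close> and outside the radius of order \<open>1/\<nu>\<close>.
\<close>

definition profile :: "nat \<Rightarrow> real \<Rightarrow> real \<Rightarrow> real \<Rightarrow> real" where
  "profile m \<mu> \<nu> s = (step (\<mu>\<^sup>2 * s - 1) - step (\<nu>\<^sup>2 * s - 1)) * inverse s ^ m"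

definition profile' :: "nat \<Rightarrow> real \<Rightarrow> real \<Rightarrow> real \<Rightarrow> real" where
  "profile' m \<mu> \<nu> s = (\<mu>\<^sup>2 * step' (\<mu>\<^sup>2 * s - 1) - \<nu>\<^sup>2 * step' (\<nu>\<^sup>2 * s - 1)) * inverse s ^ m
     - real m * (step (\<mu>\<^sup>2 * s - 1) - step (\<nu>\<^sup>2 * s - 1)) * inverse s ^ (m + 1)"

text \<open>
  The field \<open>x / |x|\<^bsup>2m\<^esup>\<close> cut off at infinity only, at radii of order \<open>1/\<mu>\<close>.
  At the origin its value is \<open>0\<close>, because \<open>inverse 0 = 0\<close>.
\<close>

definition grad_kernel :: "'a::euclidean_space set \<Rightarrow> nat \<Rightarrow> real \<Rightarrow> 'a \<Rightarrow> 'a \<Rightarrow> real" where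
  "grad_kernel D m \<mu> a w = (w \<bullet> a) * ((1 - step (\<mu>\<^sup>2 * sq D w - 1)) * inverse (sq D w) ^ m) * slab D w"

text \<open>
  The divergence of \<open>x / |x|\<^bsup>2m\<^esup>\<close> cut off inside the radius \<open>1/\<mu>\<close>. As the
  divergence of the field itself is zero away from the origin, only the derivative of the cutoff contributes. It lives in
  the shell \<open>1 < \<mu>\<^sup>2 |x|\<^sup>2 < 2\<close>, and the kernels with different \<open>\<mu>\<close> are
  rescalings of each other.
\<close>

definition shell_kernel :: "'a::euclidean_space set \<Rightarrow> nat \<Rightarrow> real \<Rightarrow> 'a \<Rightarrow> real" where
  "shell_kernel D m \<mu> w = 2 * \<mu>\<^sup>2 * step' (\<mu>\<^sup>2 * sq D w - 1) * inverse (sq D w) ^ (m - 1) * slab D w"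

lemma step_scaled_has_derivative:
  "((\<lambda>s. step (\<mu>\<^sup>2 * s - 1)) has_real_derivative \<mu>\<^sup>2 * step' (\<mu>\<^sup>2 * s - 1)) (at s)"
proof -
  have "((\<lambda>s. \<mu>\<^sup>2 * s - 1) has_real_derivative \<mu>\<^sup>2) (at s)" by (auto intro!: derivative_eq_intros)
  from DERIV_chain2[OF step_has_derivative this] show ?thesis by (simp add: mult.commute)
qed

lemma step_scaled_small:
  assumes "\<mu> > 0" "s \<le> inverse (\<mu>\<^sup>2)"
  shows "step (\<mu>\<^sup>2 * s - 1) = 0" "step' (\<mu>\<^sup>2 * s - 1) = 0"
proof -
  have "\<mu>\<^sup>2 * s \<le> \<mu>\<^sup>2 * inverse (\<mu>\<^sup>2)" using assms by (intro mult_left_mono) auto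
  then have "\<mu>\<^sup>2 * s - 1 \<le> 0" using assms by simp
  then show "step (\<mu>\<^sup>2 * s - 1) = 0" "step' (\<mu>\<^sup>2 * s - 1) = 0"
    using step_nonpos step'_outside by blast+
qed

lemma step_scaled_large:
  assumes "\<mu> > 0" "s \<ge> 2 * inverse (\<mu>\<^sup>2)"
  shows "step (\<mu>\<^sup>2 * s - 1) = 1" "step' (\<mu>\<^sup>2 * s - 1) = 0"
proof -
  have "\<mu>\<^sup>2 * (2 * inverse (\<mu>\<^sup>2)) \<le> \<mu>\<^sup>2 * s" using assms by (intro mult_left_mono) auto
  moreover have "\<mu>\<^sup>2 * (2 * inverse (\<mu>\<^sup>2)) = 2" using assms by simp
  ultimately have "\<mu>\<^sup>2 * s - 1 \<ge> 1" by linarith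
  then show "step (\<mu>\<^sup>2 * s - 1) = 1" "step' (\<mu>\<^sup>2 * s - 1) = 0"
    using step_ge_1 step'_outside by blast+
qed

lemma profile_vanish:
  assumes "\<mu> > 0" "\<nu> > 0" "s \<le> min (inverse (\<mu>\<^sup>2)) (inverse (\<nu>\<^sup>2)) \<or> s \<ge> max (2 * inverse (\<mu>\<^sup>2)) (2 * inverse (\<nu>\<^sup>2))"
  shows "profile m \<mu> \<nu> s = 0" "profile' m \<mu> \<nu> s = 0"
  using assms step_scaled_small[of \<mu> s] step_scaled_small[of \<nu> s] step_scaled_large[of \<mu> s] step_scaled_large[of \<nu> s]
  by (auto simp: profile_def profile'_def)

lemma profile_has_derivative:
  assumes "\<mu> > 0" "\<nu> > 0"
  shows "(profile m \<mu> \<nu> has_real_derivative profile' m \<mu> \<nu> s) (at s)"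
proof (cases "s > 0")
  case True
  have N: "((\<lambda>s. step (\<mu>\<^sup>2 * s - 1) - step (\<nu>\<^sup>2 * s - 1)) has_real_derivative
      \<mu>\<^sup>2 * step' (\<mu>\<^sup>2 * s - 1) - \<nu>\<^sup>2 * step' (\<nu>\<^sup>2 * s - 1)) (at s)"
    by (intro DERIV_diff step_scaled_has_derivative)
  have "s \<noteq> 0" using True by simp
  from DERIV_mult[OF N inverse_power_has_derivative[OF this, of m]] show ?thesis
    unfolding profile_def[abs_def] profile'_def by (simp add: algebra_simps)
next
  case False
  let ?\<delta> = "min (inverse (\<mu>\<^sup>2)) (inverse (\<nu>\<^sup>2))"
  have "?\<delta> > 0" using assms by simp
  then have s: "s < ?\<delta>" using False by linarith
  have "((\<lambda>_. 0) has_real_derivative 0) (at s)" by simp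
  then have "(profile m \<mu> \<nu> has_real_derivative 0) (at s)"
    by (rule has_field_derivative_transform_within_open[where S = "{..<?\<delta>}"])
       (use s profile_vanish(1)[OF assms] in \<open>auto simp: less_imp_le\<close>)
  then show ?thesis using profile_vanish(2)[OF assms, of s m] s by (simp add: less_imp_le)
qed

lemma profile'_measurable [measurable]: "profile' m \<mu> \<nu> \<in> borel_measurable borel"
proof -
  have [measurable]: "step \<in> borel_measurable borel" "step' \<in> borel_measurable borel"
    using Ck_step[of 0] continuous_step'[of UNIV] by (auto intro: borel_measurable_continuous_onI)
  show ?thesis unfolding profile'_def[abs_def] by measurable
qed

lemma profile_bounded:
  assumes "\<mu> > 0" "\<nu> > 0"
  obtains B where "\<And>s. \<bar>profile m \<mu> \<nu> s\<bar> \<le> B" "\<And>s. \<bar>profile' m \<mu> \<nu> s\<bar> \<le> B"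
proof -
  let ?\<delta> = "min (inverse (\<mu>\<^sup>2)) (inverse (\<nu>\<^sup>2))" and ?S = "max (2 * inverse (\<mu>\<^sup>2)) (2 * inverse (\<nu>\<^sup>2))"
  have \<delta>: "?\<delta> > 0" using assms by simp
  have st: "continuous_on UNIV step" using Ck_step[of 0] by simp
  have c1: "continuous_on {?\<delta>..?S} (\<lambda>s. step (\<mu>\<^sup>2 * s - 1))" for \<mu>
    by (rule continuous_on_compose2[OF st]) (auto intro!: continuous_intros)
  have c2: "continuous_on {?\<delta>..?S} (\<lambda>s. step' (\<mu>\<^sup>2 * s - 1))" for \<mu>
    by (rule continuous_on_compose2[OF continuous_step'[of UNIV]]) (auto intro!: continuous_intros)
  have ne: "s \<noteq> 0" if "s \<in> {?\<delta>..?S}" for s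
    using that \<delta> unfolding atLeastAtMost_iff by linarith
  have i: "continuous_on {?\<delta>..?S} (\<lambda>s. inverse s ^ k)" for k
    by (intro continuous_on_power continuous_on_inverse continuous_on_id ballI) (rule ne)
  have "continuous_on {?\<delta>..?S} (profile m \<mu> \<nu>)" "continuous_on {?\<delta>..?S} (profile' m \<mu> \<nu>)"
    unfolding profile_def[abs_def] profile'_def[abs_def]
    by (intro continuous_on_mult continuous_on_diff continuous_on_const c1 c2 i)+
  then have "bounded (profile m \<mu> \<nu> ` {?\<delta>..?S})" "bounded (profile' m \<mu> \<nu> ` {?\<delta>..?S})"
    by (auto intro!: compact_imp_bounded compact_continuous_image)
  then obtain B1 B2 where B: "B1 > 0" "\<And>s. s \<in> {?\<delta>..?S} \<Longrightarrow> \<bar>profile m \<mu> \<nu> s\<bar> \<le> B1"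
    "B2 > 0" "\<And>s. s \<in> {?\<delta>..?S} \<Longrightarrow> \<bar>profile' m \<mu> \<nu> s\<bar> \<le> B2"
    unfolding bounded_pos by (metis imageI real_norm_def)
  have "\<bar>profile m \<mu> \<nu> s\<bar> \<le> max B1 B2 \<and> \<bar>profile' m \<mu> \<nu> s\<bar> \<le> max B1 B2" for s
  proof (cases "s \<in> {?\<delta>..?S}")
    case True
    then show ?thesis using B(2)[OF True] B(4)[OF True] by linarith
  next
    case False
    then have "s \<le> ?\<delta> \<or> s \<ge> ?S" by auto
    then show ?thesis using profile_vanish[OF assms] B(1) by simp
  qed
  then show thesis using that by blast
qed

lemma radial_profile_eq: "radial D (profile m \<mu> \<nu>) a w = grad_kernel D m \<nu> a w - grad_kernel D m \<mu> a w"
  by (simp add: radial_def profile_def grad_kernel_def algebra_simps)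

lemma radial'_sym: "radial' D \<phi> \<phi>' a b w = radial' D \<phi> \<phi>' b a w"
  by (simp add: radial'_def algebra_simps)

lemma radial'_profile_diff:
  "radial' D (profile m \<mu> \<nu>) (profile' m \<mu> \<nu>) a b w - radial' D (profile m \<mu>' \<nu>) (profile' m \<mu>' \<nu>) a b w
     = radial' D (profile m \<mu> \<mu>') (profile' m \<mu> \<mu>') a b w"
  by (simp add: radial'_def profile_def profile'_def algebra_simps)

text \<open>
  The coordinates in \<open>D\<close> span a real space of dimension \<open>2 m\<close>. That the dimension is even makes
  \<open>|x|\<^bsup>2m\<^esup>\<close> a polynomial in the coordinates.
\<close>

locale even_directions =
  fixes D :: "'a::euclidean_space set" and m :: nat
  assumes D: "D \<subseteq> Basis" and card: "card D = 2 * m" and m: "m > 0"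
begin

lemma finD: "finite D"
  using D finite_Basis finite_subset by blast

lemma neD: "D \<noteq> {}"
  using card m by auto

lemma radial_profile:
  assumes "a \<in> D" "b \<in> D" "\<mu> > 0" "\<nu> > 0"
  shows "integrable lborel (radial D (profile m \<mu> \<nu>) a)"
    and "integrable lborel (radial' D (profile m \<mu> \<nu>) (profile' m \<mu> \<nu>) a b)"
    and "L1_deriv (radial D (profile m \<mu> \<nu>) a) b (radial' D (profile m \<mu> \<nu>) (profile' m \<mu> \<nu>) a b)"
proof -
  obtain B where B: "\<And>s. \<bar>profile m \<mu> \<nu> s\<bar> \<le> B" "\<And>s. \<bar>profile' m \<mu> \<nu> s\<bar> \<le> B"
    using profile_bounded[OF assms(3,4)] by metis
  define S where "S = max (2 * inverse (\<mu>\<^sup>2)) (2 * inverse (\<nu>\<^sup>2))"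
  have S: "profile m \<mu> \<nu> s = 0" "profile' m \<mu> \<nu> s = 0" if "s > S" for s
    using profile_vanish[OF assms(3,4), of s m] that unfolding S_def by auto
  show "integrable lborel (radial D (profile m \<mu> \<nu>) a)"
    "integrable lborel (radial' D (profile m \<mu> \<nu>) (profile' m \<mu> \<nu>) a b)"
    "L1_deriv (radial D (profile m \<mu> \<nu>) a) b (radial' D (profile m \<mu> \<nu>) (profile' m \<mu> \<nu>) a b)"
    by (rule radial_derivative[OF D assms(1,2) profile_has_derivative[OF assms(3,4)] profile'_measurable B S]; assumption)+
qed

text \<open>
  With \<open>s = |x|\<^sup>2\<close> the divergence of \<open>x \<phi>(s)\<close> is
  \<open>2 m \<phi> + 2 s \<phi>'\<close>. For \<open>\<phi> = \<psi>(s) / s\<^sup>m\<close> the terms with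
  \<open>\<psi>\<close> cancel, and \<open>2 \<psi>'(s) / s\<^bsup>m-1\<^esup>\<close> remains.
\<close>

lemma radial'_trace: "(\<Sum>a\<in>D. radial' D (profile m \<mu> \<nu>) (profile' m \<mu> \<nu>) a a w) = shell_kernel D m \<mu> w - shell_kernel D m \<nu> w"
proof -
  let ?s = "sq D w"
  have "(\<Sum>a\<in>D. radial' D (profile m \<mu> \<nu>) (profile' m \<mu> \<nu>) a a w)
      = (\<Sum>a\<in>D. (profile m \<mu> \<nu> ?s * slab D w + (w \<bullet> a)\<^sup>2 * (2 * profile' m \<mu> \<nu> ?s * slab D w)))"
    by (intro sum.cong refl) (simp add: radial'_def power2_eq_square algebra_simps)
  also have "\<dots> = (2 * real m * profile m \<mu> \<nu> ?s + 2 * ?s * profile' m \<mu> \<nu> ?s) * slab D w"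
    unfolding sum.distrib sum_distrib_right[symmetric] sq_def[symmetric] using card by (simp add: algebra_simps)
  also have "2 * real m * profile m \<mu> \<nu> ?s + 2 * ?s * profile' m \<mu> \<nu> ?s
      = (2 * \<mu>\<^sup>2 * step' (\<mu>\<^sup>2 * ?s - 1) - 2 * \<nu>\<^sup>2 * step' (\<nu>\<^sup>2 * ?s - 1)) * inverse ?s ^ (m - 1)"
  proof (cases "?s = 0")
    case True
    have "step' (-1) = 0" by (rule step'_outside) simp
    then show ?thesis using True by (simp add: profile_def)
  next
    case False
    obtain k where k: "m = Suc k" using m by (cases m) auto
    show ?thesis using False by (simp add: profile_def profile'_def k field_simps)
  qed
  finally show ?thesis by (simp add: shell_kernel_def algebra_simps)
qed

lemma grad_kernel_dilate:
  assumes "\<mu> > 0" "a \<in> D"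
  shows "grad_kernel D m (\<mu> * \<nu>) a w = \<mu> ^ (2 * m - 1) * grad_kernel D m \<nu> a (dilate D \<mu> w)"
proof -
  have a: "dilate D \<mu> w \<bullet> a = \<mu> * (w \<bullet> a)" using assms D by (auto simp: dilate_inner)
  have "\<mu> ^ (2 * m - 1) * \<mu> * inverse (\<mu>\<^sup>2) ^ m = 1"
  proof -
    have "\<mu> ^ (2 * m - 1) * \<mu> = \<mu> ^ (2 * m)" using m by (cases m) auto
    then show ?thesis using assms(1) by (simp add: power_mult power_inverse)
  qed
  then have p: "\<mu> ^ (2 * m - 1) * (\<mu> * (x * (y * (inverse (\<mu>\<^sup>2) ^ m * z)))) = x * (y * z)" for x y z
    by (metis (no_types, opaque_lifting) mult.assoc mult.commute mult.left_commute mult_1)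
  show ?thesis
    unfolding grad_kernel_def a sq_dilate[OF D] slab_dilate inverse_mult_distrib power_mult_distrib
    using p[of "w \<bullet> a" "1 - step (\<nu>\<^sup>2 * (\<mu>\<^sup>2 * sq D w) - 1)" "inverse (sq D w) ^ m * slab D w"]
    by (simp add: ac_simps)
qed

lemma shell_kernel_dilate:
  assumes "\<mu> > 0"
  shows "shell_kernel D m \<mu> w = \<mu> ^ (2 * m) * shell_kernel D m 1 (dilate D \<mu> w)"
proof -
  obtain k where k: "m = Suc k" using m by (cases m) auto
  have "\<mu> ^ (2 * m) * inverse (\<mu>\<^sup>2) ^ (m - 1) = \<mu>\<^sup>2"
  proof -
    have "(\<mu>\<^sup>2) ^ k * inverse (\<mu>\<^sup>2) ^ k = 1" using assms by (simp add: power_mult_distrib[symmetric] del: power_inverse)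
    then have "\<mu>\<^sup>2 * ((\<mu>\<^sup>2) ^ k * inverse (\<mu>\<^sup>2) ^ k) = \<mu>\<^sup>2" by (simp only: mult_1_right)
    moreover have "\<mu> ^ (2 * m) = \<mu>\<^sup>2 * (\<mu>\<^sup>2) ^ k" by (simp only: power_mult k power_Suc)
    ultimately show ?thesis by (simp only: k diff_Suc_1 mult.assoc)
  qed
  then have p: "\<mu> ^ (2 * m) * (x * (inverse (\<mu>\<^sup>2) ^ (m - 1) * y)) = \<mu>\<^sup>2 * (x * y)" for x y
    by (metis (no_types, opaque_lifting) mult.assoc mult.commute mult.left_commute)
  show ?thesis
    unfolding shell_kernel_def sq_dilate[OF D] slab_dilate inverse_mult_distrib power_mult_distrib
    using p[of "2 * step' (\<mu>\<^sup>2 * sq D w - 1)" "inverse (sq D w) ^ (m - 1) * slab D w", symmetric]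
    by (simp add: ac_simps)
qed

lemma shell_kernel_support:
  assumes "\<mu> > 0" "shell_kernel D m \<mu> w \<noteq> 0"
  shows "inverse (\<mu>\<^sup>2) < sq D w" "sq D w < 2 * inverse (\<mu>\<^sup>2)"
  using step_scaled_small(2)[OF assms(1), of "sq D w"] step_scaled_large(2)[OF assms(1), of "sq D w"] assms(2)
  unfolding shell_kernel_def by force+

lemma shell_kernel_nonneg: "shell_kernel D m \<mu> w \<ge> 0"
  unfolding shell_kernel_def using step'_nonneg sq_nonneg slab_cases[of D w]
  by (intro mult_nonneg_nonneg zero_le_power[of "inverse (sq D w)"]) auto

lemma shell_kernel_measurable [measurable]: "shell_kernel D m \<mu> \<in> borel_measurable borel"
proof -
  have [measurable]: "step' \<in> borel_measurable borel"
    using continuous_step'[of UNIV] by (auto intro: borel_measurable_continuous_onI)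
  show ?thesis unfolding shell_kernel_def[abs_def] by measurable
qed

lemma shell_kernel_1_integrable: "integrable lborel (shell_kernel D m 1)"
proof -
  have "compact (step' ` {0..1})"
    by (intro compact_continuous_image continuous_step') auto
  then have "bounded (step' ` {0..1})" by (rule compact_imp_bounded)
  then obtain B where B: "B > 0" "\<And>s. s \<in> {0..1} \<Longrightarrow> \<bar>step' s\<bar> \<le> B"
    unfolding bounded_pos by (metis imageI real_norm_def)
  have B': "\<bar>step' s\<bar> \<le> B" for s
    using B step'_outside[of s] by (cases "s \<in> {0..1}") auto
  show ?thesis
  proof (rule bounded_support_integrable[where B = "2 * B" and M = "real DIM('a) * (1 + 2)"])
    show "\<bar>shell_kernel D m 1 w\<bar> \<le> 2 * B" for w
    proof (cases "shell_kernel D m 1 w = 0")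
      case False
      from shell_kernel_support(1)[OF _ this] have "sq D w > 1" by simp
      then have i: "\<bar>inverse (sq D w) ^ (m - 1)\<bar> \<le> 1"
        using sq_nonneg[of D w] by (simp add: power_le_one inverse_le_1_iff)
      have "\<bar>2 * step' (sq D w - 1)\<bar> * \<bar>inverse (sq D w) ^ (m - 1)\<bar> * \<bar>slab D w\<bar> \<le> 2 * B * 1 * 1"
        using B'[of "sq D w - 1"] B(1) i slab_cases[of D w] by (intro mult_mono) auto
      then show ?thesis by (simp add: shell_kernel_def abs_mult)
    qed (use B in simp)
    show "shell_kernel D m 1 w = 0" if "norm w > real DIM('a) * (1 + 2)" for w
    proof (rule ccontr)
      assume n: "shell_kernel D m 1 w \<noteq> 0"
      then have "slab D w \<noteq> 0" by (auto simp: shell_kernel_def)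
      moreover have "sq D w \<le> 2" using shell_kernel_support(2)[OF _ n] by simp
      ultimately show False using norm_le_of_slab[OF D, of w 2] that by linarith
    qed
  qed measurable
qed

definition shell_mass :: real where "shell_mass = (LINT w|lborel. shell_kernel D m 1 w)"

lemma shell_kernel_integral:
  assumes "\<mu> > 0"
  shows "integrable lborel (shell_kernel D m \<mu>)" "(LINT w|lborel. shell_kernel D m \<mu> w) = shell_mass"
proof -
  have "shell_kernel D m \<mu> = (\<lambda>w. \<mu> ^ (2 * m) * shell_kernel D m 1 (dilate D \<mu> w))"
    using shell_kernel_dilate[OF assms] by (rule ext)
  then show "integrable lborel (shell_kernel D m \<mu>)" "(LINT w|lborel. shell_kernel D m \<mu> w) = shell_mass"
    using integral_dilate[OF D assms shell_kernel_1_integrable] by (simp_all add: shell_mass_def card)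
qed

text \<open>
  The kernel is nonnegative, and positive on a nonempty open set.
\<close>

lemma shell_mass_pos: "shell_mass > 0"
proof -
  have "shell_mass \<noteq> 0"
  proof
    assume "shell_mass = 0"
    then have "AE w in lborel. shell_kernel D m 1 w = 0"
      unfolding shell_mass_def
      by (subst (asm) integral_nonneg_eq_0_iff_AE[OF shell_kernel_1_integrable]) (auto simp: shell_kernel_nonneg)
    let ?U = "{w. 1 < sq D w} \<inter> {w. sq D w < 2} \<inter> {w. \<forall>b\<in>Basis - D. 0 < w \<bullet> b \<and> w \<bullet> b < 1}"
    have "continuous_on UNIV (sq D)" unfolding sq_def[abs_def] by (intro continuous_intros)
    then have "open ({w. 1 < sq D w} \<inter> {w. sq D w < 2} \<inter> (\<Inter>b\<in>Basis - D. {w. 0 < w \<bullet> b} \<inter> {w. w \<bullet> b < 1}))"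
      by (intro open_Int open_INT ballI open_Collect_less continuous_intros) auto
    moreover have "(\<Inter>b\<in>Basis - D. {w. 0 < w \<bullet> b} \<inter> {w. w \<bullet> b < 1}) = {w. \<forall>b\<in>Basis - D. 0 < w \<bullet> b \<and> w \<bullet> b < 1}"
      by auto
    ultimately have op: "open ?U" by simp
    have ne: "?U \<noteq> {}"
    proof -
      obtain b0 where b0: "b0 \<in> D" using neD by auto
      define w :: 'a where "w = (\<Sum>b\<in>Basis. (if b = b0 then 6/5 else if b \<in> D then 0 else 1/2) *\<^sub>R b)"
      have wb: "w \<bullet> b = (if b = b0 then 6/5 else if b \<in> D then 0 else 1/2)" if "b \<in> Basis" for b
        unfolding w_def using that by (simp add: inner_sum_left_Basis)
      have "sq D w = (\<Sum>b\<in>D. if b = b0 then (6/5)\<^sup>2 else 0)"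
        unfolding sq_def using D by (intro sum.cong refl) (auto simp: wb subset_iff)
      then have "sq D w = 36/25" using b0 finD by (simp add: power2_eq_square)
      then have "w \<in> ?U" using b0 by (auto simp: wb)
      then show ?thesis by blast
    qed
    have pos: "shell_kernel D m 1 w \<noteq> 0" if "w \<in> ?U" for w
    proof -
      have "step' (sq D w - 1) > 0" using that by (intro step'_pos) auto
      moreover have "slab D w = 1" using that by (auto simp: slab_def less_imp_le)
      ultimately show ?thesis using that by (auto simp: shell_kernel_def)
    qed
    have "AE w in lborel. w \<notin> ?U"
      using \<open>AE w in lborel. shell_kernel D m 1 w = 0\<close> by eventually_elim (use pos in blast)
    then have "?U \<in> null_sets lborel" by (subst AE_iff_null_sets) (use op in auto)
    then have "negligible ?U" using op by (simp add: negligible_iff_emeasure0 null_setsD1)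
    then show False using open_not_negligible[OF op ne] by simp
  qed
  moreover have "shell_mass \<ge> 0" unfolding shell_mass_def by (simp add: integral_nonneg_AE shell_kernel_nonneg)
  ultimately show ?thesis by simp
qed

lemma grad_kernel_measurable [measurable]: "grad_kernel D m \<mu> a \<in> borel_measurable borel"
proof -
  have [measurable]: "step \<in> borel_measurable borel"
    using Ck_step[of 0] by (auto intro: borel_measurable_continuous_onI)
  show ?thesis unfolding grad_kernel_def[abs_def] by measurable
qed

lemma grad_kernel_eventually_0: "\<forall>\<^sub>F i in sequentially. grad_kernel D m (2 ^ i) a w = 0"
proof (cases "sq D w = 0")
  case True
  then show ?thesis using m by (simp add: grad_kernel_def)
next
  case False
  then have pos: "sq D w > 0" using sq_nonneg[of D w] by simp
  obtain N where N: "2 * inverse (sq D w) < 2 ^ N" using real_arch_pow[of 2 "2 * inverse (sq D w)"] by auto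
  show ?thesis
  proof (rule eventually_sequentiallyI[of N])
    fix i assume "i \<ge> N"
    have "(2::real) ^ N \<le> 2 ^ i" using \<open>i \<ge> N\<close> by (intro power_increasing) auto
    also have "\<dots> \<le> (2 ^ i)\<^sup>2" using one_le_power[of "2::real" i] by (simp add: power2_eq_square)
    finally have "2 * inverse (sq D w) < (2 ^ i)\<^sup>2" using N by linarith
    then have "2 * inverse ((2 ^ i)\<^sup>2) \<le> sq D w" using pos by (simp add: field_simps)
    then show "grad_kernel D m (2 ^ i) a w = 0" by (simp add: grad_kernel_def step_scaled_large(1))
  qed
qed

text \<open>
  Summation over dyadic shells. The part of the kernel at scale \<open>2\<^bsup>-i\<^esup>\<close> is a rescaling of the
  one at scale \<open>1\<close>, and its integral is smaller by the factor \<open>2\<^bsup>-i\<^esup>\<close>, because the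
  kernel has degree \<open>1 - 2 m\<close> in dimension \<open>2 m\<close>.
\<close>

lemma grad_kernel_1_integrable:
  assumes a: "a \<in> D"
  shows "integrable lborel (grad_kernel D m 1 a)"
proof -
  define q where "q i = radial D (profile m (2 ^ Suc i) (2 ^ i)) a" for i :: nat
  have q: "q i w = grad_kernel D m (2 ^ i) a w - grad_kernel D m (2 ^ Suc i) a w" for i w
    unfolding q_def by (rule radial_profile_eq)
  have qint: "integrable lborel (q i)" for i unfolding q_def by (rule radial_profile(1)[OF a a]) auto
  note [measurable] = borel_measurable_integrable[OF qint]
  define c where "c = (LINT w|lborel. \<bar>q 0 w\<bar>)"
  have qc: "(LINT w|lborel. \<bar>q i w\<bar>) = (1/2) ^ i * c" for i
  proof -
    have "q i w = (2 ^ i) ^ (2 * m - 1) * q 0 (dilate D (2 ^ i) w)" for w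
      unfolding q using grad_kernel_dilate[OF _ a, of "2 ^ i" 1] grad_kernel_dilate[OF _ a, of "2 ^ i" 2]
      by (simp add: algebra_simps)
    then have "(LINT w|lborel. \<bar>q i w\<bar>) = (2 ^ i) ^ (2 * m - 1) * (LINT w|lborel. \<bar>q 0 (dilate D (2 ^ i) w)\<bar>)"
      by (simp add: abs_mult)
    moreover have "c = (2 ^ i) ^ (2 * m) * (LINT w|lborel. \<bar>q 0 (dilate D (2 ^ i) w)\<bar>)"
      unfolding c_def using integral_dilate(2)[OF D _ integrable_abs[OF qint[of 0]], of "2 ^ i"] card by simp
    moreover have "((2::real) ^ i) ^ (2 * m) = 2 ^ i * (2 ^ i) ^ (2 * m - 1)"
      using m by (cases m) auto
    ultimately show ?thesis by (simp add: power_divide)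
  qed
  have "(\<integral>\<^sup>+w. ennreal (norm (grad_kernel D m 1 a w)) \<partial>lborel) \<le> (\<integral>\<^sup>+w. (\<Sum>i. ennreal \<bar>q i w\<bar>) \<partial>lborel)"
  proof (rule nn_integral_mono)
    fix w
    obtain n where n: "grad_kernel D m (2 ^ n) a w = 0"
      using grad_kernel_eventually_0[of a w] by (auto dest: eventually_happens)
    have "(\<Sum>i<n. q i w) = grad_kernel D m (2 ^ 0) a w - grad_kernel D m (2 ^ n) a w"
      unfolding q by (rule sum_lessThan_telescope')
    then have "norm (grad_kernel D m 1 a w) \<le> (\<Sum>i<n. \<bar>q i w\<bar>)" using n sum_abs[of "\<lambda>i. q i w" "{..<n}"] by simp
    then have "ennreal (norm (grad_kernel D m 1 a w)) \<le> (\<Sum>i<n. ennreal \<bar>q i w\<bar>)"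
      by (subst sum_ennreal) (auto intro: ennreal_leI)
    also have "\<dots> \<le> (\<Sum>i. ennreal \<bar>q i w\<bar>)" by (rule sum_le_suminf[OF summableI]) simp_all
    finally show "ennreal (norm (grad_kernel D m 1 a w)) \<le> (\<Sum>i. ennreal \<bar>q i w\<bar>)" .
  qed
  also have "\<dots> = (\<Sum>i. \<integral>\<^sup>+w. ennreal \<bar>q i w\<bar> \<partial>lborel)" by (rule nn_integral_suminf) measurable
  also have "\<dots> = (\<Sum>i. ennreal ((1/2) ^ i * c))"
    by (intro suminf_cong) (simp only: qc[symmetric], rule nn_integral_eq_integral, auto intro: integrable_abs qint)
  also have "\<dots> < \<infinity>"
  proof -
    have "c \<ge> 0" unfolding c_def by (simp add: integral_nonneg_AE)
    then show ?thesis by (subst suminf_ennreal2) (auto intro!: summable_mult2 summable_geometric)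
  qed
  finally show ?thesis by (intro integrableI_bounded) auto
qed

definition grad_mass :: "'a \<Rightarrow> real" where "grad_mass a = (LINT w|lborel. \<bar>grad_kernel D m 1 a w\<bar>)"

lemma grad_kernel_integral:
  assumes a: "a \<in> D" and "\<mu> > 0"
  shows "integrable lborel (grad_kernel D m \<mu> a)" "(LINT w|lborel. \<bar>grad_kernel D m \<mu> a w\<bar>) = inverse \<mu> * grad_mass a"
proof -
  have s: "grad_kernel D m \<mu> a = (\<lambda>w. \<mu> ^ (2 * m - 1) * grad_kernel D m 1 a (dilate D \<mu> w))"
    using grad_kernel_dilate[OF assms(2) a, of 1] by (intro ext) simp
  show "integrable lborel (grad_kernel D m \<mu> a)"
    by (subst s) (intro integrable_mult_right integral_dilate(1)[OF D assms(2) grad_kernel_1_integrable[OF a]])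
  have "(LINT w|lborel. \<bar>grad_kernel D m \<mu> a w\<bar>) = \<mu> ^ (2 * m - 1) * (LINT w|lborel. \<bar>grad_kernel D m 1 a (dilate D \<mu> w)\<bar>)"
    unfolding fun_cong[OF s] abs_mult integral_mult_right_zero using assms(2) by simp
  moreover have "grad_mass a = \<mu> ^ (2 * m) * (LINT w|lborel. \<bar>grad_kernel D m 1 a (dilate D \<mu> w)\<bar>)"
    unfolding grad_mass_def using integral_dilate(2)[OF D assms(2) integrable_abs[OF grad_kernel_1_integrable[OF a]]] card by simp
  moreover have "\<mu> ^ (2 * m) = \<mu> * \<mu> ^ (2 * m - 1)" using m by (cases m) auto
  ultimately show "(LINT w|lborel. \<bar>grad_kernel D m \<mu> a w\<bar>) = inverse \<mu> * grad_mass a"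
    using assms(2) by simp
qed

section \<open>Solving the divergence equation\<close>

lemma proj_shift: "b \<in> D \<Longrightarrow> proj D (w + t *\<^sub>R b) = proj D w + t *\<^sub>R b"
  by (rule proj_translate[OF D])

lemma conv_shell_kernel_tendsto:
  assumes g: "g \<in> L2"
  shows "(\<lambda>n. norm_L2 (\<lambda>z. conv (proj D) (shell_kernel D m (2 ^ n)) g z - shell_mass *\<^sub>R g z)) \<longlonglongrightarrow> 0"
proof (rule conv_approximate_identity[where A = shell_mass])
  show "integrable lborel (shell_kernel D m (2 ^ n))" "(LINT w|lborel. shell_kernel D m (2 ^ n) w) = shell_mass" for n
    using shell_kernel_integral[of "2 ^ n"] by auto
  then show "(LINT w|lborel. \<bar>shell_kernel D m (2 ^ n) w\<bar>) \<le> shell_mass" for n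
    using shell_kernel_nonneg by simp
  fix d :: real assume d: "d > 0"
  obtain N where N: "2 * inverse (d\<^sup>2) < 2 ^ N" using real_arch_pow[of 2 "2 * inverse (d\<^sup>2)"] by auto
  show "\<forall>\<^sub>F n in sequentially. \<forall>w. shell_kernel D m (2 ^ n) w \<noteq> 0 \<longrightarrow> norm (proj D w) < d"
  proof (rule eventually_sequentiallyI[of N], intro allI impI)
    fix n w assume n: "n \<ge> N" "shell_kernel D m (2 ^ n) w \<noteq> 0"
    have "(2::real) ^ N \<le> 2 ^ n" using n(1) by (intro power_increasing) auto
    also have "\<dots> \<le> (2 ^ n)\<^sup>2" using one_le_power[of "2::real" n] by (simp add: power2_eq_square)
    finally have "2 * inverse (d\<^sup>2) < (2 ^ n)\<^sup>2" using N by linarith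
    then have "2 * inverse ((2 ^ n)\<^sup>2) < d\<^sup>2" using d by (simp add: field_simps)
    then have "(norm (proj D w))\<^sup>2 < d\<^sup>2"
      using shell_kernel_support(2)[OF _ n(2)] by (simp add: norm_proj_sq[OF D])
    then show "norm (proj D w) < d" by (rule power2_less_imp_less) (use d in simp)
  qed
qed (use g in auto)

text \<open>
  Cutting off the singularity at the radius \<open>2\<^bsup>-n\<^esup>\<close> gives kernels that may be differentiated,
  and the divergences converge by \<open>conv_shell_kernel_tendsto\<close>. The bound of \<open>curl_free_norm\<close>
  extends the convergence to all derivatives, and limits of weak derivatives are weak derivatives.
\<close>

lemma singular_convolution_derivatives:
  assumes g: "g \<in> L2" and \<nu>: "\<nu> > 0"
  obtains v where
    "\<And>a b. a \<in> D \<Longrightarrow> b \<in> D \<Longrightarrow> v a b \<in> L2"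
    "\<And>a b. a \<in> D \<Longrightarrow> b \<in> D \<Longrightarrow> has_weak_deriv (conv (proj D) (grad_kernel D m \<nu> a) g) b (v a b)"
    "\<And>a b. a \<in> D \<Longrightarrow> b \<in> D \<Longrightarrow> AE z in lborel. v a b z = v b a z"
    "AE z in lborel. (\<Sum>a\<in>D. v a a z) = shell_mass *\<^sub>R g z - conv (proj D) (shell_kernel D m \<nu>) g z"
proof -
  let ?P = "proj D"
  let ?k = "\<lambda>\<mu> \<nu> a. radial D (profile m \<mu> \<nu>) a" and ?k' = "\<lambda>\<mu> \<nu> a b. radial' D (profile m \<mu> \<nu>) (profile' m \<mu> \<nu>) a b"
  let ?dc = "\<lambda>\<mu>. conv ?P (shell_kernel D m \<mu>) g"
  define U where "U \<mu> \<nu> a = conv ?P (?k \<mu> \<nu> a) g" for \<mu> \<nu> a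
  define V where "V \<mu> \<nu> a b = conv ?P (?k' \<mu> \<nu> a b) g" for \<mu> \<nu> a b
  have UL: "U \<mu> \<nu> a \<in> L2" if "a \<in> D" "\<mu> > 0" "\<nu> > 0" for \<mu> \<nu> a
    unfolding U_def using that by (intro conv_L2(2) proj_measurable radial_profile g)
  have VL: "V \<mu> \<nu> a b \<in> L2" if "a \<in> D" "b \<in> D" "\<mu> > 0" "\<nu> > 0" for \<mu> \<nu> a b
    unfolding V_def using that by (intro conv_L2(2) proj_measurable radial_profile g)
  have dL: "?dc \<mu> \<in> L2" if "\<mu> > 0" for \<mu>
    using that by (intro conv_L2(2) proj_measurable shell_kernel_integral g)
  have strong: "strong_deriv (U \<mu> \<nu> a) b (V \<mu> \<nu> a b)" if "a \<in> D" "b \<in> D" "\<mu> > 0" "\<nu> > 0" for \<mu> \<nu> a b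
    unfolding U_def V_def using that by (intro strong_deriv_conv proj_measurable proj_shift radial_profile g)
  have sym: "V \<mu> \<nu> a b = V \<mu> \<nu> b a" for \<mu> \<nu> a b
  proof -
    have "?k' \<mu> \<nu> a b = ?k' \<mu> \<nu> b a" by (rule ext) (rule radial'_sym)
    then show ?thesis unfolding V_def by simp
  qed
  have trace: "AE z in lborel. (\<Sum>a\<in>D. V \<mu> \<nu> a a z) = ?dc \<mu> z - ?dc \<nu> z" if "\<mu> > 0" "\<nu> > 0" for \<mu> \<nu>
  proof -
    have "AE z in lborel. conv ?P (\<lambda>w. \<Sum>a\<in>D. ?k' \<mu> \<nu> a a w) g z = (\<Sum>a\<in>D. V \<mu> \<nu> a a z)"
      unfolding V_def using that by (intro conv_kernel_sum proj_measurable radial_profile finD g)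
    moreover have "(\<lambda>w. \<Sum>a\<in>D. ?k' \<mu> \<nu> a a w) = (\<lambda>w. shell_kernel D m \<mu> w - shell_kernel D m \<nu> w)"
      by (rule ext) (rule radial'_trace)
    moreover have "AE z in lborel. conv ?P (\<lambda>w. shell_kernel D m \<mu> w - shell_kernel D m \<nu> w) g z = ?dc \<mu> z - ?dc \<nu> z"
      using that by (intro conv_kernel_diff proj_measurable shell_kernel_integral g)
    ultimately show ?thesis by (auto elim!: eventually_elim2)
  qed
  \<comment> \<open>The difference of two regularised kernels is again of the same form, so that \<open>curl_free_norm\<close> bounds the differences
    of all derivatives by the difference of the divergences.\<close>
  have close: "norm_L2 (\<lambda>z. V \<mu> \<nu> a b z - V \<mu>' \<nu> a b z) \<le> norm_L2 (\<lambda>z. ?dc \<mu> z - ?dc \<mu>' z)"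
    if "a \<in> D" "b \<in> D" "\<mu> > 0" "\<mu>' > 0" for \<mu> \<mu>' a b
  proof -
    have "AE z in lborel. conv ?P (\<lambda>w. ?k' \<mu> \<nu> a b w - ?k' \<mu>' \<nu> a b w) g z = V \<mu> \<nu> a b z - V \<mu>' \<nu> a b z"
      unfolding V_def using that \<nu> by (intro conv_kernel_diff proj_measurable radial_profile g)
    moreover have "(\<lambda>w. ?k' \<mu> \<nu> a b w - ?k' \<mu>' \<nu> a b w) = ?k' \<mu> \<mu>' a b"
      by (rule ext) (rule radial'_profile_diff)
    ultimately have "AE z in lborel. V \<mu> \<nu> a b z - V \<mu>' \<nu> a b z = V \<mu> \<mu>' a b z"
      unfolding V_def by (auto elim!: eventually_mono)
    then have "norm_L2 (\<lambda>z. V \<mu> \<nu> a b z - V \<mu>' \<nu> a b z) = norm_L2 (V \<mu> \<mu>' a b)"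
      using that \<nu> by (intro norm_L2_cong_AE L2_measurable L2_diff VL)
    moreover have "(norm_L2 (V \<mu> \<mu>' a b))\<^sup>2 \<le> (\<Sum>b\<in>D. (norm_L2 (V \<mu> \<mu>' a b))\<^sup>2)"
      using that finD by (intro member_le_sum) auto
    moreover have "(\<Sum>b\<in>D. (norm_L2 (V \<mu> \<mu>' a b))\<^sup>2) \<le> (\<Sum>a\<in>D. \<Sum>b\<in>D. (norm_L2 (V \<mu> \<mu>' a b))\<^sup>2)"
      using that finD by (intro member_le_sum[of a D "\<lambda>a. \<Sum>b\<in>D. (norm_L2 (V \<mu> \<mu>' a b))\<^sup>2"] sum_nonneg) auto
    moreover have "(\<Sum>a\<in>D. \<Sum>b\<in>D. (norm_L2 (V \<mu> \<mu>' a b))\<^sup>2) = (norm_L2 (\<lambda>z. \<Sum>a\<in>D. V \<mu> \<mu>' a a z))\<^sup>2"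
      using that by (intro curl_free_norm[where u = "U \<mu> \<mu>'"] finD UL VL strong) (assumption | rule fun_cong[OF sym])+
    moreover have "norm_L2 (\<lambda>z. \<Sum>a\<in>D. V \<mu> \<mu>' a a z) = norm_L2 (\<lambda>z. ?dc \<mu> z - ?dc \<mu>' z)"
      by (rule norm_L2_cong_AE[OF L2_measurable[OF L2_sum[OF VL]] L2_measurable[OF L2_diff[OF dL dL]] trace]) (use that in simp_all)
    ultimately have "(norm_L2 (\<lambda>z. V \<mu> \<nu> a b z - V \<mu>' \<nu> a b z))\<^sup>2 \<le> (norm_L2 (\<lambda>z. ?dc \<mu> z - ?dc \<mu>' z))\<^sup>2" by simp
    then show ?thesis by (rule power2_le_imp_le) (rule norm_L2_nonneg)
  qed
  note lim = conv_shell_kernel_tendsto[OF g]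
  have cg: "(\<lambda>z. shell_mass *\<^sub>R g z) \<in> L2" by (rule L2_scaleR[OF g])
  have ex: "\<exists>v\<in>L2. (\<lambda>n. norm_L2 (\<lambda>z. V (2 ^ n) \<nu> a b z - v z)) \<longlonglongrightarrow> 0" if ab: "a \<in> D" "b \<in> D" for a b
  proof -
    have C: "\<exists>N. \<forall>i\<ge>N. \<forall>j\<ge>N. norm_L2 (\<lambda>z. V (2 ^ i) \<nu> a b z - V (2 ^ j) \<nu> a b z) < e" if "e > 0" for e
    proof -
      from LIMSEQ_D[OF lim, of "e/2"] \<open>e > 0\<close> obtain N
        where N: "\<And>n. n \<ge> N \<Longrightarrow> norm_L2 (\<lambda>z. ?dc (2 ^ n) z - shell_mass *\<^sub>R g z) < e/2" by (auto simp: abs_norm_L2)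
      have "norm_L2 (\<lambda>z. V (2 ^ i) \<nu> a b z - V (2 ^ j) \<nu> a b z) < e" if "i \<ge> N" "j \<ge> N" for i j
      proof -
        have "norm_L2 (\<lambda>z. V (2 ^ i) \<nu> a b z - V (2 ^ j) \<nu> a b z) \<le> norm_L2 (\<lambda>z. ?dc (2 ^ i) z - ?dc (2 ^ j) z)"
          by (rule close[OF ab]) auto
        also have "\<dots> \<le> norm_L2 (\<lambda>z. ?dc (2 ^ i) z - shell_mass *\<^sub>R g z) + norm_L2 (\<lambda>z. shell_mass *\<^sub>R g z - ?dc (2 ^ j) z)"
          by (intro norm_L2_triangle_diff dL cg) auto
        also have "\<dots> < e"
          using N[OF that(1)] N[OF that(2)] norm_L2_diff_commute[of "\<lambda>z. shell_mass *\<^sub>R g z" "?dc (2 ^ j)"] by simp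
        finally show ?thesis .
      qed
      then show ?thesis by blast
    qed
    have Ln: "V (2 ^ n) \<nu> a b \<in> L2" for n by (rule VL[OF ab _ \<nu>]) simp
    obtain v where "v \<in> L2" "(\<lambda>n. norm_L2 (\<lambda>z. V (2 ^ n) \<nu> a b z - v z)) \<longlonglongrightarrow> 0"
      by (rule L2_complete[of "\<lambda>n. V (2 ^ n) \<nu> a b", OF Ln C])
    then show ?thesis by blast
  qed
  define v where "v a b = (SOME v. v \<in> L2 \<and> (\<lambda>n. norm_L2 (\<lambda>z. V (2 ^ n) \<nu> a b z - v z)) \<longlonglongrightarrow> 0)" for a b
  have "v a b \<in> L2 \<and> (\<lambda>n. norm_L2 (\<lambda>z. V (2 ^ n) \<nu> a b z - v a b z)) \<longlonglongrightarrow> 0" if "a \<in> D" "b \<in> D" for a b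
  proof -
    have "\<exists>v. v \<in> L2 \<and> (\<lambda>n. norm_L2 (\<lambda>z. V (2 ^ n) \<nu> a b z - v z)) \<longlonglongrightarrow> 0" using ex[OF that] by blast
    then show ?thesis unfolding v_def by (rule someI_ex)
  qed
  then have v: "\<And>a b. a \<in> D \<Longrightarrow> b \<in> D \<Longrightarrow> v a b \<in> L2"
    "\<And>a b. a \<in> D \<Longrightarrow> b \<in> D \<Longrightarrow> (\<lambda>n. norm_L2 (\<lambda>z. V (2 ^ n) \<nu> a b z - v a b z)) \<longlonglongrightarrow> 0"
    by blast+
  have VLn: "V (2 ^ n) \<nu> a b \<in> L2" if "a \<in> D" "b \<in> D" for n a b
    using that \<nu> by (intro VL) auto
  show thesis
  proof (rule that[OF v(1)])
    fix a b assume ab: "a \<in> D" "b \<in> D"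
    show "has_weak_deriv (conv ?P (grad_kernel D m \<nu> a) g) b (v a b)"
    proof (rule has_weak_deriv_L2_limit[OF _ _ VLn[OF ab] v(1)[OF ab] _ _ _ v(2)[OF ab]])
      show UL': "U (2 ^ n) \<nu> a \<in> L2" for n using ab \<nu> by (intro UL) auto
      show SL: "conv ?P (grad_kernel D m \<nu> a) g \<in> L2"
        by (intro conv_L2(2) proj_measurable grad_kernel_integral ab \<nu> g)
      show b: "b \<in> Basis" using ab D by auto
      show "has_weak_deriv (U (2 ^ n) \<nu> a) b (V (2 ^ n) \<nu> a b)" for n
        using ab \<nu> by (intro strong_deriv_imp_weak UL VL strong b) auto
      have le: "norm_L2 (\<lambda>z. U (2 ^ n) \<nu> a z - conv ?P (grad_kernel D m \<nu> a) g z) \<le> inverse (2 ^ n) * grad_mass a * norm_L2 g" for n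
      proof -
        have "AE z in lborel. conv ?P (\<lambda>w. grad_kernel D m \<nu> a w - ?k (2 ^ n) \<nu> a w) g z = conv ?P (grad_kernel D m \<nu> a) g z - U (2 ^ n) \<nu> a z"
          unfolding U_def using ab \<nu> by (intro conv_kernel_diff proj_measurable grad_kernel_integral radial_profile g) auto
        moreover have "(\<lambda>w. grad_kernel D m \<nu> a w - ?k (2 ^ n) \<nu> a w) = grad_kernel D m (2 ^ n) a"
          by (rule ext) (simp add: radial_profile_eq)
        ultimately have "AE z in lborel. conv ?P (grad_kernel D m \<nu> a) g z - U (2 ^ n) \<nu> a z = conv ?P (grad_kernel D m (2 ^ n) a) g z"
          by (auto elim!: eventually_mono)
        moreover have S2: "conv ?P (grad_kernel D m (2 ^ n) a) g \<in> L2"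
          by (intro conv_L2(2) proj_measurable grad_kernel_integral ab g) auto
        ultimately have "norm_L2 (\<lambda>z. conv ?P (grad_kernel D m \<nu> a) g z - U (2 ^ n) \<nu> a z) = norm_L2 (conv ?P (grad_kernel D m (2 ^ n) a) g)"
          by (intro norm_L2_cong_AE L2_measurable L2_diff UL' SL)
        also have "\<dots> \<le> (LINT w|lborel. \<bar>grad_kernel D m (2 ^ n) a w\<bar>) * norm_L2 g"
          by (intro conv_L2(3) proj_measurable grad_kernel_integral ab g) auto
        finally show ?thesis
          using grad_kernel_integral(2)[OF ab(1), of "2 ^ n"] norm_L2_diff_commute[of "U (2 ^ n) \<nu> a"] by simp
      qed
      have "(\<lambda>n. inverse (2 ^ n) * grad_mass a * norm_L2 g) \<longlonglongrightarrow> 0 * grad_mass a * norm_L2 g"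
        by (intro tendsto_intros LIMSEQ_inverse_realpow_zero) auto
      then have "(\<lambda>n. inverse (2 ^ n) * grad_mass a * norm_L2 g) \<longlonglongrightarrow> 0" by simp
      then show "(\<lambda>n. norm_L2 (\<lambda>z. U (2 ^ n) \<nu> a z - conv ?P (grad_kernel D m \<nu> a) g z)) \<longlonglongrightarrow> 0"
        by (rule tendsto_sandwich[OF _ _ tendsto_const, rotated 2]) (simp_all only: norm_L2_nonneg le eventually_True)
    qed
    show "AE z in lborel. v a b z = v b a z"
      using v(2)[OF ab(2,1)] unfolding sym[of _ _ b a]
      by (rule L2_limit_unique[OF VLn[OF ab] v(1)[OF ab] v(1)[OF ab(2,1)] v(2)[OF ab]])
  next
    have 1: "(\<lambda>n. norm_L2 (\<lambda>z. (\<Sum>a\<in>D. V (2 ^ n) \<nu> a a z) - (\<Sum>a\<in>D. v a a z))) \<longlonglongrightarrow> 0"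
      by (intro L2_limit_sum finD VLn v)
    have "norm_L2 (\<lambda>z. (\<Sum>a\<in>D. V (2 ^ n) \<nu> a a z) - (shell_mass *\<^sub>R g z - ?dc \<nu> z)) = norm_L2 (\<lambda>z. ?dc (2 ^ n) z - shell_mass *\<^sub>R g z)" for n
      using trace[of "2 ^ n" \<nu>] \<nu>
      by (intro norm_L2_cong_AE L2_measurable L2_diff L2_sum VLn dL cg) (auto elim!: eventually_mono)
    then have 2: "(\<lambda>n. norm_L2 (\<lambda>z. (\<Sum>a\<in>D. V (2 ^ n) \<nu> a a z) - (shell_mass *\<^sub>R g z - ?dc \<nu> z))) \<longlonglongrightarrow> 0"
      using lim by simp
    show "AE z in lborel. (\<Sum>a\<in>D. v a a z) = shell_mass *\<^sub>R g z - ?dc \<nu> z"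
      by (rule L2_limit_unique[OF _ _ _ 1 2]) (intro L2_sum L2_diff VLn v cg dL \<nu>; assumption)+
  qed
qed

text \<open>
  The kernels are those of \<open>singular_convolution_derivatives\<close>, cut off beyond \<open>R\<close> and divided by
  the mass of the approximate identity. The field is a gradient, which is why its derivatives \<open>v a b\<close> are
  symmetric.
\<close>

theorem divergence_solution:
  assumes R: "R > 0"
  obtains \<kappa> r where
    "\<And>a. a \<in> D \<Longrightarrow> integrable lborel (\<kappa> a)" "integrable lborel r"
    "\<And>w. norm (proj D w) \<le> R \<Longrightarrow> r w = 0"
    "\<And>g. g \<in> L2 \<Longrightarrow> \<exists>v. (\<forall>a\<in>D. \<forall>b\<in>D. v a b \<in> L2 \<and> has_weak_deriv (conv (proj D) (\<kappa> a) g) b (v a b)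
        \<and> (AE z in lborel. v a b z = v b a z)) \<and> (AE z in lborel. (\<Sum>a\<in>D. v a a z) = g z - conv (proj D) r g z)"
proof -
  let ?c = "inverse shell_mass"
  have c: "?c * shell_mass = 1" "shell_mass > 0" using shell_mass_pos by auto
  define \<nu> where "\<nu> = inverse R"
  have \<nu>: "\<nu> > 0" using R by (simp add: \<nu>_def)
  show thesis
  proof (rule that[of "\<lambda>a w. ?c * grad_kernel D m \<nu> a w" "\<lambda>w. ?c * shell_kernel D m \<nu> w"])
    show "a \<in> D \<Longrightarrow> integrable lborel (\<lambda>w. ?c * grad_kernel D m \<nu> a w)" for a
      using grad_kernel_integral(1)[OF _ \<nu>] by (intro integrable_mult_right)
    show "integrable lborel (\<lambda>w. ?c * shell_kernel D m \<nu> w)"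
      using shell_kernel_integral(1)[OF \<nu>] by (intro integrable_mult_right)
    show "?c * shell_kernel D m \<nu> w = 0" if "norm (proj D w) \<le> R" for w
    proof (rule ccontr)
      assume "?c * shell_kernel D m \<nu> w \<noteq> 0"
      then have "R\<^sup>2 < sq D w" using shell_kernel_support(1)[OF \<nu>, of w] by (auto simp: \<nu>_def power_inverse)
      moreover have "(norm (proj D w))\<^sup>2 \<le> R\<^sup>2" using that by (intro power_mono) auto
      ultimately show False by (simp add: norm_proj_sq[OF D])
    qed
    fix g :: "'a \<Rightarrow> complex" assume g: "g \<in> L2"
    obtain v where v: "\<And>a b. a \<in> D \<Longrightarrow> b \<in> D \<Longrightarrow> v a b \<in> L2"
      "\<And>a b. a \<in> D \<Longrightarrow> b \<in> D \<Longrightarrow> has_weak_deriv (conv (proj D) (grad_kernel D m \<nu> a) g) b (v a b)"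
      "\<And>a b. a \<in> D \<Longrightarrow> b \<in> D \<Longrightarrow> AE z in lborel. v a b z = v b a z"
      "AE z in lborel. (\<Sum>a\<in>D. v a a z) = shell_mass *\<^sub>R g z - conv (proj D) (shell_kernel D m \<nu>) g z"
      using singular_convolution_derivatives[OF g \<nu>] by blast
    let ?v = "\<lambda>a b z. complex_of_real ?c * v a b z"
    have conv: "conv (proj D) (\<lambda>w. ?c * \<kappa> w) g = (\<lambda>z. complex_of_real ?c * conv (proj D) \<kappa> g z)" for \<kappa>
      by (rule ext) (simp add: conv_kernel_cmult scaleR_conv_of_real)
    have "AE z in lborel. (\<Sum>a\<in>D. ?v a a z) = g z - conv (proj D) (\<lambda>w. ?c * shell_kernel D m \<nu> w) g z"
      using v(4)
    proof eventually_elim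
      case (elim z)
      have "(\<Sum>a\<in>D. ?v a a z) = complex_of_real ?c * (\<Sum>a\<in>D. v a a z)" by (simp add: sum_distrib_left)
      then show ?case
        unfolding elim conv using c by (simp add: algebra_simps scaleR_conv_of_real)
    qed
    moreover have "?v a b \<in> L2 \<and> has_weak_deriv (conv (proj D) (\<lambda>w. ?c * grad_kernel D m \<nu> a w) g) b (?v a b)
        \<and> (AE z in lborel. ?v a b z = ?v b a z)" if "a \<in> D" "b \<in> D" for a b
      unfolding conv using v(1-3)[OF that] by (auto intro!: L2_cmult has_weak_deriv_cmult elim!: eventually_mono)
    ultimately show "\<exists>v. (\<forall>a\<in>D. \<forall>b\<in>D. v a b \<in> L2 \<and> has_weak_deriv (conv (proj D) (\<lambda>w. ?c * grad_kernel D m \<nu> a w) g) b (v a b)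
        \<and> (AE z in lborel. v a b z = v b a z)) \<and> (AE z in lborel. (\<Sum>a\<in>D. v a a z) = g z - conv (proj D) (\<lambda>w. ?c * shell_kernel D m \<nu> w) g z)"
      by (intro exI[of _ ?v]) blast
  qed
qed

end

section \<open>The Cauchy-Riemann operators\<close>

text \<open>
  Membership in \<open>W1\<close> as far as the variable \<open>z\<^sub>j\<close> is concerned. The fields solving the
  equation in some of the variables have derivatives in those only.
\<close>

definition W1_in :: "'n::finite \<Rightarrow> (complex ^ 'n \<Rightarrow> complex) \<Rightarrow> bool" where
  "W1_in j u \<longleftrightarrow> u \<in> L2 \<and> (\<exists>p\<in>L2. has_weak_deriv u (axis j 1) p) \<and> (\<exists>q\<in>L2. has_weak_deriv u (axis j \<i>) q)"

lemma axis_Basis: "axis j 1 \<in> (Basis :: (complex ^ 'n) set)" "axis j \<i> \<in> (Basis :: (complex ^ 'n) set)"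
  by (auto simp: axis_in_Basis_iff Basis_complex_def)

lemma W1_iff_W1_in: "u \<in> W1 \<longleftrightarrow> (\<forall>j. W1_in j u)"
  unfolding W1_def W1_in_def Basis_vec_def Basis_complex_def by simp blast

lemma d_zbar_AE:
  assumes "p \<in> L2" "q \<in> L2" "has_weak_deriv u (axis j 1) p" "has_weak_deriv u (axis j \<i>) q"
  shows "AE z in lborel. d_zbar j u z = (p z + \<i> * q z) / 2"
  using weak_deriv_AE(2)[OF assms(1,3)] weak_deriv_AE(2)[OF assms(2,4)]
  by eventually_elim (simp add: d_zbar_def)

lemma W1_in_weak_deriv:
  assumes "W1_in j u"
  shows "u \<in> L2" "weak_deriv u (axis j 1) \<in> L2" "weak_deriv u (axis j \<i>) \<in> L2"
    "has_weak_deriv u (axis j 1) (weak_deriv u (axis j 1))" "has_weak_deriv u (axis j \<i>) (weak_deriv u (axis j \<i>))"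
proof -
  have *: "weak_deriv u b \<in> L2 \<and> has_weak_deriv u b (weak_deriv u b)" if "\<exists>p\<in>L2. has_weak_deriv u b p" for b
  proof -
    have "\<exists>p. p \<in> L2 \<and> has_weak_deriv u b p" using that by blast
    then show ?thesis unfolding weak_deriv_def by (rule someI_ex)
  qed
  show "u \<in> L2" "weak_deriv u (axis j 1) \<in> L2" "weak_deriv u (axis j \<i>) \<in> L2"
    "has_weak_deriv u (axis j 1) (weak_deriv u (axis j 1))" "has_weak_deriv u (axis j \<i>) (weak_deriv u (axis j \<i>))"
    using assms *[of "axis j 1"] *[of "axis j \<i>"] unfolding W1_in_def by blast+
qed

lemma d_zbar_eq: "d_zbar j u = (\<lambda>z. (weak_deriv u (axis j 1) z + \<i> * weak_deriv u (axis j \<i>) z) / 2)"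
  by (simp add: fun_eq_iff d_zbar_def)

lemma W1_in_d_zbar_L2: "W1_in j u \<Longrightarrow> d_zbar j u \<in> L2"
  unfolding d_zbar_eq by (intro L2_divide L2_add L2_cmult W1_in_weak_deriv(2,3))

lemma W1_inI:
  assumes "u \<in> L2" "p \<in> L2" "q \<in> L2" "has_weak_deriv u (axis j 1) p" "has_weak_deriv u (axis j \<i>) q"
  shows "W1_in j u"
  using assms unfolding W1_in_def by blast

lemma W1_in_cmult:
  assumes "W1_in j u"
  shows "W1_in j (\<lambda>z. c * u z)" "AE z in lborel. d_zbar j (\<lambda>z. c * u z) z = c * d_zbar j u z"
proof -
  note u = W1_in_weak_deriv[OF assms]
  note L = L2_cmult[OF u(2), of c] L2_cmult[OF u(3), of c]
  note w = has_weak_deriv_cmult[OF u(4), of c] has_weak_deriv_cmult[OF u(5), of c]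
  show "W1_in j (\<lambda>z. c * u z)" by (rule W1_inI[OF L2_cmult[OF u(1)] L w])
  show "AE z in lborel. d_zbar j (\<lambda>z. c * u z) z = c * d_zbar j u z"
    using d_zbar_AE[OF L w] by eventually_elim (simp add: d_zbar_eq algebra_simps)
qed

lemma W1_in_diff:
  assumes "W1_in j u" "W1_in j v"
  shows "W1_in j (\<lambda>z. u z - v z)" "AE z in lborel. d_zbar j (\<lambda>z. u z - v z) z = d_zbar j u z - d_zbar j v z"
proof -
  note u = W1_in_weak_deriv[OF assms(1)] and v = W1_in_weak_deriv[OF assms(2)]
  note L = L2_diff[OF u(2) v(2)] L2_diff[OF u(3) v(3)]
  note w = has_weak_deriv_diff[OF u(1) v(1) u(2) v(2) axis_Basis(1) u(4) v(4)]
    has_weak_deriv_diff[OF u(1) v(1) u(3) v(3) axis_Basis(2) u(5) v(5)]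
  show "W1_in j (\<lambda>z. u z - v z)" by (rule W1_inI[OF L2_diff[OF u(1) v(1)] L w])
  show "AE z in lborel. d_zbar j (\<lambda>z. u z - v z) z = d_zbar j u z - d_zbar j v z"
    using d_zbar_AE[OF L w] by eventually_elim (simp add: d_zbar_eq algebra_simps diff_divide_distrib add_divide_distrib)
qed

lemma W1_in_zero: "W1_in j (\<lambda>z. 0)" "AE z in lborel. d_zbar j (\<lambda>z. 0) z = 0"
  by (rule W1_inI[OF L2_zero L2_zero L2_zero has_weak_deriv_zero has_weak_deriv_zero])
    (use d_zbar_AE[OF L2_zero L2_zero has_weak_deriv_zero has_weak_deriv_zero, of j] in simp)

lemma W1_in_conv:
  assumes P: "P \<in> borel_measurable borel" and \<kappa>: "integrable lborel \<kappa>" and z: "W1_in j u"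
  shows "W1_in j (conv P \<kappa> u)" "AE z in lborel. d_zbar j (conv P \<kappa> u) z = conv P \<kappa> (d_zbar j u) z"
proof -
  note u = W1_in_weak_deriv[OF z]
  note L = conv_L2(2)[OF P \<kappa> u(2)] conv_L2(2)[OF P \<kappa> u(3)]
  note w = has_weak_deriv_conv[OF P \<kappa> u(1,2) axis_Basis(1) u(4)] has_weak_deriv_conv[OF P \<kappa> u(1,3) axis_Basis(2) u(5)]
  show "W1_in j (conv P \<kappa> u)" by (rule W1_inI[OF conv_L2(2)[OF P \<kappa> u(1)] L w])
  have e: "d_zbar j u = (\<lambda>z. (1/2) * (weak_deriv u (axis j 1) z + \<i> * weak_deriv u (axis j \<i>) z))"
    by (simp add: fun_eq_iff d_zbar_def)
  show "AE z in lborel. d_zbar j (conv P \<kappa> u) z = conv P \<kappa> (d_zbar j u) z"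
    using d_zbar_AE[OF L w] conv_add[OF P \<kappa> u(2) L2_cmult[OF u(3), of \<i>]]
    by eventually_elim (unfold e conv_cmult, simp only:, simp)
qed

subsection \<open>Convolution operators that invert them\<close>

text \<open>
  If \<open>u\<close> is the gradient produced by \<open>\<kappa>\<close>, this is
  \<open>2 (u\<^bsub>x\<^sub>j\<^esub> - i u\<^bsub>y\<^sub>j\<^esub>)\<close>.
\<close>

definition dbar_conv :: "(complex ^ 'n \<Rightarrow> complex ^ 'n) \<Rightarrow> (complex ^ 'n \<Rightarrow> complex ^ 'n \<Rightarrow> real) \<Rightarrow> 'n::finite \<Rightarrow>
    (complex ^ 'n \<Rightarrow> complex) \<Rightarrow> complex ^ 'n \<Rightarrow> complex" where
  "dbar_conv P \<kappa> j g z = 2 * (conv P (\<kappa> (axis j 1)) g z - \<i> * conv P (\<kappa> (axis j \<i>)) g z)"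

context
  fixes P :: "complex ^ 'n \<Rightarrow> complex ^ 'n::finite" and \<kappa> :: "complex ^ 'n \<Rightarrow> complex ^ 'n \<Rightarrow> real" and j :: 'n
  assumes P: "P \<in> borel_measurable borel"
    and \<kappa>: "integrable lborel (\<kappa> (axis j 1))" "integrable lborel (\<kappa> (axis j \<i>))"
begin

lemma dbar_conv_L2: "g \<in> L2 \<Longrightarrow> dbar_conv P \<kappa> j g \<in> L2"
  unfolding dbar_conv_def[abs_def] by (intro L2_intros conv_L2(2) P \<kappa>)

lemma dbar_conv_vanish_on:
  assumes "g \<in> L2" "AE z in lborel. z \<in> E \<longrightarrow> g z = 0" "\<And>z w. z \<in> A \<Longrightarrow> z - P w \<in> E"
  shows "AE z in lborel. z \<in> A \<longrightarrow> dbar_conv P \<kappa> j g z = 0"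
proof -
  have m: "\<kappa> (axis j 1) \<in> borel_measurable borel" "\<kappa> (axis j \<i>) \<in> borel_measurable borel" using \<kappa> by auto
  have "AE z in lborel. z \<in> A \<longrightarrow> conv P (\<kappa> (axis j 1)) g z = 0" "AE z in lborel. z \<in> A \<longrightarrow> conv P (\<kappa> (axis j \<i>)) g z = 0"
    by (rule conv_vanish_on[OF P m(1) L2_measurable[OF assms(1)] assms(2)], rule assms(3), assumption,
        rule conv_vanish_on[OF P m(2) L2_measurable[OF assms(1)] assms(2)], rule assms(3), assumption)
  then show ?thesis by eventually_elim (simp add: dbar_conv_def)
qed

lemma dbar_conv_diff:
  assumes "g \<in> L2" "h \<in> L2"
  shows "AE z in lborel. dbar_conv P \<kappa> j (\<lambda>x. g x - h x) z = dbar_conv P \<kappa> j g z - dbar_conv P \<kappa> j h z"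
  using conv_diff[OF P \<kappa>(1) assms] conv_diff[OF P \<kappa>(2) assms]
  by eventually_elim (simp add: dbar_conv_def right_diff_distrib)

lemma dbar_conv_sum:
  assumes "finite A" "\<And>i. i \<in> A \<Longrightarrow> g i \<in> L2"
  shows "AE z in lborel. dbar_conv P \<kappa> j (\<lambda>x. \<Sum>i\<in>A. g i x) z = (\<Sum>i\<in>A. dbar_conv P \<kappa> j (g i) z)"
proof -
  have "AE z in lborel. conv P (\<kappa> (axis j 1)) (\<lambda>x. \<Sum>i\<in>A. g i x) z = (\<Sum>i\<in>A. conv P (\<kappa> (axis j 1)) (g i) z)"
    "AE z in lborel. conv P (\<kappa> (axis j \<i>)) (\<lambda>x. \<Sum>i\<in>A. g i x) z = (\<Sum>i\<in>A. conv P (\<kappa> (axis j \<i>)) (g i) z)"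
    by (rule conv_sum[OF P \<kappa>(1) assms], assumption, rule conv_sum[OF P \<kappa>(2) assms], assumption)
  then show ?thesis
    by eventually_elim (simp add: dbar_conv_def sum_distrib_left sum_subtractf right_diff_distrib)
qed

lemma dbar_conv_cong_AE:
  assumes "g \<in> L2" "h \<in> L2" "AE z in lborel. g z = h z"
  shows "AE z in lborel. dbar_conv P \<kappa> j g z = dbar_conv P \<kappa> j h z"
proof -
  have m: "\<kappa> (axis j 1) \<in> borel_measurable borel" "\<kappa> (axis j \<i>) \<in> borel_measurable borel" using \<kappa> by auto
  show ?thesis
    using conv_cong_AE[OF P m(1) L2_measurable[OF assms(1)] L2_measurable[OF assms(2)] assms(3)]
      conv_cong_AE[OF P m(2) L2_measurable[OF assms(1)] L2_measurable[OF assms(2)] assms(3)]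
    by eventually_elim (simp add: dbar_conv_def)
qed

lemma W1_in_dbar_conv:
  assumes "W1_in l g"
  shows "W1_in l (dbar_conv P \<kappa> j g)" "AE z in lborel. d_zbar l (dbar_conv P \<kappa> j g) z = dbar_conv P \<kappa> j (d_zbar l g) z"
proof -
  note a = W1_in_conv[OF P \<kappa>(1) assms] and b = W1_in_conv[OF P \<kappa>(2) assms]
  note b' = W1_in_cmult[OF b(1), of \<i>]
  note d = W1_in_diff[OF a(1) b'(1)]
  note e = W1_in_cmult[OF d(1), of 2]
  have eq: "dbar_conv P \<kappa> j g = (\<lambda>z. 2 * (conv P (\<kappa> (axis j 1)) g z - \<i> * conv P (\<kappa> (axis j \<i>)) g z))"
    by (rule ext) (rule dbar_conv_def)
  show "W1_in l (dbar_conv P \<kappa> j g)" unfolding eq by (rule e(1))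
  show "AE z in lborel. d_zbar l (dbar_conv P \<kappa> j g) z = dbar_conv P \<kappa> j (d_zbar l g) z"
    unfolding eq using e(2) d(2) b'(2) a(2) b(2) by eventually_elim (simp add: dbar_conv_def)
qed

end

definition dirs :: "'n set \<Rightarrow> (complex ^ 'n::finite) set" where
  "dirs J = (\<lambda>j. axis j 1) ` J \<union> (\<lambda>j. axis j \<i>) ` J"

lemma dirs_Basis: "dirs J \<subseteq> Basis"
  by (auto simp: dirs_def axis_Basis)

lemma axis_1_neq_i: "axis j (1::complex) \<noteq> axis k \<i>"
  by (auto simp: axis_eq_axis)

lemma sum_dirs: "(\<Sum>b\<in>dirs J. f b) = (\<Sum>j\<in>J. f (axis j 1) + f (axis j \<i>))"
proof -
  have "(\<Sum>b\<in>dirs J. f b) = (\<Sum>b\<in>(\<lambda>j. axis j 1) ` J. f b) + (\<Sum>b\<in>(\<lambda>j. axis j \<i>) ` J. f b)"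
    unfolding dirs_def using axis_1_neq_i by (intro sum.union_disjoint) auto
  also have "\<dots> = (\<Sum>j\<in>J. f (axis j 1)) + (\<Sum>j\<in>J. f (axis j \<i>))"
    by (subst (1 2) sum.reindex) (auto simp: inj_on_def axis_eq_axis)
  finally show ?thesis by (simp add: sum.distrib)
qed

lemma card_dirs: "card (dirs J) = 2 * card J"
  using sum_dirs[of "\<lambda>_. 1::nat" J] by (simp add: mult.commute)

lemma proj_dirs_nth: "proj (dirs J) z $ k = (if k \<in> J then z $ k else 0)"
proof -
  have in1: "axis k (1::complex) \<in> dirs J \<longleftrightarrow> k \<in> J" "axis k \<i> \<in> dirs J \<longleftrightarrow> k \<in> J"
    using axis_1_neq_i by (auto simp: dirs_def axis_eq_axis image_iff)
  have "Re (proj (dirs J) z $ k) = (if k \<in> J then Re (z $ k) else 0)"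
    using proj_inner[OF dirs_Basis axis_Basis(1), of J z k] in1 by (simp add: inner_axis inner_complex_def split: if_splits)
  moreover have "Im (proj (dirs J) z $ k) = (if k \<in> J then Im (z $ k) else 0)"
    using proj_inner[OF dirs_Basis axis_Basis(2), of J z k] in1 by (simp add: inner_axis inner_complex_def split: if_splits)
  ultimately show ?thesis by (simp add: complex_eq_iff)
qed

text \<open>
  The derivative of \<open>2 (u\<^bsub>x\<^sub>j\<^esub> - i u\<^bsub>y\<^sub>j\<^esub>)\<close> by the conjugate of
  \<open>z\<^sub>j\<close> has the part of the divergence of \<open>u\<close> that belongs to \<open>z\<^sub>j\<close> as
  its real terms. The remaining ones cancel, because \<open>u\<close> is curl-free.
\<close>

lemma dbar_solution:
  fixes J :: "'n::finite set"
  assumes J: "J \<noteq> {}" and R: "R > 0"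
  obtains \<kappa> r where
    "\<And>j. j \<in> J \<Longrightarrow> integrable lborel (\<kappa> (axis j 1))" "\<And>j. j \<in> J \<Longrightarrow> integrable lborel (\<kappa> (axis j \<i>))"
    "integrable lborel r" "\<And>w. norm (proj (dirs J) w) \<le> R \<Longrightarrow> r w = 0"
    "\<And>g j l. g \<in> L2 \<Longrightarrow> j \<in> J \<Longrightarrow> l \<in> J \<Longrightarrow> W1_in l (dbar_conv (proj (dirs J)) \<kappa> j g)"
    "\<And>g. g \<in> L2 \<Longrightarrow> AE z in lborel. (\<Sum>j\<in>J. d_zbar j (dbar_conv (proj (dirs J)) \<kappa> j g) z) = g z - conv (proj (dirs J)) r g z"
proof -
  have "card J > 0" using J by (simp add: card_gt_0_iff)
  then interpret even_directions "dirs J" "card J"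
    by unfold_locales (auto simp: dirs_Basis card_dirs)
  obtain \<kappa> r where \<kappa>: "\<And>a. a \<in> dirs J \<Longrightarrow> integrable lborel (\<kappa> a)" "integrable lborel r"
    "\<And>w. norm (proj (dirs J) w) \<le> R \<Longrightarrow> r w = 0"
    "\<And>g. g \<in> L2 \<Longrightarrow> \<exists>v. (\<forall>a\<in>dirs J. \<forall>b\<in>dirs J. v a b \<in> L2 \<and> has_weak_deriv (conv (proj (dirs J)) (\<kappa> a) g) b (v a b)
        \<and> (AE z in lborel. v a b z = v b a z)) \<and> (AE z in lborel. (\<Sum>a\<in>dirs J. v a a z) = g z - conv (proj (dirs J)) r g z)"
    using divergence_solution[OF R] by blast
  let ?P = "proj (dirs J)"
  have ax: "axis j 1 \<in> dirs J" "axis j \<i> \<in> dirs J" if "j \<in> J" for j using that by (auto simp: dirs_def)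
  have main: "(\<forall>j\<in>J. \<forall>l\<in>J. W1_in l (dbar_conv ?P \<kappa> j g)) \<and>
      (AE z in lborel. (\<Sum>j\<in>J. d_zbar j (dbar_conv ?P \<kappa> j g) z) = g z - conv ?P r g z)" if g: "g \<in> L2" for g
  proof -
    obtain v where v: "\<And>a b. a \<in> dirs J \<Longrightarrow> b \<in> dirs J \<Longrightarrow> v a b \<in> L2"
      "\<And>a b. a \<in> dirs J \<Longrightarrow> b \<in> dirs J \<Longrightarrow> has_weak_deriv (conv ?P (\<kappa> a) g) b (v a b)"
      "\<And>a b. a \<in> dirs J \<Longrightarrow> b \<in> dirs J \<Longrightarrow> AE z in lborel. v a b z = v b a z"
      "AE z in lborel. (\<Sum>a\<in>dirs J. v a a z) = g z - conv ?P r g z"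
      using \<kappa>(4)[OF g] by blast
    have cL: "conv ?P (\<kappa> a) g \<in> L2" if "a \<in> dirs J" for a
      by (rule conv_L2(2)[OF proj_measurable \<kappa>(1)[OF that] g])
    let ?w = "\<lambda>j b z. 2 * (v (axis j 1) b z - \<i> * v (axis j \<i>) b z)"
    have wL: "?w j b \<in> L2" if "j \<in> J" "b \<in> dirs J" for j b
      by (intro L2_cmult L2_diff v ax that)
    have eq: "dbar_conv ?P \<kappa> j g = (\<lambda>z. 2 * (conv ?P (\<kappa> (axis j 1)) g z - \<i> * conv ?P (\<kappa> (axis j \<i>)) g z))" for j
      by (rule ext) (rule dbar_conv_def)
    have w: "has_weak_deriv (dbar_conv ?P \<kappa> j g) b (?w j b)" if "j \<in> J" "b \<in> dirs J" for j b
      unfolding eq using that dirs_Basis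
      by (intro has_weak_deriv_cmult has_weak_deriv_diff cL v ax L2_cmult) auto
    have zd: "W1_in l (dbar_conv ?P \<kappa> j g)" if "j \<in> J" "l \<in> J" for j l
      by (rule W1_inI[OF _ wL[OF that(1) ax(1)[OF that(2)]] wL[OF that(1) ax(2)[OF that(2)]] w[OF that(1) ax(1)[OF that(2)]] w[OF that(1) ax(2)[OF that(2)]]])
         (rule dbar_conv_L2[OF proj_measurable \<kappa>(1)[OF ax(1)[OF that(1)]] \<kappa>(1)[OF ax(2)[OF that(1)]] g])
    have d: "AE z in lborel. d_zbar j (dbar_conv ?P \<kappa> j g) z = v (axis j 1) (axis j 1) z + v (axis j \<i>) (axis j \<i>) z" if "j \<in> J" for j
      using d_zbar_AE[OF wL[OF that ax(1)[OF that]] wL[OF that ax(2)[OF that]] w[OF that ax(1)[OF that]] w[OF that ax(2)[OF that]]]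
        v(3)[OF ax[OF that]]
    proof eventually_elim
      case (elim z)
      show ?case unfolding elim(1) elim(2) by (simp add: algebra_simps)
    qed
    have "AE z in lborel. \<forall>j\<in>J. d_zbar j (dbar_conv ?P \<kappa> j g) z = v (axis j 1) (axis j 1) z + v (axis j \<i>) (axis j \<i>) z"
      by (rule AE_finite_allI) (auto intro: d)
    then have "AE z in lborel. (\<Sum>j\<in>J. d_zbar j (dbar_conv ?P \<kappa> j g) z) = g z - conv ?P r g z"
      using v(4) by eventually_elim (simp add: sum_dirs)
    then show ?thesis using zd by blast
  qed
  show thesis
    by (rule that[of \<kappa> r]) (use main \<kappa>(1)[OF ax(1)] \<kappa>(1)[OF ax(2)] \<kappa>(2,3) in blast)+
qed

lemma cutoff_deriv_eq_0:
  fixes x :: "'a::euclidean_space"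
  assumes "(\<exists>c\<in>Basis. \<bar>x \<bullet> c\<bar> > R + 1) \<or> (\<forall>c\<in>Basis. \<bar>x \<bullet> c\<bar> < R)"
  shows "frechet_derivative (cutoff Basis R) (at x) b = 0"
proof -
  have z: "frechet_derivative (cutoff Basis R) (at x) b = 0"
    if "open S" "x \<in> S" "\<And>y. y \<in> S \<Longrightarrow> t = cutoff Basis R y" for S :: "'a set" and t
  proof -
    have "(cutoff Basis R has_derivative (\<lambda>_. 0)) (at x)"
      by (rule has_derivative_transform_within_open[OF has_derivative_const[of t] that])
    then show ?thesis using fun_cong[OF frechet_derivative_at, of "cutoff Basis R" "\<lambda>_. 0" x b] by simp
  qed
  from assms show ?thesis
  proof
    assume "\<exists>c\<in>Basis. \<bar>x \<bullet> c\<bar> > R + 1"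
    then obtain c where c: "c \<in> Basis" "\<bar>x \<bullet> c\<bar> > R + 1" by auto
    have "open {y::'a. \<bar>y \<bullet> c\<bar> > R + 1}" by (intro open_Collect_less continuous_intros)
    then show ?thesis
      by (rule z[where t = 0]) (use c cutoff_eq_0[OF finite_Basis c(1)] in \<open>auto simp: less_imp_le\<close>)
  next
    assume *: "\<forall>c\<in>Basis. \<bar>x \<bullet> c\<bar> < R"
    have "open (\<Inter>c\<in>Basis. {y::'a. \<bar>y \<bullet> c\<bar> < R})"
      by (intro open_INT ballI open_Collect_less continuous_intros) auto
    then show ?thesis
    proof (rule z[where t = 1])
      show "1 = cutoff Basis R y" if "y \<in> (\<Inter>c\<in>Basis. {y. \<bar>y \<bullet> c\<bar> < R})" for y :: 'a
        by (rule cutoff_eq_1[symmetric]) (use that in \<open>auto intro: less_imp_le\<close>)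
    qed (use * in auto)
  qed
qed

lemma W1_in_cutoff:
  fixes u :: "complex ^ 'n::finite \<Rightarrow> complex" and R :: real
  assumes u: "W1_in j u"
  defines "\<eta> \<equiv> cutoff Basis R"
  shows "W1_in j (\<lambda>z. \<eta> z *\<^sub>R u z)"
    and "AE z in lborel. (\<exists>c\<in>Basis. \<bar>z \<bullet> c\<bar> > R + 1) \<longrightarrow> d_zbar j (\<lambda>z. \<eta> z *\<^sub>R u z) z = 0"
    and "AE z in lborel. (\<forall>c\<in>Basis. \<bar>z \<bullet> c\<bar> < R) \<longrightarrow> d_zbar j (\<lambda>z. \<eta> z *\<^sub>R u z) z = d_zbar j u z"
proof -
  note u = W1_in_weak_deriv[OF u]
  have test: "test_function \<eta>" unfolding \<eta>_def by (rule test_function_cutoff)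
  have Ck: "Ck k \<eta>" for k unfolding \<eta>_def by (intro Ck_cutoff finite_Basis)
  have \<eta>m: "\<eta> \<in> borel_measurable borel"
    by (rule borel_measurable_continuous_onI[OF test_function_continuous(1)[OF test]])
  have \<eta>L: "(\<lambda>z. \<eta> z *\<^sub>R v z) \<in> L2" if "v \<in> L2" for v
    by (rule L2_bounded_scaleR[OF that \<eta>m, of 1]) (simp add: \<eta>_def cutoff_nonneg cutoff_le_1)
  have DL: "(\<lambda>z. frechet_derivative \<eta> (at z) b *\<^sub>R v z) \<in> L2" if v: "v \<in> L2" and b: "b \<in> Basis" for v b
  proof -
    obtain M where "\<And>x b. norm x > M \<Longrightarrow> frechet_derivative \<eta> (at x) b = 0"
      using test_function_support[OF test] by metis
    then obtain B where "\<And>x. \<bar>frechet_derivative \<eta> (at x) b\<bar> \<le> B"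
      using continuous_bounded_of_support[OF test_function_continuous(2)[OF test b]] by metis
    then show ?thesis
      by (rule L2_bounded_scaleR[OF v borel_measurable_continuous_onI[OF test_function_continuous(2)[OF test b]]])
  qed
  let ?p = "\<lambda>b z. \<eta> z *\<^sub>R weak_deriv u b z + frechet_derivative \<eta> (at z) b *\<^sub>R u z"
  have L: "?p (axis j 1) \<in> L2" "?p (axis j \<i>) \<in> L2"
    by (intro L2_add \<eta>L DL u axis_Basis)+
  have w: "has_weak_deriv (\<lambda>z. \<eta> z *\<^sub>R u z) (axis j 1) (?p (axis j 1))"
    "has_weak_deriv (\<lambda>z. \<eta> z *\<^sub>R u z) (axis j \<i>) (?p (axis j \<i>))"
    by (intro has_weak_deriv_smooth_mult Ck \<eta>L DL u axis_Basis)+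
  show "W1_in j (\<lambda>z. \<eta> z *\<^sub>R u z)" by (rule W1_inI[OF \<eta>L[OF u(1)] L w])
  show "AE z in lborel. (\<exists>c\<in>Basis. \<bar>z \<bullet> c\<bar> > R + 1) \<longrightarrow> d_zbar j (\<lambda>z. \<eta> z *\<^sub>R u z) z = 0"
    using d_zbar_AE[OF L w]
  proof eventually_elim
    case (elim z)
    show ?case
    proof
      assume *: "\<exists>c\<in>Basis. \<bar>z \<bullet> c\<bar> > R + 1"
      then have "\<eta> z = 0" unfolding \<eta>_def using cutoff_eq_0[OF finite_Basis] less_imp_le by metis
      moreover have "frechet_derivative \<eta> (at z) b = 0" for b unfolding \<eta>_def using * by (intro cutoff_deriv_eq_0) blast
      ultimately show "d_zbar j (\<lambda>z. \<eta> z *\<^sub>R u z) z = 0" using elim by simp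
    qed
  qed
  show "AE z in lborel. (\<forall>c\<in>Basis. \<bar>z \<bullet> c\<bar> < R) \<longrightarrow> d_zbar j (\<lambda>z. \<eta> z *\<^sub>R u z) z = d_zbar j u z"
    using d_zbar_AE[OF L w]
  proof eventually_elim
    case (elim z)
    show ?case
    proof
      assume *: "\<forall>c\<in>Basis. \<bar>z \<bullet> c\<bar> < R"
      then have "\<eta> z = 1" unfolding \<eta>_def by (intro cutoff_eq_1) (auto intro: less_imp_le)
      moreover have "frechet_derivative \<eta> (at z) b = 0" for b unfolding \<eta>_def using * by (intro cutoff_deriv_eq_0) blast
      ultimately show "d_zbar j (\<lambda>z. \<eta> z *\<^sub>R u z) z = d_zbar j u z" using elim by (simp add: d_zbar_eq)
    qed
  qed
qed

section \<open>Products of planar sets\<close>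

lemma proj_dirs_sub: "proj (dirs J) (z - w) = proj (dirs J) z - proj (dirs J) w"
  by (simp add: vec_eq_iff proj_dirs_nth)

lemma proj_dirs_idem: "proj (dirs J) (proj (dirs J) z) = proj (dirs J) z"
  by (simp add: vec_eq_iff proj_dirs_nth)

lemma proj_dirs_disjoint: "J \<inter> L = {} \<Longrightarrow> proj (dirs J) (proj (dirs L) z) = 0"
  by (auto simp: vec_eq_iff proj_dirs_nth)

lemma norm_proj_dirs_le: "norm (proj (dirs J) z) \<le> norm z"
  unfolding norm_vec_def by (intro L2_set_mono) (auto simp: proj_dirs_nth)

lemma norm_le_coordinate_sum:
  fixes z :: "'a::euclidean_space"
  assumes "D \<subseteq> Basis" "\<And>b. b \<in> D \<Longrightarrow> \<bar>z \<bullet> b\<bar> \<le> R"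
  shows "norm (proj D z) \<le> real (card D) * R"
proof -
  have "norm (proj D z) \<le> (\<Sum>b\<in>D. norm ((z \<bullet> b) *\<^sub>R b))"
    unfolding proj_def by (rule norm_sum)
  also have "\<dots> \<le> real (card D) * R"
    using assms by (intro sum_bounded_above) (auto simp: subset_iff)
  finally show ?thesis .
qed

text \<open>
  The radius \<open>2 (R + 3)\<close> leaves room for both transitions: the cutoff is \<open>1\<close> on the box of
  half-width \<open>R + 1\<close> and vanishes outside the one of half-width \<open>R + 2\<close>, and a point whose
  coordinate \<open>z\<^sub>a\<close> is in that box has \<open>|z\<^sub>a| \<le> 2 (R + 2)\<close>.
\<close>

lemma W1_in_cutoff_family:
  fixes F :: "'n::finite \<Rightarrow> complex ^ 'n \<Rightarrow> complex" and a :: 'n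
  assumes F: "\<And>j. F j \<in> W1" and R: "R \<ge> 0"
  obtains G where "\<And>j. G j \<in> W1"
    "\<And>j z. norm z \<le> R \<Longrightarrow> G j z = F j z"
    "\<And>j. AE z in lborel. norm z \<le> R \<longrightarrow> d_zbar j (G j) z = d_zbar j (F j) z"
    "\<And>j z. norm (proj (dirs {a}) z) > 2 * (R + 3) \<Longrightarrow> G j z = 0"
    "\<And>j. AE z in lborel. norm (proj (dirs {a}) z) > 2 * (R + 3) \<longrightarrow> d_zbar j (G j) z = 0"
proof -
  define G where "G j z = cutoff Basis (R + 1) z *\<^sub>R F j z" for j z
  have Geq: "G j = (\<lambda>z. cutoff Basis (R + 1) z *\<^sub>R F j z)" for j by (simp add: G_def fun_eq_iff)
  have zF: "W1_in l (F j)" for l j using F[of j] unfolding W1_iff_W1_in by blast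
  have near: "\<bar>z \<bullet> c\<bar> < R + 1" if "norm z \<le> R" "c \<in> Basis" for z c :: "complex ^ 'n"
    using Basis_le_norm[OF that(2), of z] that(1) by linarith
  have far: "\<exists>c\<in>Basis. \<bar>z \<bullet> c\<bar> > (R + 1) + 1" if "norm (proj (dirs {a}) z) > 2 * (R + 3)" for z :: "complex ^ 'n"
  proof (rule ccontr)
    assume "\<not> ?thesis"
    then have "\<bar>z \<bullet> c\<bar> \<le> R + 2" if "c \<in> dirs {a}" for c using that dirs_Basis by force
    then have "norm (proj (dirs {a}) z) \<le> real (card (dirs {a})) * (R + 2)" by (intro norm_le_coordinate_sum dirs_Basis)
    then show False using that by (simp add: card_dirs)
  qed
  show thesis
  proof (rule that[of G])
    show "G j \<in> W1" for j unfolding W1_iff_W1_in Geq by (intro allI W1_in_cutoff(1) zF)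
    show "G j z = F j z" if "norm z \<le> R" for j z
      unfolding G_def using cutoff_eq_1[of Basis z "R + 1"] near[OF that] by (simp add: less_imp_le)
    show "AE z in lborel. norm z \<le> R \<longrightarrow> d_zbar j (G j) z = d_zbar j (F j) z" for j
      using W1_in_cutoff(3)[OF zF[of j j], of "R + 1"] unfolding Geq by eventually_elim (use near in blast)
    show "G j z = 0" if z: "norm (proj (dirs {a}) z) > 2 * (R + 3)" for j z
    proof -
      obtain c where "c \<in> Basis" "\<bar>z \<bullet> c\<bar> > (R + 1) + 1" using far[OF z] by blast
      then have "cutoff Basis (R + 1) z = 0" by (intro cutoff_eq_0[OF finite_Basis]) auto
      then show ?thesis by (simp add: G_def)
    qed
    show "AE z in lborel. norm (proj (dirs {a}) z) > 2 * (R + 3) \<longrightarrow> d_zbar j (G j) z = 0" for j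
      using W1_in_cutoff(2)[OF zF[of j j], of "R + 1"] unfolding Geq by eventually_elim (use far in blast)
  qed
qed

text \<open>
  Here \<open>?P\<close> projects onto the coordinate \<open>z\<^sub>a\<close> and \<open>?Q\<close> onto the others. The
  operator \<open>T\<close> of the introduction is convolution with \<open>\<kappa>\<close> along \<open>?P\<close>, with
  error kernel \<open>r\<close>, and \<open>S\<close> is convolution with \<open>\<theta>\<close> along \<open>?Q\<close>,
  with error kernel \<open>s\<close>. The error kernels vanish up to the radii \<open>R + R1\<close> and
  \<open>R + R\<close>, so that from the points of \<open>KK\<close>, which have norm at most \<open>R\<close>, they reach
  only points outside the supports of the functions to which they are applied.
\<close>

theorem divergence_free_on_product:
  fixes K :: "'n::finite \<Rightarrow> complex set" and F :: "'n \<Rightarrow> complex ^ 'n \<Rightarrow> complex" and a :: 'n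
  defines "KK \<equiv> {z :: complex ^ 'n. \<forall>j. z $ j \<in> K j}"
  assumes card: "CARD('n) \<ge> 2" and K: "closed (K a)" and bdd: "bounded KK" and F: "\<And>j. F j \<in> W1"
    and div: "AE z in lborel. z \<in> KK \<longrightarrow> (\<Sum>j\<in>UNIV. d_zbar j (F j) z) = 0"
  obtains Y where "\<And>l. l \<noteq> a \<Longrightarrow> Y l \<in> W1"
    "\<And>l. l \<noteq> a \<Longrightarrow> AE z in lborel. z \<in> KK \<longrightarrow> d_zbar a (Y l) z = F l z"
    "AE z in lborel. z \<in> KK \<longrightarrow> - (\<Sum>l\<in>UNIV - {a}. d_zbar l (Y l) z) = F a z"
proof -
  obtain R where R: "R > 0" "\<And>z. z \<in> KK \<Longrightarrow> norm z \<le> R"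
    using bdd by (auto simp: bounded_pos)
  let ?A = "- {a}"
  let ?P = "proj (dirs {a})" and ?Q = "proj (dirs ?A)"
  define R1 where "R1 = 2 * (R + 3)"
  obtain G where G: "\<And>j. G j \<in> W1" "\<And>j z. norm z \<le> R \<Longrightarrow> G j z = F j z"
    "\<And>j. AE z in lborel. norm z \<le> R \<longrightarrow> d_zbar j (G j) z = d_zbar j (F j) z"
    "\<And>j z. norm (?P z) > R1 \<Longrightarrow> G j z = 0"
    "\<And>j. AE z in lborel. norm (?P z) > R1 \<longrightarrow> d_zbar j (G j) z = 0"
    using W1_in_cutoff_family[of F R a, OF F less_imp_le[OF R(1)]] unfolding R1_def by blast
  have zG: "W1_in l (G j)" for l j using G(1)[of j] unfolding W1_iff_W1_in by blast
  have GL: "G j \<in> L2" for j by (rule W1_in_weak_deriv(1)[OF zG])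
  have neA: "?A \<noteq> {}"
  proof
    assume "?A = {}"
    then have "UNIV = {a}" by auto
    then show False using card by (metis card.empty card_insert_disjoint empty_iff finite.emptyI not_less_eq_eq numeral_2_eq_2 order_refl)
  qed
  have "R + R1 > 0" "R + R > 0" using R(1) by (auto simp: R1_def)
  obtain \<kappa> r where \<kappa>: "\<And>j. j \<in> {a} \<Longrightarrow> integrable lborel (\<kappa> (axis j 1))" "\<And>j. j \<in> {a} \<Longrightarrow> integrable lborel (\<kappa> (axis j \<i>))"
    and r: "integrable lborel r" "\<And>w. norm (?P w) \<le> R + R1 \<Longrightarrow> r w = 0"
    and T: "\<And>g j l. g \<in> L2 \<Longrightarrow> j \<in> {a} \<Longrightarrow> l \<in> {a} \<Longrightarrow> W1_in l (dbar_conv ?P \<kappa> j g)"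
    "\<And>g. g \<in> L2 \<Longrightarrow> AE z in lborel. (\<Sum>j\<in>{a}. d_zbar j (dbar_conv ?P \<kappa> j g) z) = g z - conv ?P r g z"
    using dbar_solution[of "{a}", OF insert_not_empty \<open>R + R1 > 0\<close>] by blast
  obtain \<theta> s where \<theta>: "\<And>j. j \<in> ?A \<Longrightarrow> integrable lborel (\<theta> (axis j 1))" "\<And>j. j \<in> ?A \<Longrightarrow> integrable lborel (\<theta> (axis j \<i>))"
    and s: "integrable lborel s" "\<And>w. norm (?Q w) \<le> R + R \<Longrightarrow> s w = 0"
    and S: "\<And>g j l. g \<in> L2 \<Longrightarrow> j \<in> ?A \<Longrightarrow> l \<in> ?A \<Longrightarrow> W1_in l (dbar_conv ?Q \<theta> j g)"
    "\<And>g. g \<in> L2 \<Longrightarrow> AE z in lborel. (\<Sum>j\<in>?A. d_zbar j (dbar_conv ?Q \<theta> j g) z) = g z - conv ?Q s g z"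
    using dbar_solution[of ?A, OF neA \<open>R + R > 0\<close>] by blast
  note \<kappa>' = \<kappa>(1)[OF singletonI] \<kappa>(2)[OF singletonI]
  note T1 = T(1)[OF _ singletonI singletonI]
  have T2: "AE z in lborel. d_zbar a (dbar_conv ?P \<kappa> a g) z = g z - conv ?P r g z" if "g \<in> L2" for g
    using T(2)[OF that] by simp
  have P1: "?P (z - ?Q w) = ?P z" "?Q (z - ?P w) = ?Q z" for z w
    by (simp_all add: proj_dirs_sub proj_dirs_disjoint)
  have Pa: "(z - ?Q w) $ a = z $ a" and Pl: "l \<noteq> a \<Longrightarrow> (z - ?P w) $ l = z $ l" for z w l
    by (simp_all add: proj_dirs_nth)
  have PP: "?P (z - ?P w) = ?P z - ?P w" "?Q (z - ?Q w) = ?Q z - ?Q w" for z w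
    by (simp_all add: proj_dirs_sub proj_dirs_idem)

  define g where "g z = (\<Sum>j\<in>UNIV. d_zbar j (G j) z)" for z
  have gL: "g \<in> L2" unfolding g_def[abs_def] by (intro L2_sum W1_in_d_zbar_L2 zG)
  have gK: "AE z in lborel. z \<in> KK \<longrightarrow> g z = 0"
  proof -
    have "AE z in lborel. \<forall>j\<in>UNIV. norm z \<le> R \<longrightarrow> d_zbar j (G j) z = d_zbar j (F j) z"
      by (rule AE_finite_allI) (auto intro: G(3))
    then show ?thesis using div by eventually_elim (use R(2) in \<open>auto simp: g_def\<close>)
  qed
  have gfar: "AE z in lborel. norm (?P z) > R1 \<longrightarrow> g z = 0"
  proof -
    have "AE z in lborel. \<forall>j\<in>UNIV. norm (?P z) > R1 \<longrightarrow> d_zbar j (G j) z = 0"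
      by (rule AE_finite_allI) (auto intro: G(5))
    then show ?thesis by eventually_elim (auto simp: g_def)
  qed
  \<comment> \<open>The restriction to bounded \<open>?Q z\<close> keeps the error term of the operator along \<open>?Q z\<close> away from
    \<open>KK\<close>; on the product set nothing is lost, since \<open>?Q z\<close> is bounded there.\<close>
  define B where "B = {z :: complex ^ 'n. z $ a \<notin> K a \<and> norm (?Q z) \<le> R}"
  have B: "B \<in> sets borel"
  proof -
    have "open {z :: complex ^ 'n. z $ a \<in> - K a}"
      using K by (intro open_vimage_vec_nth[unfolded vimage_def]) auto
    moreover have "B = {z. z $ a \<in> - K a} \<inter> {z \<in> space borel. norm (?Q z) \<le> R}" by (auto simp: B_def)
    ultimately show ?thesis by simp
  qed
  define g1 where "g1 z = indicator B z *\<^sub>R g z" for z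
  have g1L: "g1 \<in> L2"
    unfolding g1_def[abs_def] by (rule L2_bounded_scaleR[OF gL, where c = 1]) (use B in \<open>auto simp: indicator_def\<close>)
  define h where "h l = dbar_conv ?Q \<theta> l g1" for l
  have hL: "h l \<in> L2" if "l \<noteq> a" for l
    unfolding h_def using that by (intro dbar_conv_L2 proj_measurable \<theta> g1L) auto
  have hz: "W1_in j (h l)" if "l \<noteq> a" "j \<noteq> a" for l j
    unfolding h_def using that by (intro S(1) g1L) auto
  have hK: "AE z in lborel. z \<in> {z. z $ a \<in> K a} \<longrightarrow> h l z = 0" if "l \<noteq> a" for l
    unfolding h_def
  proof (rule dbar_conv_vanish_on[OF proj_measurable _ _ g1L])
    show "AE z in lborel. z \<in> {z. z $ a \<in> K a} \<longrightarrow> g1 z = 0" by (auto simp: g1_def B_def)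
  qed (use that \<theta> Pa in auto)
  have hfar: "AE z in lborel. z \<in> {z. norm (?P z) > R1} \<longrightarrow> h l z = 0" if "l \<noteq> a" for l
    unfolding h_def
  proof (rule dbar_conv_vanish_on[OF proj_measurable _ _ g1L])
    show "AE z in lborel. z \<in> {z. norm (?P z) > R1} \<longrightarrow> g1 z = 0"
      using gfar by eventually_elim (simp add: g1_def)
  qed (use that \<theta> P1 in auto)
  define X where "X l z = G l z - h l z" for l z
  have XL: "X l \<in> L2" if "l \<noteq> a" for l unfolding X_def[abs_def] by (intro L2_diff GL hL that)
  have Xz: "W1_in j (X l)" "AE z in lborel. d_zbar j (X l) z = d_zbar j (G l) z - d_zbar j (h l) z"
    if "l \<noteq> a" "j \<noteq> a" for l j
    unfolding X_def[abs_def] by (rule W1_in_diff[OF zG hz[OF that]])+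
  define Y where "Y l = dbar_conv ?P \<kappa> a (X l)" for l
  have YW: "Y l \<in> W1" if "l \<noteq> a" for l
    unfolding W1_iff_W1_in
  proof
    fix j show "W1_in j (Y l)"
    proof (cases "j = a")
      case True
      show ?thesis unfolding Y_def True by (rule T1[OF XL[OF that]])
    next
      case False
      show ?thesis unfolding Y_def by (rule W1_in_dbar_conv(1)[OF proj_measurable \<kappa>' Xz(1)[OF that False]])
    qed
  qed
  have nearP: "norm (?P z) \<le> R" "norm (?Q z) \<le> R" if "z \<in> KK" for z
    using order_trans[OF norm_proj_dirs_le R(2)[OF that]] by auto
  have rvanish: "AE z in lborel. z \<in> KK \<longrightarrow> conv ?P r g' z = 0"
    if "g' \<in> L2" "AE z in lborel. z \<in> {z. norm (?P z) > R1} \<longrightarrow> g' z = 0" for g'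
  proof (rule conv_vanish_on[OF proj_measurable _ L2_measurable[OF that(1)] that(2)])
    show "r \<in> borel_measurable borel" using r(1) by auto
    fix z w assume z: "z \<in> KK" and "r w \<noteq> 0"
    then have "norm (?P w) > R + R1" using r(2)[of w] by force
    moreover have "norm (?P w) \<le> norm (?P z) + norm (?P z - ?P w)"
      using norm_triangle_ineq4[of "?P z" "?P z - ?P w"] by simp
    ultimately show "z - ?P w \<in> {z. norm (?P z) > R1}" using nearP(1)[OF z] by (simp add: PP)
  qed
  have 1: "AE z in lborel. z \<in> KK \<longrightarrow> d_zbar a (Y l) z = F l z" if l: "l \<noteq> a" for l
  proof -
    have "AE z in lborel. z \<in> {z. norm (?P z) > R1} \<longrightarrow> X l z = 0"
      using hfar[OF l] by eventually_elim (simp add: X_def G(4))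
    from rvanish[OF XL[OF l] this] show ?thesis
      using T2[OF XL[OF l]] hK[OF l]
    proof eventually_elim
      case (elim z)
      show ?case
      proof
        assume z: "z \<in> KK"
        then have "h l z = 0" using elim(3) by (auto simp: KK_def)
        then have "X l z = F l z" using G(2)[OF R(2)[OF z]] by (simp add: X_def)
        then show "d_zbar a (Y l) z = F l z" using elim(1,2) z by (simp add: Y_def)
      qed
    qed
  qed
  \<comment> \<open>The divergence of \<open>X\<close> without its component \<open>a\<close> is \<open>q\<close> minus the derivative of
    \<open>G a\<close>.\<close>
  define q where "q z = (g z - g1 z) + conv ?Q s g1 z" for z
  have cL: "conv ?Q s g1 \<in> L2" by (rule conv_L2(2)[OF proj_measurable s(1) g1L])
  have qL: "q \<in> L2" unfolding q_def[abs_def] by (intro L2_add L2_diff gL g1L cL)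
  \<comment> \<open>The points reached from \<open>KK\<close> when the coordinate \<open>z $ a\<close> is moved freely.\<close>
  define E where "E = {z :: complex ^ 'n. (\<forall>l. l \<noteq> a \<longrightarrow> z $ l \<in> K l) \<and> norm (?Q z) \<le> R}"
  have svanish: "AE z in lborel. z \<in> E \<longrightarrow> conv ?Q s g1 z = 0"
  proof (rule conv_vanish_on[OF proj_measurable _ L2_measurable[OF g1L], where E = "{z. norm (?Q z) > R}"])
    show "s \<in> borel_measurable borel" using s(1) by auto
    show "AE z in lborel. z \<in> {z. norm (?Q z) > R} \<longrightarrow> g1 z = 0" by (auto simp: g1_def B_def)
    fix z w assume z: "z \<in> E" and "s w \<noteq> 0"
    then have "norm (?Q w) > R + R" using s(2)[of w] by force
    moreover have "norm (?Q w) \<le> norm (?Q z) + norm (?Q z - ?Q w)"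
      using norm_triangle_ineq4[of "?Q z" "?Q z - ?Q w"] by simp
    ultimately show "z - ?Q w \<in> {z. norm (?Q z) > R}" using z by (simp add: PP E_def)
  qed
  have qE: "AE z in lborel. z \<in> E \<longrightarrow> q z = 0"
    using svanish gK
  proof eventually_elim
    case (elim z)
    show ?case
    proof
      assume z: "z \<in> E"
      have "g z - g1 z = 0"
      proof (cases "z $ a \<in> K a")
        case True
        then have "z \<in> KK" using z by (auto simp: E_def KK_def)
        then show ?thesis using elim(2) True by (simp add: g1_def B_def)
      next
        case False
        then show ?thesis using z by (simp add: g1_def B_def E_def)
      qed
      then show "q z = 0" using elim(1) z by (simp add: q_def)
    qed
  qed
  have Tq: "AE z in lborel. z \<in> KK \<longrightarrow> dbar_conv ?P \<kappa> a q z = 0"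
  proof (rule dbar_conv_vanish_on[OF proj_measurable \<kappa>' qL qE])
    fix z w assume z: "z \<in> KK"
    then show "z - ?P w \<in> E" using nearP(2)[OF z] Pl by (auto simp: E_def P1 KK_def simp del: vector_minus_component)
  qed
  have 2: "AE z in lborel. z \<in> KK \<longrightarrow> - (\<Sum>l\<in>UNIV - {a}. d_zbar l (Y l) z) = F a z"
  proof -
    have dL: "d_zbar l (X l) \<in> L2" if "l \<in> ?A" for l using that by (intro W1_in_d_zbar_L2 Xz) auto
    have sumX: "AE z in lborel. (\<Sum>l\<in>?A. d_zbar l (X l) z) = q z - d_zbar a (G a) z"
    proof -
      have "AE z in lborel. \<forall>l\<in>?A. d_zbar l (X l) z = d_zbar l (G l) z - d_zbar l (h l) z"
        by (rule AE_finite_allI) (auto intro: Xz)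
      then show ?thesis
        using S(2)[OF g1L]
      proof eventually_elim
        case (elim z)
        have "g z = d_zbar a (G a) z + (\<Sum>l\<in>?A. d_zbar l (G l) z)"
          unfolding g_def by (subst sum.remove[of UNIV a]) (auto simp: Compl_eq_Diff_UNIV)
        moreover have "(\<Sum>l\<in>?A. d_zbar l (X l) z) = (\<Sum>l\<in>?A. d_zbar l (G l) z) - (\<Sum>l\<in>?A. d_zbar l (h l) z)"
          using elim(1) by (simp add: sum_subtractf)
        moreover have "(\<Sum>l\<in>?A. d_zbar l (h l) z) = g1 z - conv ?Q s g1 z"
          using elim(2) by (simp add: h_def)
        ultimately show ?case by (simp add: q_def)
      qed
    qed
    have dY: "AE z in lborel. \<forall>l\<in>?A. d_zbar l (Y l) z = dbar_conv ?P \<kappa> a (d_zbar l (X l)) z"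
      unfolding Y_def by (rule AE_finite_allI) (auto intro!: W1_in_dbar_conv(2)[OF proj_measurable \<kappa>' Xz(1)])
    have c1: "AE z in lborel. dbar_conv ?P \<kappa> a (\<lambda>z. \<Sum>l\<in>?A. d_zbar l (X l) z) z = (\<Sum>l\<in>?A. dbar_conv ?P \<kappa> a (d_zbar l (X l)) z)"
      by (rule dbar_conv_sum[OF proj_measurable \<kappa>']) (auto intro: dL)
    have c2: "AE z in lborel. dbar_conv ?P \<kappa> a (\<lambda>z. \<Sum>l\<in>?A. d_zbar l (X l) z) z = dbar_conv ?P \<kappa> a (\<lambda>z. q z - d_zbar a (G a) z) z"
      by (rule dbar_conv_cong_AE[OF proj_measurable \<kappa>' _ _ sumX]) (intro L2_sum dL L2_diff qL W1_in_d_zbar_L2 zG; assumption)+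
    have c3: "AE z in lborel. dbar_conv ?P \<kappa> a (\<lambda>z. q z - d_zbar a (G a) z) z = dbar_conv ?P \<kappa> a q z - dbar_conv ?P \<kappa> a (d_zbar a (G a)) z"
      by (rule dbar_conv_diff[OF proj_measurable \<kappa>' qL W1_in_d_zbar_L2[OF zG]])
    have c4: "AE z in lborel. d_zbar a (dbar_conv ?P \<kappa> a (G a)) z = dbar_conv ?P \<kappa> a (d_zbar a (G a)) z"
      by (rule W1_in_dbar_conv(2)[OF proj_measurable \<kappa>' zG])
    have rG: "AE z in lborel. z \<in> KK \<longrightarrow> conv ?P r (G a) z = 0"
      by (rule rvanish[OF GL]) (simp add: G(4))
    show ?thesis
      using dY c1 c2 c3 c4 rG T2[OF GL[of a]] Tq
    proof eventually_elim
      case (elim z)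
      show ?case
      proof
        assume z: "z \<in> KK"
        have "(\<Sum>l\<in>UNIV - {a}. d_zbar l (Y l) z) = (\<Sum>l\<in>?A. dbar_conv ?P \<kappa> a (d_zbar l (X l)) z)"
          using elim(1) by (intro sum.cong) auto
        also have "\<dots> = dbar_conv ?P \<kappa> a q z - dbar_conv ?P \<kappa> a (d_zbar a (G a)) z"
          using elim(2,3,4) by simp
        also have "\<dots> = - G a z" using elim(5,6,7,8) z by simp
        finally show "- (\<Sum>l\<in>UNIV - {a}. d_zbar l (Y l) z) = F a z" using G(2)[OF R(2)[OF z]] by simp
      qed
    qed
  qed
  show thesis by (rule that[of Y, OF YW 1 2])
qed

text \<open>
  For the least index \<open>a\<close> no sign arises from moving the differential of index \<open>a\<close> past others,
  and \<open>\<epsilon> j\<close> is the sign in the definition of \<open>dbar\<close> on \<open>(0,n-1)\<close>-forms.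
  The matrix of \<open>divergence_free_on_product\<close> becomes the form whose coefficient omitting the indices
  \<open>a\<close> and \<open>l\<close> is \<open>\<epsilon> l\<close> times \<open>Y l\<close>.
\<close>

theorem proposition6p2:
  fixes K :: "'n::{finite,linorder} \<Rightarrow> complex set"
  assumes "CARD('n) \<ge> 2"
    and "\<And>j. compact (K j)"
    and "regular_compact {z :: (complex, 'n) vec. \<forall>j. z $ j \<in> K j}"
  shows "H_W1_vanishes 0 (CARD('n) - 1) {z :: (complex, 'n) vec. \<forall>j. z $ j \<in> K j}"
  unfolding H_W1_vanishes_def
proof (intro allI impI, elim conjE)
  let ?K = "{z :: (complex, 'n) vec. \<forall>j. z $ j \<in> K j}"
  fix f :: "'n form"
  assume W: "W1_form 0 (CARD('n) - 1) f" and closed: "form_eq_on ?K 0 (CARD('n) - 1 + 1) (dbar f) (\<lambda>I J z. 0)"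
  define a :: 'n where "a = Min UNIV"
  have a_min: "a \<le> j" for j unfolding a_def by (rule Min_le) auto
  define \<epsilon> :: "'n \<Rightarrow> complex" where "\<epsilon> j = (-1) ^ card {i. i < j}" for j
  have \<epsilon>2: "\<epsilon> j * \<epsilon> j = 1" for j by (simp add: \<epsilon>_def power_add[symmetric] flip: mult_2)
  have no_less: "{i. i < a} = {}" using a_min by (auto simp: not_less)
  have \<epsilon>a: "\<epsilon> a = 1" by (simp add: \<epsilon>_def no_less)
  have card_co: "card (UNIV - {j}) = CARD('n) - 1" for j :: 'n by (simp add: card_Diff_singleton)
  define F where "F j z = \<epsilon> j * f {} (UNIV - {j}) z" for j z
  have fW: "f {} (UNIV - {j}) \<in> W1" for j using W card_co[of j] by (simp add: W1_form_def)
  have fz: "W1_in l (f {} (UNIV - {j}))" for l j using fW[of j] unfolding W1_iff_W1_in by blast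
  have F: "F j \<in> W1" for j unfolding W1_iff_W1_in F_def[abs_def] by (intro allI W1_in_cmult(1) fz)
  have div: "AE z in lborel. z \<in> ?K \<longrightarrow> (\<Sum>j\<in>UNIV. d_zbar j (F j) z) = 0"
  proof -
    have "AE z in lborel. z \<in> ?K \<longrightarrow> dbar f {} UNIV z = 0"
      using closed assms(1) unfolding form_eq_on_def by simp
    moreover have "AE z in lborel. \<forall>j\<in>UNIV. d_zbar j (F j) z = \<epsilon> j * d_zbar j (f {} (UNIV - {j})) z"
      unfolding F_def[abs_def] by (rule AE_finite_allI) (auto intro: W1_in_cmult(2) fz)
    ultimately show ?thesis
      by eventually_elim (simp add: dbar_def \<epsilon>_def)
  qed
  have "compact ?K" using assms(3) by (simp add: regular_compact_def)
  then have bdd: "bounded ?K" by (rule compact_imp_bounded)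
  obtain Y where Y: "\<And>l. l \<noteq> a \<Longrightarrow> Y l \<in> W1"
    "\<And>l. l \<noteq> a \<Longrightarrow> AE z in lborel. z \<in> ?K \<longrightarrow> d_zbar a (Y l) z = F l z"
    "AE z in lborel. z \<in> ?K \<longrightarrow> - (\<Sum>l\<in>UNIV - {a}. d_zbar l (Y l) z) = F a z"
    using divergence_free_on_product[of K a F, OF assms(1) compact_imp_closed[OF assms(2)] bdd F div] by blast
  have Yz: "W1_in j (Y l)" if "l \<noteq> a" for l j using Y(1)[OF that] unfolding W1_iff_W1_in by blast
  \<comment> \<open>The index \<open>l\<close> is determined by \<open>M\<close> when \<open>M\<close> omits exactly \<open>a\<close> and
    \<open>l\<close>.\<close>
  define u :: "'n form" where
    "u I M z = (if a \<in> M \<or> card M \<noteq> CARD('n) - 2 then 0 else \<epsilon> (THE l. l \<noteq> a \<and> l \<notin> M) * Y (THE l. l \<noteq> a \<and> l \<notin> M) z)" for I M z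
  have u_a: "u I M = (\<lambda>z. 0)" if "a \<in> M" for I M using that by (simp add: u_def fun_eq_iff)
  have card2: "card (UNIV - {a, l}) = CARD('n) - 2" if "l \<noteq> a" for l
    using that by (simp add: card_Diff_subset)
  have u_l: "u I (UNIV - {a, l}) = (\<lambda>z. \<epsilon> l * Y l z)" if "l \<noteq> a" for I l
  proof -
    have "(THE k. k \<noteq> a \<and> k \<notin> UNIV - {a, l}) = l" using that by (intro the_equality) auto
    then show ?thesis using card2[OF that] by (simp add: u_def fun_eq_iff)
  qed
  have uW: "W1_form 0 (CARD('n) - 1 - 1) u"
    unfolding W1_form_def
  proof (intro allI impI)
    fix I M :: "'n set" assume M: "card M = CARD('n) - 1 - 1"
    show "u I M \<in> W1"
    proof (cases "a \<in> M")
      case True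
      then show ?thesis unfolding u_a[OF True] W1_iff_W1_in using W1_in_zero(1) by blast
    next
      case False
      have "card (UNIV - M) = 2" using M assms(1) by (simp add: card_Diff_subset)
      then obtain x y where xy: "UNIV - M = {x, y}" "x \<noteq> y" by (auto simp: card_2_iff)
      have "a \<in> UNIV - M" using False by simp
      then have "a = x \<or> a = y" using xy(1) by auto
      then obtain l where l: "UNIV - M = {a, l}" "l \<noteq> a" using xy by (metis insert_commute)
      then have "M = UNIV - {a, l}" by auto
      then show ?thesis using u_l[OF l(2)] Yz[OF l(2)] unfolding W1_iff_W1_in by (simp add: W1_in_cmult(1))
    qed
  qed
  have "form_eq_on ?K 0 (CARD('n) - 1) (dbar u) f"
    unfolding form_eq_on_def
  proof (intro allI impI)
    fix I J :: "'n set" assume "card I = 0" and J: "card J = CARD('n) - 1"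
    then have I: "I = {}" by simp
    have "card (UNIV - J) = 1" using J assms(1) by (simp add: card_Diff_subset)
    then obtain k where k: "UNIV - J = {k}" by (auto simp: card_1_singleton_iff)
    then have J: "J = UNIV - {k}" by auto
    show "AE z in lborel. z \<in> ?K \<longrightarrow> dbar u I J z = f I J z"
    proof (cases "k = a")
      case False
      have "AE z in lborel. \<forall>j\<in>UNIV - {k} - {a}. d_zbar j (u {} (UNIV - {k} - {j})) z = 0"
      proof (rule AE_finite_allI)
        fix j assume "j \<in> UNIV - {k} - {a}"
        then have "a \<in> UNIV - {k} - {j}" using False by auto
        from u_a[OF this] show "AE z in lborel. d_zbar j (u {} (UNIV - {k} - {j})) z = 0"
          using W1_in_zero(2) by simp
      qed auto
      moreover have "AE z in lborel. d_zbar a (u {} (UNIV - {k} - {a})) z = \<epsilon> k * d_zbar a (Y k) z"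
      proof -
        have "UNIV - {k} - {a} = UNIV - {a, k}" by auto
        then show ?thesis using u_l[OF False] W1_in_cmult(2)[OF Yz[OF False]] by simp
      qed
      moreover note Y(2)[OF False]
      ultimately show ?thesis
      proof eventually_elim
        case (elim z)
        show ?case
        proof
          assume z: "z \<in> ?K"
          have none: "{i \<in> UNIV - {k}. i < a} = {}" using no_less by auto
          have "dbar u I J z = (-1) ^ card {i \<in> UNIV - {k}. i < a} * d_zbar a (u {} (UNIV - {k} - {a})) z
              + (\<Sum>j\<in>UNIV - {k} - {a}. (-1) ^ card {i \<in> UNIV - {k}. i < j} * d_zbar j (u {} (UNIV - {k} - {j})) z)"
            unfolding dbar_def I J using False by (subst sum.remove[of _ a]) auto
          also have "\<dots> = \<epsilon> k * (\<epsilon> k * f {} (UNIV - {k}) z)"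
            unfolding none using elim z by (simp add: F_def)
          also have "\<dots> = f I J z" by (simp add: I J \<epsilon>2 flip: mult.assoc)
          finally show "dbar u I J z = f I J z" .
        qed
      qed
    next
      case True
      have "AE z in lborel. \<forall>j\<in>UNIV - {a}. d_zbar j (u {} (UNIV - {a} - {j})) z = \<epsilon> j * d_zbar j (Y j) z"
      proof (rule AE_finite_allI)
        fix j assume "j \<in> UNIV - {a}"
        then have j: "j \<noteq> a" by simp
        have "UNIV - {a} - {j} = UNIV - {a, j}" by auto
        then show "AE z in lborel. d_zbar j (u {} (UNIV - {a} - {j})) z = \<epsilon> j * d_zbar j (Y j) z"
          using u_l[OF j] W1_in_cmult(2)[OF Yz[OF j]] by simp
      qed auto
      then show ?thesis using Y(3)
      proof eventually_elim
        case (elim z)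
        show ?case
        proof
          assume z: "z \<in> ?K"
          have sgn: "(-1) ^ card {i \<in> UNIV - {a}. i < j} * (\<epsilon> j * w) = - w" if "j \<in> UNIV - {a}" for j w
          proof -
            have "a < j" using that a_min[of j] by (simp add: order.strict_iff_order)
            then have "{i. i < j} = insert a {i \<in> UNIV - {a}. i < j}" by auto
            then have "card {i. i < j} = Suc (card {i \<in> UNIV - {a}. i < j})" by simp
            then have "\<epsilon> j = - ((-1) ^ card {i \<in> UNIV - {a}. i < j})" by (simp add: \<epsilon>_def)
            then show ?thesis by (simp add: power_add[symmetric] flip: mult.assoc mult_2)
          qed
          have "dbar u I J z = (\<Sum>j\<in>UNIV - {a}. (-1) ^ card {i \<in> UNIV - {a}. i < j} * (\<epsilon> j * d_zbar j (Y j) z))"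
            unfolding dbar_def I J True using elim(1) by (intro sum.cong refl) simp
          also have "\<dots> = (\<Sum>j\<in>UNIV - {a}. - d_zbar j (Y j) z)"
            by (intro sum.cong refl) (rule sgn)
          also have "\<dots> = F a z" using elim(2) z by (simp add: sum_negf)
          also have "\<dots> = f I J z" by (simp add: F_def \<epsilon>a I J True)
          finally show "dbar u I J z = f I J z" .
        qed
      qed
    qed
  qed
  with uW show "\<exists>u. W1_form 0 (CARD('n) - 1 - 1) u \<and> form_eq_on ?K 0 (CARD('n) - 1) (dbar u) f"
    by blast
qed

end
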